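(* Suppose that $X$ is a holomorphic Poisson manifold with complex dimension $n$. If the Frölicher spectral sequence of its complex structure degenerates at the $E_1$-level, then its holomorphic Poisson spectral sequence degenerates at the $E_n$-level.
   Context: A holomorphic Poisson manifold is a complex manifold $X$ with a holomorphic section $\Lambda$ of $\wedge^2T^{1,0}X$ whose Schouten bracket satisfies $[\![\Lambda,\Lambda]\!]=0$. Poisson double complex and spectral sequence. Put $A^{p,q}=C^\infty(X,\wedge^pT^{1,0}X\otimes\wedge^qT^{*(0,1)}X)$ and $K^m=\bigoplus_{p+q=m}A^{p,q}$. The operator $\overline\partial:A^{p,q}\to A^{p,q+1}$ is the graded derivation (for total degree) that is the usual Dolbeault operator on functions and $(0,q)$-forms and the Cauchy–Riemann operator of the holomorphic tangent bundle on $(1,0)$-vector fields. The operator $\mathrm{ad}_\Lambda=[\![\Lambda,-]\!]:A^{p,q}\to A^{p+1,q}$ is given locally, for $\Lambda=\sum_jX_j\wedge Y_j$ with $X_j,Y_j$ holomorphic $(1,0)$-vector fields, by $\mathrm{ad}_\Lambda(v)=\sum_j(X_j\wedge\mathcal L_{Y_j}v-Y_j\wedge\mathcal L_{X_j}v)$, where $\mathcal L_Z$ is the degree-zero derivation with $\mathcal L_Zf=Zf$, $\mathcal L_ZW=[Z,W]$ for $(1,0)$-vector fields $W$, and $\mathcal L_Z\overline\omega=\iota_Zd\overline\omega$ for $(0,1)$-forms $\overline\omega$. These satisfy $\overline\partial^2=0$, $\mathrm{ad}_\Lambda^2=0$, $\overline\partial\,\mathrm{ad}_\Lambda+\mathrm{ad}_\Lambda\overline\partial=0$.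 The holomorphic Poisson spectral sequence is that of $(K^\bullet,\overline\partial+\mathrm{ad}_\Lambda)$ filtered by $F^pK^m=\bigoplus_{p'+q=m,\,p'\ge p}A^{p',q}$: here $E_1^{p,q}=H^q(X,\Theta^p)$ with $\Theta^p$ the $p$-th exterior power of the holomorphic tangent bundle, $d_1=\mathrm{ad}_\Lambda$, and $d_r:E_r^{p,q}\to E_r^{p+r,q-r+1}$. The Frölicher spectral sequence is that of the double complex $B^{p,q}=C^\infty(X,\wedge^pT^{*(1,0)}X\otimes\wedge^qT^{*(0,1)}X)$ with differentials $\partial,\overline\partial$, filtered by $p$, so its first sheet is $H^q(X,\Omega^p)$. A spectral sequence degenerates at the $E_r$-level if $d_s=0$ for all $s\ge r$. *)

theory Defs
  imports "HOL-Analysis.Analysis" "HOL-Library.Function_Algebras"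
begin

text \<open>
  Sections, local fields and elements of the exterior algebra are all functions into the complex
  numbers; they are added pointwise.
\<close>

section \<open>The spectral sequence of a double complex\<close>

text \<open>
  A double complex is given inside one ambient abelian group by its pieces \<open>A p q\<close>
  and its total differential \<open>D\<close>. All indices are integers (\<open>A p q\<close> is zero for
  negative indices in the cases of interest), so that \<open>p - r + 1\<close> and
  \<open>q - r + 1\<close> are not truncated.
  \<open>filtration A p m\<close> is \<open>F\<^sup>pK\<^sup>m\<close>; as \<open>q \<ge> 0\<close>, only the columns \<open>p \<le> p' \<le> m\<close> contribute.
\<close>

definition filtration :: "(int \<Rightarrow> int \<Rightarrow> 'k::ab_group_add set) \<Rightarrow> int \<Rightarrow> int \<Rightarrow> 'k set" where
  "filtration A p m = {\<Sum>p'\<in>{p..m}. a p' | a. \<forall>p'\<in>{p..m}. a p' \<in> A p' (m - p')}"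

definition cycles :: "(int \<Rightarrow> int \<Rightarrow> 'k::ab_group_add set) \<Rightarrow> ('k \<Rightarrow> 'k) \<Rightarrow> int \<Rightarrow> int \<Rightarrow> int \<Rightarrow> 'k set" where
  "cycles A D r p q = {x \<in> filtration A p (p + q). D x \<in> filtration A (p + r) (p + q + 1)}"

definition boundaries :: "(int \<Rightarrow> int \<Rightarrow> 'k::ab_group_add set) \<Rightarrow> ('k \<Rightarrow> 'k) \<Rightarrow> int \<Rightarrow> int \<Rightarrow> int \<Rightarrow> 'k set" where
  "boundaries A D r p q = {y + D z | y z. y \<in> cycles A D (r - 1) (p + 1) (q - 1)
                              \<and> z \<in> cycles A D (r - 1) (p - r + 1) (q + r - 2)}"

definition page_rel ::
  "(int \<Rightarrow> int \<Rightarrow> 'k::ab_group_add set) \<Rightarrow> ('k \<Rightarrow> 'k) \<Rightarrow> int \<Rightarrow> int \<Rightarrow> int \<Rightarrow> ('k \<times> 'k) set" where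
  "page_rel A D r p q = {(x, y). x \<in> cycles A D r p q \<and> y \<in> cycles A D r p q \<and> x - y \<in> boundaries A D r p q}"

definition page :: "(int \<Rightarrow> int \<Rightarrow> 'k::ab_group_add set) \<Rightarrow> ('k \<Rightarrow> 'k) \<Rightarrow> int \<Rightarrow> int \<Rightarrow> int \<Rightarrow> 'k set set" where
  "page A D r p q = cycles A D r p q // page_rel A D r p q"

definition page_zero :: "(int \<Rightarrow> int \<Rightarrow> 'k::ab_group_add set) \<Rightarrow> ('k \<Rightarrow> 'k) \<Rightarrow> int \<Rightarrow> int \<Rightarrow> int \<Rightarrow> 'k set" where
  "page_zero A D r p q = page_rel A D r p q `` {0}"

definition page_diff ::
  "(int \<Rightarrow> int \<Rightarrow> 'k::ab_group_add set) \<Rightarrow> ('k \<Rightarrow> 'k) \<Rightarrow> int \<Rightarrow> int \<Rightarrow> int \<Rightarrow> 'k set \<Rightarrow> 'k set" where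
  "page_diff A D r p q \<xi> = (\<Union>x\<in>\<xi>. page_rel A D r (p + r) (q - r + 1) `` {D x})"

definition degenerates_at :: "(int \<Rightarrow> int \<Rightarrow> 'k::ab_group_add set) \<Rightarrow> ('k \<Rightarrow> 'k) \<Rightarrow> int \<Rightarrow> bool" where
  "degenerates_at A D r \<longleftrightarrow>
     (\<forall>s\<ge>r. \<forall>p q. \<forall>\<xi>\<in>page A D s p q.
        page_diff A D s p q \<xi> = page_zero A D s (p + s) (q - s + 1))"


section \<open>Exterior algebras\<close>

text \<open>
  An element \<open>a\<close> of the exterior algebra on generators indexed by a finite linearly ordered type is
  given by its coefficients: \<open>a S\<close> is the coefficient of \<open>g\<^sub>1 \<and> \<dots> \<and> g\<^sub>k\<close>, where
  \<open>S = {g\<^sub>1 < \<dots> < g\<^sub>k}\<close>. The order serves only to fix signs.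
\<close>

type_synonym 'g ext = "'g set \<Rightarrow> complex"

definition ext_one :: "'g ext" where
  "ext_one = (\<lambda>S. if S = {} then 1 else 0)"

definition gen :: "'g \<Rightarrow> 'g ext" where
  "gen g = (\<lambda>S. if S = {g} then 1 else 0)"

definition scale :: "complex \<Rightarrow> 'g ext \<Rightarrow> 'g ext" where
  "scale c a = (\<lambda>S. c * a S)"

definition shuffle_sign :: "'g::linorder set \<Rightarrow> 'g set \<Rightarrow> complex" where
  "shuffle_sign S T = (-1) ^ card {(s, t). s \<in> S \<and> t \<in> T \<and> t < s}"

definition wedge :: "'g::{finite,linorder} ext \<Rightarrow> 'g ext \<Rightarrow> 'g ext" where
  "wedge a b = (\<lambda>S. \<Sum>T\<in>Pow S. shuffle_sign T (S - T) * a T * b (S - T))"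

text \<open>The antiderivation of degree \<open>-1\<close> with \<open>g \<mapsto> 1\<close> and \<open>h \<mapsto> 0\<close> for the generators \<open>h \<noteq> g\<close>.\<close>

definition contract :: "'g::{finite,linorder} \<Rightarrow> 'g ext \<Rightarrow> 'g ext" where
  "contract g a = (\<lambda>S. if g \<in> S then 0 else (-1) ^ card {t \<in> S. t < g} * a (insert g S))"

text \<open>The algebra homomorphism that sends each generator \<open>g\<close> to \<open>f g\<close>.\<close>

definition ext_hom :: "('g::{finite,linorder} \<Rightarrow> 'h::{finite,linorder} ext) \<Rightarrow> 'g ext \<Rightarrow> 'h ext" where
  "ext_hom f a = (\<Sum>S\<in>UNIV. scale (a S) (foldr wedge (map f (sorted_list_of_set S)) ext_one))"

text \<open>
  \<open>Anti j\<close> stands for the conjugate of \<open>dz\<^sub>j\<close>; \<open>Hol i\<close> stands for \<open>\<partial>/\<partial>z\<^sub>i\<close> in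
  the Poisson double complex and for \<open>dz\<^sub>i\<close> in the Dolbeault double complex.
\<close>

datatype 'n frame = Hol 'n | Anti 'n

instance frame :: (finite) finite
proof
  have "(UNIV :: 'a frame set) = range Hol \<union> range Anti"
    by (metis UNIV_eq_I UnI1 UnI2 frame.exhaust rangeI)
  then show "finite (UNIV :: 'a frame set)"
    by (metis finite finite_Un finite_imageI)
qed

instantiation frame :: (linorder) linorder
begin

fun less_eq_frame :: "'a frame \<Rightarrow> 'a frame \<Rightarrow> bool" where
  "less_eq_frame (Hol i) (Hol j) \<longleftrightarrow> i \<le> j"
| "less_eq_frame (Hol i) (Anti j) \<longleftrightarrow> True"
| "less_eq_frame (Anti i) (Hol j) \<longleftrightarrow> False"
| "less_eq_frame (Anti i) (Anti j) \<longleftrightarrow> i \<le> j"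

definition less_frame :: "'a frame \<Rightarrow> 'a frame \<Rightarrow> bool" where
  "less_frame x y \<longleftrightarrow> x \<le> y \<and> \<not> y \<le> x"

instance
proof
  fix x y z :: "'a frame"
  show "x < y \<longleftrightarrow> x \<le> y \<and> \<not> y \<le> x"
    by (rule less_frame_def)
  show "x \<le> x"
    by (cases x) auto
  show "x \<le> z" if "x \<le> y" "y \<le> z"
    using that by (cases x; cases y; cases z) auto
  show "x = y" if "x \<le> y" "y \<le> x"
    using that by (cases x; cases y) auto
  show "x \<le> y \<or> y \<le> x"
    by (cases x; cases y) auto
qed

end

definition has_bidegree :: "int \<Rightarrow> int \<Rightarrow> 'n frame ext \<Rightarrow> bool" where
  "has_bidegree p q a \<longleftrightarrow>
     (\<forall>S. a S \<noteq> 0 \<longrightarrow> int (card (Hol -` S)) = p \<and> int (card (Anti -` S)) = q)"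


section \<open>Calculus on open subsets of complex coordinate space\<close>

fun Ck_on :: "nat \<Rightarrow> 'v::real_normed_vector set \<Rightarrow> ('v \<Rightarrow> 'w::real_normed_vector) \<Rightarrow> bool" where
  "Ck_on 0 U f \<longleftrightarrow> continuous_on U f"
| "Ck_on (Suc k) U f \<longleftrightarrow>
     (\<forall>x\<in>U. f differentiable (at x)) \<and> (\<forall>v. Ck_on k U (\<lambda>x. frechet_derivative f (at x) v))"

definition smooth_on :: "'v::real_normed_vector set \<Rightarrow> ('v \<Rightarrow> 'w::real_normed_vector) \<Rightarrow> bool" where
  "smooth_on U f \<longleftrightarrow> (\<forall>k. Ck_on k U f)"

definition d_z :: "'n::finite \<Rightarrow> (complex ^ 'n \<Rightarrow> complex) \<Rightarrow> complex ^ 'n \<Rightarrow> complex" where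
  "d_z i f z = (frechet_derivative f (at z) (axis i 1)
                - \<i> * frechet_derivative f (at z) (axis i \<i>)) / 2"

definition d_zbar :: "'n::finite \<Rightarrow> (complex ^ 'n \<Rightarrow> complex) \<Rightarrow> complex ^ 'n \<Rightarrow> complex" where
  "d_zbar i f z = (frechet_derivative f (at z) (axis i 1)
                   + \<i> * frechet_derivative f (at z) (axis i \<i>)) / 2"

definition holo_on :: "(complex ^ 'n::finite) set \<Rightarrow> (complex ^ 'n \<Rightarrow> complex) \<Rightarrow> bool" where
  "holo_on U f \<longleftrightarrow> smooth_on U f \<and> (\<forall>z\<in>U. \<forall>i. d_zbar i f z = 0)"


section \<open>Complex manifolds\<close>

type_synonym ('a, 'n) chart = "'a set \<times> ('a \<Rightarrow> complex ^ 'n)"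

definition chart_image :: "('a, 'n) chart \<Rightarrow> (complex ^ 'n) set" where
  "chart_image c = snd c ` fst c"

definition transition :: "('a, 'n) chart \<Rightarrow> ('a, 'n) chart \<Rightarrow> complex ^ 'n \<Rightarrow> complex ^ 'n" where
  "transition c c' = snd c' \<circ> inv_into (fst c) (snd c)"

definition complex_manifold :: "'a topology \<Rightarrow> ('a, 'n::finite) chart set \<Rightarrow> bool" where
  "complex_manifold X \<A> \<longleftrightarrow>
     Hausdorff_space X \<and> second_countable X \<and>
     (\<Union>c\<in>\<A>. fst c) = topspace X \<and>
     (\<forall>c\<in>\<A>. openin X (fst c) \<and> open (chart_image c) \<and>
        homeomorphic_map (subtopology X (fst c)) (top_of_set (chart_image c)) (snd c)) \<and>
     (\<forall>c\<in>\<A>. \<forall>c'\<in>\<A>. \<forall>k.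
        holo_on (snd c ` (fst c \<inter> fst c')) (\<lambda>z. transition c c' z $ k))"

text \<open>\<open>jacobian c c' x a i\<close> is \<open>\<partial>w\<^sub>a/\<partial>z\<^sub>i\<close> at \<open>x\<close>, for coordinates \<open>z\<close> of \<open>c\<close> and \<open>w\<close> of \<open>c'\<close>.\<close>

definition jacobian :: "('a, 'n::finite) chart \<Rightarrow> ('a, 'n) chart \<Rightarrow> 'a \<Rightarrow> 'n \<Rightarrow> 'n \<Rightarrow> complex" where
  "jacobian c c' x a i = d_z i (\<lambda>z. transition c c' z $ a) (snd c x)"


section \<open>The two double complexes\<close>

text \<open>
  A section is the family of its local expressions: \<open>s c z\<close> is the value at the point with
  \<open>c\<close>-coordinates \<open>z\<close>, written in the coordinate frame of the chart \<open>c\<close>. To make the family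
  determined by the section it is set to zero where it has no meaning. On overlaps the local
  expressions are related by the change of frame \<open>G c c' x\<close>, which gives the frame of \<open>c\<close> at \<open>x\<close> in
  terms of that of \<open>c'\<close>.
\<close>

type_synonym 'n field = "complex ^ 'n \<Rightarrow> 'n frame ext"

type_synonym ('a, 'n) sect = "('a, 'n) chart \<Rightarrow> 'n field"

definition smooth_sections ::
  "(('a, 'n::{finite,linorder}) chart \<Rightarrow> ('a, 'n) chart \<Rightarrow> 'a \<Rightarrow> 'n frame \<Rightarrow> 'n frame ext) \<Rightarrow>
   ('a, 'n) chart set \<Rightarrow> int \<Rightarrow> int \<Rightarrow> ('a, 'n) sect set" where
  "smooth_sections G \<A> p q = {s.
     (\<forall>c\<in>\<A>. \<forall>S. smooth_on (chart_image c) (\<lambda>z. s c z S)) \<and>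
     (\<forall>c z. c \<notin> \<A> \<or> z \<notin> chart_image c \<longrightarrow> s c z = 0) \<and>
     (\<forall>c\<in>\<A>. \<forall>c'\<in>\<A>. \<forall>x\<in>fst c \<inter> fst c'.
        s c' (snd c' x) = ext_hom (G c c' x) (s c (snd c x))) \<and>
     (\<forall>c z. has_bidegree p q (s c z))}"

fun vector_change ::
  "('a, 'n::{finite,linorder}) chart \<Rightarrow> ('a, 'n) chart \<Rightarrow> 'a \<Rightarrow> 'n frame \<Rightarrow> 'n frame ext" where
  "vector_change c c' x (Hol i) = (\<Sum>a\<in>UNIV. scale (jacobian c c' x a i) (gen (Hol a)))"
| "vector_change c c' x (Anti j) = (\<Sum>b\<in>UNIV. scale (cnj (jacobian c' c x j b)) (gen (Anti b)))"

fun form_change ::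
  "('a, 'n::{finite,linorder}) chart \<Rightarrow> ('a, 'n) chart \<Rightarrow> 'a \<Rightarrow> 'n frame \<Rightarrow> 'n frame ext" where
  "form_change c c' x (Hol i) = (\<Sum>a\<in>UNIV. scale (jacobian c' c x i a) (gen (Hol a)))"
| "form_change c c' x (Anti j) = (\<Sum>b\<in>UNIV. scale (cnj (jacobian c' c x j b)) (gen (Anti b)))"

definition polyvector_sections ::
  "('a, 'n::{finite,linorder}) chart set \<Rightarrow> int \<Rightarrow> int \<Rightarrow> ('a, 'n) sect set" where
  "polyvector_sections = smooth_sections vector_change"

definition form_sections ::
  "('a, 'n::{finite,linorder}) chart set \<Rightarrow> int \<Rightarrow> int \<Rightarrow> ('a, 'n) sect set" where
  "form_sections = smooth_sections form_change"

text \<open>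
  The operators in one chart. The derivation \<open>\<partial>\<close>-bar kills all members of the frame
  (\<open>dz\<^sub>i\<close>, its conjugate, and \<open>\<partial>/\<partial>z\<^sub>i\<close>, which is holomorphic),
  so one formula serves for both double complexes.
\<close>

definition dbar_loc :: "'n::{finite,linorder} field \<Rightarrow> 'n field" where
  "dbar_loc v z = (\<Sum>j\<in>UNIV. wedge (gen (Anti j)) (\<lambda>S. d_zbar j (\<lambda>y. v y S) z))"

definition del_loc :: "'n::{finite,linorder} field \<Rightarrow> 'n field" where
  "del_loc v z = (\<Sum>i\<in>UNIV. wedge (gen (Hol i)) (\<lambda>S. d_z i (\<lambda>y. v y S) z))"

text \<open>\<open>(1,0)\<close>-vector fields \<open>W\<close> are fields of bidegree \<open>(1,0)\<close>, with components \<open>W z {Hol i}\<close>.\<close>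

definition vf_apply ::
  "'n::{finite,linorder} field \<Rightarrow> ((complex, 'n) vec \<Rightarrow> complex) \<Rightarrow> (complex, 'n) vec \<Rightarrow> complex" where
  "vf_apply W f z = (\<Sum>i\<in>UNIV. W z {Hol i} * d_z i f z)"

definition vf_bracket :: "'n::{finite,linorder} field \<Rightarrow> 'n field \<Rightarrow> 'n field" where
  "vf_bracket V W z = (\<Sum>i\<in>UNIV.
     scale (vf_apply V (\<lambda>y. W y {Hol i}) z - vf_apply W (\<lambda>y. V y {Hol i}) z) (gen (Hol i)))"

text \<open>
  The derivation \<open>L\<^sub>W\<close> of degree zero. Its values on the frame are
  \<open>L\<^sub>W(\<partial>/\<partial>z\<^sub>k) = [W, \<partial>/\<partial>z\<^sub>k]\<close>, and zero on the conjugate of \<open>dz\<^sub>k\<close>.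
  The latter comes from \<open>L\<^sub>W\<omega> = \<iota>\<^sub>Wd\<omega>\<close>, which for a \<open>(0,1)\<close>-form \<open>\<omega>\<close> amounts to letting
  \<open>W\<close> act on its coefficients.
\<close>

definition lie_loc :: "'n::{finite,linorder} field \<Rightarrow> 'n field \<Rightarrow> 'n field" where
  "lie_loc W v z = (\<lambda>S. vf_apply W (\<lambda>y. v y S) z) +
     (\<Sum>k\<in>UNIV. wedge (vf_bracket W (\<lambda>_. gen (Hol k)) z) (contract (Hol k) (v z)))"

definition ad_decomposable_loc ::
  "'n::{finite,linorder} field \<Rightarrow> 'n field \<Rightarrow> 'n field \<Rightarrow> 'n field" where
  "ad_decomposable_loc V W v z = wedge (V z) (lie_loc W v z) - wedge (W z) (lie_loc V v z)"

text \<open>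
  The operator \<open>v \<mapsto> [\<Lambda>, v]\<close>, by means of the decomposition
  \<open>\<Lambda> = \<Sum>\<^sub>i\<^sub><\<^sub>j (\<Lambda>\<^sub>i\<^sub>j \<partial>/\<partial>z\<^sub>i) \<and> \<partial>/\<partial>z\<^sub>j\<close>.
\<close>

definition ad_loc :: "'n::{finite,linorder} field \<Rightarrow> 'n field \<Rightarrow> 'n field" where
  "ad_loc \<Lambda> v = (\<Sum>(i, j)\<in>{(i, j). i < j}.
     ad_decomposable_loc (\<lambda>z. scale (\<Lambda> z {Hol i, Hol j}) (gen (Hol i))) (\<lambda>_. gen (Hol j)) v)"

definition chartwise ::
  "('a, 'n::finite) chart set \<Rightarrow> (('a, 'n) chart \<Rightarrow> 'n field \<Rightarrow> 'n field) \<Rightarrow>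
   ('a, 'n) sect \<Rightarrow> ('a, 'n) sect" where
  "chartwise \<A> P s = (\<lambda>c z. if c \<in> \<A> \<and> z \<in> chart_image c then P c (s c) z else 0)"

definition dbar_op :: "('a, 'n::{finite,linorder}) chart set \<Rightarrow> ('a, 'n) sect \<Rightarrow> ('a, 'n) sect" where
  "dbar_op \<A> = chartwise \<A> (\<lambda>_. dbar_loc)"

definition del_op :: "('a, 'n::{finite,linorder}) chart set \<Rightarrow> ('a, 'n) sect \<Rightarrow> ('a, 'n) sect" where
  "del_op \<A> = chartwise \<A> (\<lambda>_. del_loc)"

definition ad_op ::
  "('a, 'n::{finite,linorder}) chart set \<Rightarrow> ('a, 'n) sect \<Rightarrow> ('a, 'n) sect \<Rightarrow> ('a, 'n) sect" where
  "ad_op \<A> \<Lambda> = chartwise \<A> (\<lambda>c. ad_loc (\<Lambda> c))"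

definition holomorphic_poisson_manifold ::
  "'a topology \<Rightarrow> ('a, 'n::{finite,linorder}) chart set \<Rightarrow> ('a, 'n) sect \<Rightarrow> bool" where
  "holomorphic_poisson_manifold X \<A> \<Lambda> \<longleftrightarrow>
     complex_manifold X \<A> \<and>
     \<Lambda> \<in> polyvector_sections \<A> 2 0 \<and>
     (\<forall>c\<in>\<A>. \<forall>S. holo_on (chart_image c) (\<lambda>z. \<Lambda> c z S)) \<and>
     ad_op \<A> \<Lambda> \<Lambda> = 0"

definition frolicher_degenerates_at :: "('a, 'n::{finite,linorder}) chart set \<Rightarrow> int \<Rightarrow> bool" where
  "frolicher_degenerates_at \<A> r \<longleftrightarrow>
     degenerates_at (form_sections \<A>) (\<lambda>s. del_op \<A> s + dbar_op \<A> s) r"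

definition poisson_degenerates_at ::
  "('a, 'n::{finite,linorder}) chart set \<Rightarrow> ('a, 'n) sect \<Rightarrow> int \<Rightarrow> bool" where
  "poisson_degenerates_at \<A> \<Lambda> r \<longleftrightarrow>
     degenerates_at (polyvector_sections \<A>) (\<lambda>s. dbar_op \<A> s + ad_op \<A> \<Lambda> s) r"

end

theory Submission
  imports Defs
begin

text \<open>
  The bivector \<open>\<Lambda>\<close> induces the anchor \<open>\<Lambda>\<^sup>#\<close> from forms to polyvectors: the algebra
  homomorphism that sends \<open>dz\<^sub>j\<close> to the Hamiltonian field \<open>\<Sum>\<^sub>i \<Lambda>\<^sub>i\<^sub>j \<partial>/\<partial>z\<^sub>i\<close> and fixes the
  conjugate differentials. It commutes with \<open>\<partial>\<close>-bar because \<open>\<Lambda>\<close> is holomorphic, and it turns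
  \<open>\<partial>\<close> into \<open>ad\<^sub>\<Lambda>\<close>: both are derivations, they agree on functions, and \<open>ad\<^sub>\<Lambda>\<close> kills Hamiltonian
  fields because \<open>[\<Lambda>, \<Lambda>] = 0\<close>. So \<open>\<Lambda>\<^sup>#\<close> is a map from the Dolbeault double complex to the
  Poisson double complex, and in column \<open>0\<close>, where both consist of the \<open>(0,q)\<close>-forms, it is the
  identity.

  If the Froelicher spectral sequence degenerates at \<open>E\<^sub>1\<close>, every \<open>\<partial>\<close>-bar-closed \<open>(0,q)\<close>-form
  becomes \<open>d\<close>-closed after adding a form of positive column degree
  (\<open>closed_extension_if_degenerate\<close>). Its image under \<open>\<Lambda>\<^sup>#\<close> is a closed element of the Poisson
  complex with the same leading part (\<open>first_column_extends\<close>). Hence all differentials of the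
  Poisson spectral sequence that start in column \<open>0\<close> vanish. Since the columns run from \<open>0\<close> to
  \<open>n\<close>, a differential \<open>d\<^sub>s\<close> with \<open>s \<ge> n\<close> has no other possibly nonzero source
  (\<open>degenerates_if_first_column_extends\<close>).

  The local computations are uniform in the two complexes. In a chart both total differentials have
  the form \<open>anchor_diff P\<close>, where the matrix \<open>P\<close> of functions is the unit matrix for forms and the
  matrix of \<open>\<Lambda>\<^sup>#\<close> for polyvectors. The locale \<open>poisson_anchor\<close> isolates the identities of \<open>P\<close>
  that imply that the differential squares to zero (\<open>anchor_diff_square\<close>) and that the homomorphism
  with matrix \<open>P\<close> carries \<open>d\<close> to it (\<open>anchor_diff_matrix_hom\<close>).

  Concerning global sections, the definition of a spectral sequence already contains the fact that
  the differential of a cycle is a section, so only two statements about changes of charts are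
  needed: \<open>\<Lambda>\<^sup>#\<close> is compatible with them, by the chain rule (\<open>anchor_transform\<close>), and \<open>\<partial>\<close> sends
  global \<open>(0,q)\<close>-forms to global forms (\<open>del_loc_transform\<close>).
\<close>

section \<open>Degeneration of the spectral sequence of a double complex\<close>

text \<open>
  \<open>N\<close> is an ambient group on which \<open>D\<close> is additive with square zero. For an
  element of a piece, whether \<open>D\<close> of it lies in the filtration is decided by the definition of cycles;
  in the application this replaces the proof that \<open>D\<close> is compatible with changes of charts.
\<close>

locale double_complex =
  fixes A :: "int \<Rightarrow> int \<Rightarrow> 'k::ab_group_add set" and D :: "'k \<Rightarrow> 'k" and N :: "'k set" and n :: int
  assumes zero_piece: "0 \<in> A p q"
    and diff_piece: "x \<in> A p q \<Longrightarrow> y \<in> A p q \<Longrightarrow> x - y \<in> A p q"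
    and piece_trivial: "p < 0 \<or> n < p \<or> q < 0 \<Longrightarrow> A p q = {0}"
    and piece_ambient: "A p q \<subseteq> N"
    and diff_ambient: "x \<in> N \<Longrightarrow> y \<in> N \<Longrightarrow> x - y \<in> N"
    and D_diff: "x \<in> N \<Longrightarrow> y \<in> N \<Longrightarrow> D (x - y) = D x - D y"
    and D_D: "x \<in> N \<Longrightarrow> D (D x) = 0"
begin

lemma zero_ambient: "0 \<in> N"
  using zero_piece piece_ambient by blast

lemma add_ambient: "x \<in> N \<Longrightarrow> y \<in> N \<Longrightarrow> x + y \<in> N"
  using diff_ambient[of x "0 - y"] diff_ambient[of 0 y] zero_ambient by simp

lemma sum_ambient: "(\<And>i. i \<in> I \<Longrightarrow> f i \<in> N) \<Longrightarrow> sum f I \<in> N"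
  by (induction I rule: infinite_finite_induct) (auto simp: zero_ambient add_ambient)

lemma D_zero: "D 0 = 0"
  using D_diff[of 0 0] zero_ambient by simp

lemma filtration_ambient: "filtration A p m \<subseteq> N"
  unfolding filtration_def using piece_ambient by (auto intro!: sum_ambient)

lemma zero_filtration: "0 \<in> filtration A p m"
  unfolding filtration_def by (rule CollectI, rule exI[of _ "\<lambda>_. 0"]) (auto simp: zero_piece)

lemma diff_filtration:
  assumes "x \<in> filtration A p m" "y \<in> filtration A p m"
  shows "x - y \<in> filtration A p m"
proof -
  from assms obtain a b where "x = (\<Sum>p'\<in>{p..m}. a p')" "\<forall>p'\<in>{p..m}. a p' \<in> A p' (m - p')"
    "y = (\<Sum>p'\<in>{p..m}. b p')" "\<forall>p'\<in>{p..m}. b p' \<in> A p' (m - p')"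
    unfolding filtration_def by auto
  then show ?thesis unfolding filtration_def
    by (intro CollectI exI[of _ "\<lambda>p'. a p' - b p'"]) (auto simp: sum_subtractf diff_piece)
qed

lemma minus_filtration: "x \<in> filtration A p m \<Longrightarrow> - x \<in> filtration A p m"
  using diff_filtration[OF zero_filtration] by simp

lemma add_filtration:
  "x \<in> filtration A p m \<Longrightarrow> y \<in> filtration A p m \<Longrightarrow> x + y \<in> filtration A p m"
  using diff_filtration[OF _ minus_filtration] by simp

lemma filtration_antimono:
  assumes "p \<le> p'" shows "filtration A p' m \<subseteq> filtration A p m"
proof
  fix x assume "x \<in> filtration A p' m"
  then obtain a where a: "x = (\<Sum>i\<in>{p'..m}. a i)" "\<forall>i\<in>{p'..m}. a i \<in> A i (m - i)"
    unfolding filtration_def by auto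
  have "x = (\<Sum>i\<in>{p..m}. if p' \<le> i then a i else 0)"
    unfolding a(1) using assms by (intro sum.mono_neutral_cong_left) auto
  then show "x \<in> filtration A p m" unfolding filtration_def using a(2)
    by (intro CollectI exI[of _ "\<lambda>i. if p' \<le> i then a i else 0"]) (auto simp: zero_piece)
qed

lemma piece_filtration:
  assumes x: "x \<in> A p q" shows "x \<in> filtration A p (p + q)"
proof (cases "q < 0")
  case True
  with x piece_trivial have "x = 0" by blast
  then show ?thesis using zero_filtration by simp
next
  case False
  then have "x = (\<Sum>i\<in>{p..p+q}. if i = p then x else 0)" by (simp add: sum.delta)
  then show ?thesis unfolding filtration_def using x
    by (intro CollectI exI[of _ "\<lambda>i. if i = p then x else 0"]) (auto simp: zero_piece)
qed

lemma filtration_split: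
  assumes x: "x \<in> filtration A p m"
  obtains y where "y \<in> A p (m - p)" "x - y \<in> filtration A (p + 1) m"
proof -
  from x obtain a where a: "x = (\<Sum>i\<in>{p..m}. a i)" "\<forall>i\<in>{p..m}. a i \<in> A i (m - i)"
    unfolding filtration_def by auto
  show ?thesis
  proof (cases "p \<le> m")
    case True
    then have "{p..m} = insert p {p+1..m}" by auto
    then have "x - a p = (\<Sum>i\<in>{p+1..m}. a i)" using a(1) by simp
    then have "x - a p \<in> filtration A (p + 1) m" unfolding filtration_def using a(2) by auto
    then show ?thesis using that[of "a p"] a(2) True by auto
  next
    case False
    then have "x = 0" using a(1) by simp
    then show ?thesis using that[of 0] zero_piece zero_filtration by simp
  qed
qed

lemma filtration_before_first: "p < 0 \<Longrightarrow> filtration A p m = filtration A (p + 1) m"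
proof (intro equalityI subsetI)
  fix x assume "p < 0" "x \<in> filtration A p m"
  then obtain y where "y \<in> A p (m - p)" "x - y \<in> filtration A (p + 1) m"
    using filtration_split by blast
  then show "x \<in> filtration A (p + 1) m" using piece_trivial[of p "m - p"] \<open>p < 0\<close> by simp
qed (use filtration_antimono[of p "p + 1" m] in auto)

lemma filtration_after_last:
  assumes "n < p" shows "filtration A p m = {0}"
proof -
  have "(\<Sum>i\<in>{p..m}. a i) = 0" if "\<forall>i\<in>{p..m}. a i \<in> A i (m - i)" for a
    using that assms piece_trivial by (intro sum.neutral) auto
  then show ?thesis using zero_filtration[of p m] unfolding filtration_def by blast
qed

lemma cycles_filtration: "x \<in> cycles A D r p q \<Longrightarrow> x \<in> filtration A p (p + q)"
  by (simp add: cycles_def)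

lemma cycles_ambient: "x \<in> cycles A D r p q \<Longrightarrow> x \<in> N"
  using cycles_filtration filtration_ambient by blast

lemma zero_cycles: "0 \<in> cycles A D r p q"
  by (simp add: cycles_def zero_filtration D_zero)

lemma diff_cycles:
  assumes "x \<in> cycles A D r p q" "y \<in> cycles A D r p q"
  shows "x - y \<in> cycles A D r p q"
  using assms cycles_ambient[OF assms(1)] cycles_ambient[OF assms(2)]
  by (auto simp: cycles_def D_diff diff_filtration)

lemma D_cycles:
  assumes "x \<in> cycles A D r p q" shows "D x \<in> cycles A D r (p + r) (q - r + 1)"
proof -
  have "p + r + (q - r + 1) = p + q + 1" by simp
  then show ?thesis
    using assms D_D[OF cycles_ambient[OF assms]] unfolding cycles_def
    by (simp only: mem_Collect_eq zero_filtration simp_thms)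
qed

lemma zero_boundaries: "0 \<in> boundaries A D r p q"
  unfolding boundaries_def
  by (rule CollectI, rule exI[of _ 0], rule exI[of _ 0]) (simp add: zero_cycles D_zero)

lemma D_boundaries: "z \<in> cycles A D (r - 1) (p - r + 1) (q + r - 2) \<Longrightarrow> D z \<in> boundaries A D r p q"
  unfolding boundaries_def
  by (rule CollectI, rule exI[of _ 0], rule exI[of _ z]) (simp add: zero_cycles)

lemma diff_boundaries:
  assumes "x \<in> boundaries A D r p q" "y \<in> boundaries A D r p q"
  shows "x - y \<in> boundaries A D r p q"
proof -
  from assms obtain u v u' v' where uv: "x = u + D v" "y = u' + D v'"
    "u \<in> cycles A D (r - 1) (p + 1) (q - 1)" "u' \<in> cycles A D (r - 1) (p + 1) (q - 1)"
    "v \<in> cycles A D (r - 1) (p - r + 1) (q + r - 2)"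
    "v' \<in> cycles A D (r - 1) (p - r + 1) (q + r - 2)"
    unfolding boundaries_def by blast
  then have "x - y = (u - u') + D (v - v')"
    using D_diff[OF cycles_ambient[OF uv(5)] cycles_ambient[OF uv(6)]] by simp
  then show ?thesis using uv diff_cycles unfolding boundaries_def by blast
qed

text \<open>
  The image of a class is the union of the classes of the \<open>D x\<close>, so it equals the zero class as
  soon as every \<open>D x\<close> lies in the group of boundaries; that \<open>D x\<close> is itself a cycle is
  \<open>D_cycles\<close>.
\<close>

lemma page_diff_zeroI:
  assumes "\<xi> \<in> page A D r p q"
    and bd: "\<And>x. x \<in> cycles A D r p q \<Longrightarrow> D x \<in> boundaries A D r (p + r) (q - r + 1)"
  shows "page_diff A D r p q \<xi> = page_zero A D r (p + r) (q - r + 1)"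
proof -
  from assms(1) obtain x where x: "x \<in> cycles A D r p q" "\<xi> = page_rel A D r p q `` {x}"
    unfolding page_def quotient_def by blast
  have self: "x \<in> \<xi>" using x zero_boundaries unfolding page_rel_def by simp
  have cyc: "y \<in> cycles A D r p q" if "y \<in> \<xi>" for y
    using that x(2) unfolding page_rel_def by auto
  have "page_rel A D r (p + r) (q - r + 1) `` {D y} = page_zero A D r (p + r) (q - r + 1)"
    if "y \<in> \<xi>" for y
  proof -
    note b = bd[OF cyc[OF that]]
    have "D y - w \<in> boundaries A D r (p + r) (q - r + 1) \<longleftrightarrow>
        0 - w \<in> boundaries A D r (p + r) (q - r + 1)" (is "?l \<longleftrightarrow> ?r") for w
    proof
      assume ?l
      from diff_boundaries[OF this b] show ?r by simp
    next
      assume ?r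
      from diff_boundaries[OF b diff_boundaries[OF zero_boundaries this]] show ?l by simp
    qed
    then show ?thesis unfolding page_zero_def page_rel_def
      using D_cycles[OF cyc[OF that]] zero_cycles by auto
  qed
  then show ?thesis unfolding page_diff_def using self by blast
qed

text \<open>
  Conversely, the vanishing of \<open>d\<^sub>r\<close> on the class of \<open>x\<close> is a statement about \<open>D x\<close>, which is a
  member of the image.
\<close>

lemma boundary_if_degenerate:
  assumes deg: "degenerates_at A D r0" and "r0 \<le> r" and x: "x \<in> cycles A D r p q"
  shows "D x \<in> boundaries A D r (p + r) (q - r + 1)"
proof -
  let ?\<xi> = "page_rel A D r p q `` {x}"
  have "?\<xi> \<in> page A D r p q" unfolding page_def by (rule quotientI) (rule x)
  then have eq: "page_diff A D r p q ?\<xi> = page_zero A D r (p + r) (q - r + 1)"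
    using deg \<open>r0 \<le> r\<close> unfolding degenerates_at_def by blast
  have "x \<in> ?\<xi>" using x zero_boundaries by (simp add: page_rel_def)
  moreover have "D x \<in> page_rel A D r (p + r) (q - r + 1) `` {D x}"
    using D_cycles[OF x] zero_boundaries by (simp add: page_rel_def)
  ultimately have "D x \<in> page_zero A D r (p + r) (q - r + 1)"
    unfolding eq[symmetric] page_diff_def by blast
  then have "0 - D x \<in> boundaries A D r (p + r) (q - r + 1)"
    unfolding page_zero_def page_rel_def by blast
  then show ?thesis using diff_boundaries[OF zero_boundaries] by fastforce
qed

text \<open>
  The vanishing of \<open>d\<^sub>r\<close> allows a correction of an \<open>r\<close>-cycle to an \<open>(r+1)\<close>-cycle by an element of
  higher filtration. When the target of \<open>D\<close> has passed the last column, the cycle is closed.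
\<close>

lemma closed_extension_if_degenerate:
  assumes deg: "degenerates_at A D 1" and x: "x \<in> cycles A D 1 p q"
  obtains y where "y \<in> filtration A p (p + q)" "D y = 0" "x - y \<in> filtration A (p + 1) (p + q)"
proof -
  have step: "\<exists>y. y \<in> cycles A D (1 + int k) p q \<and> x - y \<in> filtration A (p + 1) (p + q)" for k
  proof (induction k)
    case 0
    show ?case using x zero_filtration by (intro exI[of _ x]) simp
  next
    case (Suc k)
    define r where "r = 1 + int k"
    obtain y where y: "y \<in> cycles A D r p q" "x - y \<in> filtration A (p + 1) (p + q)"
      using Suc unfolding r_def by blast
    have "D y \<in> boundaries A D r (p + r) (q - r + 1)"
      by (rule boundary_if_degenerate[OF deg _ y(1)]) (simp add: r_def)
    then obtain u v where uv: "D y = u + D v"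
      "u \<in> cycles A D (r - 1) (p + r + 1) (q - r)"
      "v \<in> cycles A D (r - 1) (p + 1) (q - 1)"
      unfolding boundaries_def by (auto simp: algebra_simps)
    \<comment> \<open>subtracting \<open>v\<close> leaves the leading part alone and pushes the differential one column further\<close>
    have v: "v \<in> filtration A (p + 1) (p + q)" using cycles_filtration[OF uv(3)] by simp
    have u: "u \<in> filtration A (p + (1 + int (Suc k))) (p + q + 1)"
      using cycles_filtration[OF uv(2)] by (simp add: r_def algebra_simps)
    have "D (y - v) = u"
      using uv(1) D_diff[OF cycles_ambient[OF y(1)] cycles_ambient[OF uv(3)]] by simp
    moreover have "y - v \<in> filtration A p (p + q)"
      using diff_filtration[OF cycles_filtration[OF y(1)]
          subsetD[OF filtration_antimono[of p "p + 1"] v]] by simp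
    ultimately have "y - v \<in> cycles A D (1 + int (Suc k)) p q"
      unfolding cycles_def using u by simp
    moreover have "x - (y - v) \<in> filtration A (p + 1) (p + q)"
      using add_filtration[OF y(2) v] by (simp add: algebra_simps)
    ultimately show ?case by blast
  qed
  obtain y where y: "y \<in> cycles A D (1 + int (nat (n - p))) p q" "x - y \<in> filtration A (p + 1) (p + q)"
    using step by blast
  have "D y = 0"
    using y(1) filtration_after_last[of "p + (1 + int (nat (n - p)))"] by (auto simp: cycles_def)
  then show ?thesis using that[OF cycles_filtration[OF y(1)] _ y(2)] by blast
qed

text \<open>
  A differential \<open>d\<^sub>s\<close> with \<open>s \<ge> n\<close> ends beyond the last column unless it starts in column \<open>0\<close>
  with \<open>s = n\<close>, or in a negative column. From a negative column \<open>p\<close>, the element \<open>x\<close> itself, seen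
  one filtration step higher, exhibits \<open>D x\<close> as a boundary. In column \<open>0\<close> the difference of \<open>x\<close>
  and a closed element with the same leading part does so.
\<close>

lemma degenerates_if_first_column_extends:
  assumes n: "1 \<le> n"
    and ext: "\<And>x q. x \<in> cycles A D 1 0 q \<Longrightarrow>
      \<exists>y. y \<in> filtration A 0 q \<and> D y = 0 \<and> x - y \<in> filtration A 1 q"
  shows "degenerates_at A D n"
  unfolding degenerates_at_def
proof (intro allI impI ballI)
  fix s p q \<xi> assume "n \<le> s" "\<xi> \<in> page A D s p q"
  show "page_diff A D s p q \<xi> = page_zero A D s (p + s) (q - s + 1)"
  proof (rule page_diff_zeroI[OF \<open>\<xi> \<in> page A D s p q\<close>])
    fix x assume x: "x \<in> cycles A D s p q"
    have idx: "p + s - s + 1 = p + 1" "q - s + 1 + s - 2 = q - 1" by simp_all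
    consider "n < p + s" | "p < 0" | "p = 0" "s = n" using \<open>n \<le> s\<close> by linarith
    then show "D x \<in> boundaries A D s (p + s) (q - s + 1)"
    proof cases
      case 1
      then have "D x = 0" using x filtration_after_last by (auto simp: cycles_def)
      then show ?thesis by (simp add: zero_boundaries)
    next
      case 2
      have "x \<in> cycles A D (s - 1) (p + 1) (q - 1)"
        using x filtration_before_first[OF 2] by (simp add: cycles_def)
      then show ?thesis using D_boundaries[of x s "p + s" "q - s + 1"] unfolding idx by blast
    next
      case 3
      have "x \<in> cycles A D 1 0 q"
        using x 3 n filtration_antimono[of 1 n "q + 1"] by (auto simp: cycles_def)
      then obtain y where y: "y \<in> filtration A 0 q" "D y = 0" "x - y \<in> filtration A 1 q"
        using ext by blast
      have "D (x - y) = D x"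
        using D_diff[OF cycles_ambient[OF x] subsetD[OF filtration_ambient y(1)]] y(2) by simp
      then have "x - y \<in> cycles A D (s - 1) (p + 1) (q - 1)"
        using x y(3) 3 by (simp add: cycles_def)
      then show ?thesis using D_boundaries[of "x - y" s "p + s" "q - s + 1"] \<open>D (x - y) = D x\<close>
        unfolding idx by metis
    qed
  qed
qed

end

section \<open>Smooth functions and their Wirtinger derivatives\<close>

lemma has_derivative_frechet:
  "f differentiable (at x) \<Longrightarrow> (f has_derivative frechet_derivative f (at x)) (at x)"
  by (simp add: frechet_derivative_works)

lemma frechet_derivative_add:
  assumes "f differentiable (at x)" "g differentiable (at x)"
  shows "frechet_derivative (\<lambda>y. f y + g y) (at x) v
    = frechet_derivative f (at x) v + frechet_derivative g (at x) v"
  using fun_cong[OF frechet_derivative_at[OF has_derivative_add[OF assms[THEN has_derivative_frechet]]]]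
  by metis

lemma frechet_derivative_mult:
  fixes f g :: "'v::real_normed_vector \<Rightarrow> 'w::real_normed_algebra"
  assumes "f differentiable (at x)" "g differentiable (at x)"
  shows "frechet_derivative (\<lambda>y. f y * g y) (at x) v
    = f x * frechet_derivative g (at x) v + frechet_derivative f (at x) v * g x"
  using fun_cong[OF frechet_derivative_at[OF has_derivative_mult[OF assms[THEN has_derivative_frechet]]]]
  by metis

lemma differentiable_cong_open:
  assumes "open U" "x \<in> U" "\<And>y. y \<in> U \<Longrightarrow> f y = g y" "f differentiable (at x)"
  shows "g differentiable (at x)"
  using assms has_derivative_transform_within_open unfolding differentiable_def by blast

lemma frechet_derivative_cong_open:
  assumes "open U" "x \<in> U" "\<And>y. y \<in> U \<Longrightarrow> f y = g y"
  shows "frechet_derivative f (at x) = frechet_derivative g (at x)"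
proof -
  have "(f has_derivative f') (at x) \<longleftrightarrow> (g has_derivative f') (at x)" for f'
    using has_derivative_transform_within_open[of f f' x UNIV U g]
      has_derivative_transform_within_open[of g f' x UNIV U f] assms by auto
  then show ?thesis by (simp add: frechet_derivative_def)
qed

lemma Ck_on_cong:
  assumes U: "open U"
  shows "(\<And>x. x \<in> U \<Longrightarrow> f x = g x) \<Longrightarrow> Ck_on k U f \<Longrightarrow> Ck_on k U g"
proof (induction k arbitrary: f g)
  case 0
  then show ?case using continuous_on_cong[of U U f g] by simp
next
  case (Suc k)
  have "Ck_on k U (\<lambda>x. frechet_derivative g (at x) v)" for v
    by (rule Suc.IH[of "\<lambda>x. frechet_derivative f (at x) v"])
       (use Suc.prems frechet_derivative_cong_open[OF U, of _ f g] in auto)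
  then show ?case
    using Suc.prems differentiable_cong_open[OF U, of _ f g] by auto
qed

lemma Ck_on_Suc_D: "Ck_on (Suc k) U f \<Longrightarrow> Ck_on k U f"
proof (induction k arbitrary: f)
  case 0
  then show ?case
    by (auto intro!: continuous_at_imp_continuous_on differentiable_imp_continuous_within)
next
  case (Suc k)
  then have "\<forall>x\<in>U. f differentiable (at x)" "\<forall>v. Ck_on k U (\<lambda>x. frechet_derivative f (at x) v)"
    by (auto simp del: Ck_on.simps(2) simp: Ck_on.simps(2)[of "Suc k"])
  then show ?case by simp
qed

lemma Ck_on_const: "Ck_on k U (\<lambda>x. c)"
  by (induction k arbitrary: c) auto

lemma Ck_on_add:
  assumes U: "open U"
  shows "Ck_on k U f \<Longrightarrow> Ck_on k U g \<Longrightarrow> Ck_on k U (\<lambda>x. f x + g x)"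
proof (induction k arbitrary: f g)
  case 0
  then show ?case by (simp add: continuous_on_add)
next
  case (Suc k)
  have "Ck_on k U (\<lambda>x. frechet_derivative (\<lambda>y. f y + g y) (at x) v)" for v
    by (rule Ck_on_cong[OF U _ Suc.IH[of "\<lambda>x. frechet_derivative f (at x) v"
          "\<lambda>x. frechet_derivative g (at x) v"]])
       (use Suc.prems in \<open>auto simp: frechet_derivative_add\<close>)
  then show ?case using Suc.prems by auto
qed

lemma Ck_on_mult:
  fixes f g :: "'v::real_normed_vector \<Rightarrow> 'w::real_normed_algebra"
  assumes U: "open U"
  shows "Ck_on k U f \<Longrightarrow> Ck_on k U g \<Longrightarrow> Ck_on k U (\<lambda>x. f x * g x)"
proof (induction k arbitrary: f g)
  case 0
  then show ?case by (simp add: continuous_on_mult)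
next
  case (Suc k)
  have "Ck_on k U (\<lambda>x. frechet_derivative (\<lambda>y. f y * g y) (at x) v)" for v
    by (rule Ck_on_cong[OF U _ Ck_on_add[OF U Suc.IH[of f "\<lambda>x. frechet_derivative g (at x) v"]
          Suc.IH[of "\<lambda>x. frechet_derivative f (at x) v" g]]])
       (use Suc.prems Ck_on_Suc_D[of k U] in \<open>auto simp: frechet_derivative_mult\<close>)
  then show ?case using Suc.prems by (auto intro: differentiable_mult)
qed

lemma smooth_on_cong:
  "open U \<Longrightarrow> (\<And>x. x \<in> U \<Longrightarrow> f x = g x) \<Longrightarrow> smooth_on U f \<Longrightarrow> smooth_on U g"
  unfolding smooth_on_def using Ck_on_cong by blast

lemma smooth_on_const: "smooth_on U (\<lambda>x. c)"
  by (simp add: smooth_on_def Ck_on_const)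

lemma smooth_on_add: "open U \<Longrightarrow> smooth_on U f \<Longrightarrow> smooth_on U g \<Longrightarrow> smooth_on U (\<lambda>x. f x + g x)"
  by (simp add: smooth_on_def Ck_on_add)

lemma smooth_on_mult:
  fixes f g :: "'v::real_normed_vector \<Rightarrow> 'w::real_normed_algebra"
  shows "open U \<Longrightarrow> smooth_on U f \<Longrightarrow> smooth_on U g \<Longrightarrow> smooth_on U (\<lambda>x. f x * g x)"
  by (simp add: smooth_on_def Ck_on_mult)

lemma smooth_on_sum:
  "open U \<Longrightarrow> (\<And>i. i \<in> I \<Longrightarrow> smooth_on U (f i)) \<Longrightarrow> smooth_on U (\<lambda>x. \<Sum>i\<in>I. f i x)"
  by (induction I rule: infinite_finite_induct) (auto simp: smooth_on_const smooth_on_add)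

lemma smooth_on_differentiable: "smooth_on U f \<Longrightarrow> x \<in> U \<Longrightarrow> f differentiable (at x)"
  unfolding smooth_on_def using Ck_on.simps(2)[of 0 U f] by blast

lemma smooth_on_derivative: "smooth_on U f \<Longrightarrow> smooth_on U (\<lambda>x. frechet_derivative f (at x) v)"
  unfolding smooth_on_def using Ck_on.simps(2) by blast

lemma smooth_on_continuous: "smooth_on U f \<Longrightarrow> continuous_on U f"
  unfolding smooth_on_def using Ck_on.simps(1) by blast

lemma frechet_derivative_bounded_linear:
  assumes "bounded_linear L" "f differentiable (at x)"
  shows "frechet_derivative (\<lambda>y. L (f y)) (at x) v = L (frechet_derivative f (at x) v)"
  using fun_cong[OF frechet_derivative_at[OF bounded_linear.has_derivative[OF assms(1)
    has_derivative_frechet[OF assms(2)]]]] by metis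

lemma differentiable_bounded_linear:
  "bounded_linear L \<Longrightarrow> f differentiable (at x) \<Longrightarrow> (\<lambda>y. L (f y)) differentiable (at x)"
  unfolding differentiable_def using bounded_linear.has_derivative by blast

lemma smooth_on_bounded_linear:
  assumes U: "open U" and L: "bounded_linear L" and f: "smooth_on U f"
  shows "smooth_on U (\<lambda>x. L (f x))"
proof -
  have "Ck_on k U f \<Longrightarrow> Ck_on k U (\<lambda>x. L (f x))" for k
  proof (induction k arbitrary: f)
    case 0
    then show ?case by (simp add: bounded_linear.continuous_on[OF L])
  next
    case (Suc k)
    have "Ck_on k U (\<lambda>x. frechet_derivative (\<lambda>y. L (f y)) (at x) v)" for v
      by (rule Ck_on_cong[OF U _ Suc.IH[of "\<lambda>x. frechet_derivative f (at x) v"]])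
         (use Suc.prems in \<open>auto simp: frechet_derivative_bounded_linear[OF L]\<close>)
    then show ?case using Suc.prems by (auto intro: differentiable_bounded_linear[OF L])
  qed
  then show ?thesis using f by (simp add: smooth_on_def)
qed

lemma frechet_derivative_along_line:
  fixes f :: "'v::real_normed_vector \<Rightarrow> real"
  assumes "f differentiable (at (a + s *\<^sub>R u))"
  shows "((\<lambda>s. f (a + s *\<^sub>R u)) has_real_derivative frechet_derivative f (at (a + s *\<^sub>R u)) u) (at s)"
proof -
  have "((\<lambda>s. f (a + s *\<^sub>R u)) has_derivative
      (\<lambda>h. frechet_derivative f (at (a + s *\<^sub>R u)) (h *\<^sub>R u))) (at s)"
    by (rule has_derivative_compose[where f = "\<lambda>s. a + s *\<^sub>R u" and s = UNIV, OF _ has_derivative_frechet[OF assms]])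
       (auto intro!: derivative_eq_intros)
  moreover have "(\<lambda>h. frechet_derivative f (at (a + s *\<^sub>R u)) (h *\<^sub>R u))
      = (*) (frechet_derivative f (at (a + s *\<^sub>R u)) u)"
    using linear_cmul[OF has_derivative_linear[OF has_derivative_frechet[OF assms]]]
    by (simp add: fun_eq_iff mult.commute)
  ultimately show ?thesis by (simp add: has_field_derivative_def)
qed

text \<open>
  The symmetry of second derivatives is shown by the classical argument with the second difference
  over a small parallelogram: two applications of the mean value theorem express it by the iterated
  derivative at an intermediate point. The second difference is symmetric in the two directions.
\<close>

lemma second_difference_mean_value:
  fixes f :: "'v::real_normed_vector \<Rightarrow> real"
  assumes f: "smooth_on U f" and "0 < t"
    and sub: "\<And>r s. 0 \<le> r \<Longrightarrow> r \<le> t \<Longrightarrow> 0 \<le> s \<Longrightarrow> s \<le> t \<Longrightarrow> x + s *\<^sub>R u + r *\<^sub>R v \<in> U"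
  shows "\<exists>r s. 0 < r \<and> r < t \<and> 0 < s \<and> s < t \<and>
    f (x + t *\<^sub>R u + t *\<^sub>R v) - f (x + t *\<^sub>R u) - (f (x + t *\<^sub>R v) - f x)
    = t * (t * frechet_derivative (\<lambda>y. frechet_derivative f (at y) u) (at (x + s *\<^sub>R u + r *\<^sub>R v)) v)"
proof -
  let ?fu = "\<lambda>y. frechet_derivative f (at y) u"
  let ?g = "\<lambda>s. f (x + t *\<^sub>R v + s *\<^sub>R u) - f (x + s *\<^sub>R u)"
  have "\<exists>s>0. s < t \<and> ?g t - ?g 0 = (t - 0) * (?fu (x + t *\<^sub>R v + s *\<^sub>R u) - ?fu (x + s *\<^sub>R u))"
    using \<open>0 < t\<close>
  proof (intro MVT2)
    fix s assume s: "0 \<le> s" "s \<le> t"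
    have "x + t *\<^sub>R v + s *\<^sub>R u \<in> U" "x + s *\<^sub>R u \<in> U"
      using sub[of t s] sub[of 0 s] s by (auto simp: algebra_simps)
    then show "(?g has_real_derivative ?fu (x + t *\<^sub>R v + s *\<^sub>R u) - ?fu (x + s *\<^sub>R u)) (at s)"
      by (intro DERIV_diff frechet_derivative_along_line smooth_on_differentiable[OF f])
  qed
  then obtain s where s: "0 < s" "s < t"
    "?g t - ?g 0 = t * (?fu (x + t *\<^sub>R v + s *\<^sub>R u) - ?fu (x + s *\<^sub>R u))" by auto
  let ?h = "\<lambda>r. ?fu (x + s *\<^sub>R u + r *\<^sub>R v)"
  have "\<exists>r>0. r < t \<and> ?h t - ?h 0 = (t - 0) * frechet_derivative ?fu (at (x + s *\<^sub>R u + r *\<^sub>R v)) v"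
    using \<open>0 < t\<close>
  proof (intro MVT2)
    fix r assume r: "0 \<le> r" "r \<le> t"
    then show "(?h has_real_derivative frechet_derivative ?fu (at (x + s *\<^sub>R u + r *\<^sub>R v)) v) (at r)"
      using sub[of r s] s
      by (intro frechet_derivative_along_line smooth_on_differentiable[OF smooth_on_derivative[OF f]])
        auto
  qed
  then obtain r where r: "0 < r" "r < t"
    "?h t - ?h 0 = t * frechet_derivative ?fu (at (x + s *\<^sub>R u + r *\<^sub>R v)) v" by auto
  have "?g t - ?g 0 = t * (?h t - ?h 0)" using s(3) by (simp add: algebra_simps)
  then show ?thesis using r s(1,2) by (intro exI[of _ r] exI[of _ s]) (simp add: algebra_simps)
qed

lemma frechet_derivative_commute_real:
  fixes f :: "'v::real_normed_vector \<Rightarrow> real"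
  assumes U: "open U" and f: "smooth_on U f" and x: "x \<in> U"
  shows "frechet_derivative (\<lambda>y. frechet_derivative f (at y) u) (at x) v
       = frechet_derivative (\<lambda>y. frechet_derivative f (at y) v) (at x) u"
    (is "?F x = ?G x")
proof (rule ccontr)
  assume ne: "?F x \<noteq> ?G x"
  define e where "e = \<bar>?F x - ?G x\<bar> / 2"
  have "e > 0" using ne by (simp add: e_def)
  have near: "\<exists>d>0. \<forall>y\<in>U. dist y x < d \<longrightarrow> dist (h y) (h x) < e" if "smooth_on U h" for h :: "'v \<Rightarrow> real"
    using smooth_on_continuous[OF that] x \<open>e > 0\<close> unfolding continuous_on_iff by blast
  obtain d1 where d1: "d1 > 0" "\<And>y. y \<in> U \<Longrightarrow> dist y x < d1 \<Longrightarrow> dist (?F y) (?F x) < e"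
    using near[OF smooth_on_derivative[OF smooth_on_derivative[OF f]]] by blast
  obtain d2 where d2: "d2 > 0" "\<And>y. y \<in> U \<Longrightarrow> dist y x < d2 \<Longrightarrow> dist (?G y) (?G x) < e"
    using near[OF smooth_on_derivative[OF smooth_on_derivative[OF f]]] by blast
  obtain d3 where d3: "d3 > 0" "ball x d3 \<subseteq> U" using U x openE by blast
  define d where "d = min d1 (min d2 d3)"
  define M where "M = norm u + norm v + 1"
  define t where "t = d / (2 * M)"
  have "M > 0" using norm_ge_zero[of u] norm_ge_zero[of v] unfolding M_def by linarith
  have "d > 0" using d1 d2 d3 by (simp add: d_def)
  then have "t > 0" using \<open>M > 0\<close> by (simp add: t_def)
  have close: "dist (x + s *\<^sub>R u + r *\<^sub>R v) x < d" if "0 \<le> r" "r \<le> t" "0 \<le> s" "s \<le> t" for r s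
  proof -
    have "dist (x + s *\<^sub>R u + r *\<^sub>R v) x = norm (s *\<^sub>R u + r *\<^sub>R v)" by (simp add: dist_norm algebra_simps)
    also have "\<dots> \<le> s * norm u + r * norm v"
      using norm_triangle_ineq[of "s *\<^sub>R u" "r *\<^sub>R v"] that by simp
    also have "\<dots> \<le> t * norm u + t * norm v"
      using that by (intro add_mono mult_right_mono) auto
    also have "\<dots> \<le> t * M" using \<open>t > 0\<close> by (simp add: M_def algebra_simps)
    also have "\<dots> = d / 2" using \<open>M > 0\<close> by (simp add: t_def)
    finally show ?thesis using \<open>d > 0\<close> by simp
  qed
  have inU: "x + s *\<^sub>R u + r *\<^sub>R v \<in> U" if "0 \<le> r" "r \<le> t" "0 \<le> s" "s \<le> t" for r s
    using close[OF that] d3(2) by (auto simp: d_def dist_commute subset_iff)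
  obtain r s where rs: "0 < r" "r < t" "0 < s" "s < t"
    "f (x + t *\<^sub>R u + t *\<^sub>R v) - f (x + t *\<^sub>R u) - (f (x + t *\<^sub>R v) - f x)
      = t * (t * ?F (x + s *\<^sub>R u + r *\<^sub>R v))"
    using second_difference_mean_value[OF f \<open>t > 0\<close> inU] by blast
  have inU': "x + s *\<^sub>R v + r *\<^sub>R u \<in> U" if "0 \<le> r" "r \<le> t" "0 \<le> s" "s \<le> t" for r s
    using inU[OF that(3,4,1,2)] by (simp add: algebra_simps)
  obtain r' s' where rs': "0 < r'" "r' < t" "0 < s'" "s' < t"
    "f (x + t *\<^sub>R v + t *\<^sub>R u) - f (x + t *\<^sub>R v) - (f (x + t *\<^sub>R u) - f x)
      = t * (t * ?G (x + s' *\<^sub>R v + r' *\<^sub>R u))"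
    using second_difference_mean_value[OF f \<open>t > 0\<close> inU'] by blast
  have "t * (t * ?F (x + s *\<^sub>R u + r *\<^sub>R v)) = t * (t * ?G (x + s' *\<^sub>R v + r' *\<^sub>R u))"
    using rs(5) rs'(5) by (simp add: algebra_simps)
  then have eq: "?F (x + s *\<^sub>R u + r *\<^sub>R v) = ?G (x + r' *\<^sub>R u + s' *\<^sub>R v)"
    using \<open>t > 0\<close> by (simp add: algebra_simps)
  have "dist (?F (x + s *\<^sub>R u + r *\<^sub>R v)) (?F x) < e"
    using d1(2) inU[of r s] close[of r s] rs by (simp add: d_def)
  moreover have "dist (?G (x + r' *\<^sub>R u + s' *\<^sub>R v)) (?G x) < e"
    using d2(2) inU[of s' r'] close[of s' r'] rs' by (simp add: d_def)
  ultimately have "\<bar>?F x - ?G x\<bar> < 2 * e" unfolding eq dist_real_def by linarith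
  then show False by (simp add: e_def)
qed

lemma frechet_derivative_commute:
  fixes f :: "'v::real_normed_vector \<Rightarrow> complex"
  assumes U: "open U" and f: "smooth_on U f" and x: "x \<in> U"
  shows "frechet_derivative (\<lambda>y. frechet_derivative f (at y) u) (at x) v
       = frechet_derivative (\<lambda>y. frechet_derivative f (at y) v) (at x) u"
proof -
  have part: "frechet_derivative (\<lambda>y. frechet_derivative (\<lambda>z. L (f z)) (at y) a) (at x) b
      = L (frechet_derivative (\<lambda>y. frechet_derivative f (at y) a) (at x) b)"
    if L: "bounded_linear L" for L :: "complex \<Rightarrow> real" and a b
  proof -
    have "frechet_derivative (\<lambda>y. frechet_derivative (\<lambda>z. L (f z)) (at y) a) (at x) b
        = frechet_derivative (\<lambda>y. L (frechet_derivative f (at y) a)) (at x) b"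
      by (subst frechet_derivative_cong_open[OF U x,
            of _ "\<lambda>y. L (frechet_derivative f (at y) a)"])
         (auto simp: frechet_derivative_bounded_linear[OF L] smooth_on_differentiable[OF f])
    also have "\<dots> = L (frechet_derivative (\<lambda>y. frechet_derivative f (at y) a) (at x) b)"
      by (rule frechet_derivative_bounded_linear[OF L
            smooth_on_differentiable[OF smooth_on_derivative[OF f] x]])
    finally show ?thesis .
  qed
  show ?thesis
    using frechet_derivative_commute_real[OF U smooth_on_bounded_linear[OF U bounded_linear_Re f] x, of u v]
      frechet_derivative_commute_real[OF U smooth_on_bounded_linear[OF U bounded_linear_Im f] x, of u v]
    unfolding part[OF bounded_linear_Re] part[OF bounded_linear_Im] by (rule complex_eqI)
qed

text \<open>
  The operators \<open>d_z\<close> and \<open>d_zbar\<close> are indexed jointly by the frame, so that sums over all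
  coordinate derivatives become sums over the type of frame members.
\<close>

fun wirtinger :: "'n::finite frame \<Rightarrow> (complex ^ 'n \<Rightarrow> complex) \<Rightarrow> complex ^ 'n \<Rightarrow> complex" where
  "wirtinger (Hol i) = d_z i"
| "wirtinger (Anti i) = d_zbar i"

text \<open>
  Both kinds of derivative are combinations of two real directional derivatives of the same shape;
  facts that hold for all values of the constant \<open>c\<close> need no distinction between them.
\<close>

lemma wirtinger_formula:
  obtains i c where "\<And>f z. wirtinger g f z =
    1/2 * (frechet_derivative f (at z) (axis i 1) + c * frechet_derivative f (at z) (axis i \<i>))"
proof (cases g)
  case (Hol i)
  then show ?thesis using that[of i "- \<i>"] by (simp add: d_z_def)
next
  case (Anti i)
  then show ?thesis using that[of i "\<i>"] by (simp add: d_zbar_def)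
qed

lemma wirtinger_cong:
  assumes "open U" "z \<in> U" "\<And>y. y \<in> U \<Longrightarrow> f y = h y"
  shows "wirtinger g f z = wirtinger g h z"
proof -
  note eq = frechet_derivative_cong_open[of U z f h, OF assms]
  show ?thesis using eq by (cases g) (simp_all add: d_z_def d_zbar_def)
qed

lemma wirtinger_const [simp]: "wirtinger g (\<lambda>y. c) z = 0"
  by (cases g) (simp_all add: d_z_def d_zbar_def)

declare wirtinger.simps [simp del]

lemma wirtinger_add:
  assumes "f differentiable (at z)" "h differentiable (at z)"
  shows "wirtinger g (\<lambda>y. f y + h y) z = wirtinger g f z + wirtinger g h z"
proof -
  obtain i c where g: "\<And>f z. wirtinger g f z =
    1/2 * (frechet_derivative f (at z) (axis i 1) + c * frechet_derivative f (at z) (axis i \<i>))"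
    using wirtinger_formula by blast
  show ?thesis unfolding g frechet_derivative_add[OF assms] by (simp add: algebra_simps)
qed

lemma wirtinger_mult:
  assumes "f differentiable (at z)" "h differentiable (at z)"
  shows "wirtinger g (\<lambda>y. f y * h y) z = f z * wirtinger g h z + wirtinger g f z * h z"
proof -
  obtain i c where g: "\<And>f z. wirtinger g f z =
    1/2 * (frechet_derivative f (at z) (axis i 1) + c * frechet_derivative f (at z) (axis i \<i>))"
    using wirtinger_formula by blast
  show ?thesis unfolding g frechet_derivative_mult[OF assms] by (simp add: algebra_simps)
qed

lemma wirtinger_cmult:
  assumes "f differentiable (at z)"
  shows "wirtinger g (\<lambda>y. c * f y) z = c * wirtinger g f z"
  using wirtinger_mult[of "\<lambda>_. c" z f g] assms by simp

lemma wirtinger_sum: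
  assumes "\<And>i. i \<in> I \<Longrightarrow> f i differentiable (at z)"
  shows "wirtinger g (\<lambda>y. \<Sum>i\<in>I. f i y) z = (\<Sum>i\<in>I. wirtinger g (f i) z)"
  using assms
proof (induction I rule: infinite_finite_induct)
  case (insert i I)
  then have "(\<lambda>y. \<Sum>i\<in>I. f i y) differentiable (at z)" by (intro differentiable_sum) auto
  then show ?case using insert by (simp add: wirtinger_add)
qed auto

lemma smooth_on_wirtinger:
  assumes U: "open U" and f: "smooth_on U f"
  shows "smooth_on U (wirtinger g f)"
proof -
  obtain i c where g: "\<And>f z. wirtinger g f z =
    1/2 * (frechet_derivative f (at z) (axis i 1) + c * frechet_derivative f (at z) (axis i \<i>))"
    using wirtinger_formula by blast
  have "smooth_on U (\<lambda>z. 1/2 * (frechet_derivative f (at z) (axis i 1)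
      + c * frechet_derivative f (at z) (axis i \<i>)))"
    by (intro smooth_on_mult smooth_on_add smooth_on_const smooth_on_derivative f U)
  then show ?thesis by (simp add: g[abs_def])
qed

lemma wirtinger_commute:
  assumes U: "open U" and f: "smooth_on U f" and z: "z \<in> U"
  shows "wirtinger g (wirtinger h f) z = wirtinger h (wirtinger g f) z"
proof -
  obtain i c where g: "\<And>f z. wirtinger g f z =
    1/2 * (frechet_derivative f (at z) (axis i 1) + c * frechet_derivative f (at z) (axis i \<i>))"
    using wirtinger_formula by blast
  obtain j d where h: "\<And>f z. wirtinger h f z =
    1/2 * (frechet_derivative f (at z) (axis j 1) + d * frechet_derivative f (at z) (axis j \<i>))"
    using wirtinger_formula by blast
  let ?D = "\<lambda>u v. frechet_derivative (\<lambda>y. frechet_derivative f (at y) u) (at z) v"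
  have dif: "(\<lambda>y. frechet_derivative f (at y) u) differentiable (at z)" for u
    by (rule smooth_on_differentiable[OF smooth_on_derivative[OF f] z])
  have expand: "frechet_derivative (\<lambda>y. 1/2 * (frechet_derivative f (at y) u
      + b * frechet_derivative f (at y) v)) (at z) w = 1/2 * (?D u w + b * ?D v w)" for u v w b
    using frechet_derivative_mult[OF differentiable_const[of "1/2"]
        differentiable_add[OF dif differentiable_mult[OF differentiable_const[of b] dif]]]
      frechet_derivative_add[OF dif differentiable_mult[OF differentiable_const[of b] dif]]
      frechet_derivative_mult[OF differentiable_const[of b] dif]
    by simp
  show ?thesis
    unfolding g[abs_def] h[abs_def] expand
    using frechet_derivative_commute[OF U f z] by (simp add: algebra_simps)
qed

lemma d_z_cnj: "f differentiable (at z) \<Longrightarrow> d_z i (\<lambda>y. cnj (f y)) z = cnj (d_zbar i f z)"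
  by (simp add: d_z_def d_zbar_def frechet_derivative_bounded_linear[OF bounded_linear_cnj])

text \<open>
  A real linear map splits into a complex linear and an antilinear part. The left-hand side is the
  complex linear part at \<open>u\<close>, and it is determined by its values on the basis vectors.
\<close>

lemma real_linear_wirtinger:
  fixes L :: "complex ^ 'n \<Rightarrow> complex"
  assumes L: "linear L"
  shows "(L u - \<i> * L (\<i> *s u)) / 2 = (\<Sum>a\<in>UNIV. u $ a * ((L (axis a 1) - \<i> * L (axis a \<i>)) / 2))"
proof -
  have ax: "L (axis a c) = of_real (Re c) * L (axis a 1) + of_real (Im c) * L (axis a \<i>)" for a c
  proof -
    have "axis a c = Re c *\<^sub>R axis a 1 + Im c *\<^sub>R axis a \<i>"
      by (auto simp: vec_eq_iff axis_def complex_eq_iff)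
    then show ?thesis using linear_add[OF L] linear_cmul[OF L] by (simp add: scaleR_conv_of_real)
  qed
  have comps: "L v = (\<Sum>a\<in>UNIV. L (axis a (v $ a)))" for v
  proof -
    have "v = (\<Sum>a\<in>UNIV. axis a (v $ a))"
      by (auto simp: vec_eq_iff axis_def if_distrib cong: if_cong)
    then show ?thesis using linear_sum[OF L, of "\<lambda>a. axis a (v $ a)" UNIV] by simp
  qed
  have exp: "L v = (\<Sum>a\<in>UNIV. of_real (Re (v $ a)) * L (axis a 1) + of_real (Im (v $ a)) * L (axis a \<i>))" for v
    unfolding comps[of v] by (rule sum.cong[OF refl ax])
  have "(L u - \<i> * L (\<i> *s u)) / 2 = (\<Sum>a\<in>UNIV.
     ((of_real (Re (u $ a)) * L (axis a 1) + of_real (Im (u $ a)) * L (axis a \<i>))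
      - \<i> * (of_real (Re ((\<i> *s u) $ a)) * L (axis a 1) + of_real (Im ((\<i> *s u) $ a)) * L (axis a \<i>))) / 2)"
    by (subst exp[of u], subst exp[of "\<i> *s u"])
       (simp only: sum_divide_distrib sum_distrib_left sum_subtractf[symmetric])
  also have "\<dots> = (\<Sum>a\<in>UNIV. u $ a * ((L (axis a 1) - \<i> * L (axis a \<i>)) / 2))"
  proof (rule sum.cong[OF refl])
    fix a
    have alg: "((r * x + m * y) - \<i> * (- m * x + r * y)) / 2 = (r + \<i> * m) * ((x - \<i> * y) / 2)"
      for r m x y :: complex
      by (simp add: algebra_simps)
    have "Re ((\<i> *s u) $ a) = - Im (u $ a)" "Im ((\<i> *s u) $ a) = Re (u $ a)" by simp_all
    then show "((of_real (Re (u $ a)) * L (axis a 1) + of_real (Im (u $ a)) * L (axis a \<i>))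
      - \<i> * (of_real (Re ((\<i> *s u) $ a)) * L (axis a 1) + of_real (Im ((\<i> *s u) $ a)) * L (axis a \<i>))) / 2
      = u $ a * ((L (axis a 1) - \<i> * L (axis a \<i>)) / 2)"
      using alg[of "of_real (Re (u $ a))" "L (axis a 1)" "of_real (Im (u $ a))" "L (axis a \<i>)"]
        complex_eq[of "u $ a"] by (simp only: of_real_minus)
  qed
  finally show ?thesis .
qed

lemma has_derivative_vec:
  fixes \<tau> :: "'v::real_normed_vector \<Rightarrow> complex ^ 'm::finite"
  assumes "\<And>k. (\<lambda>y. \<tau> y $ k) differentiable (at w)"
  shows "(\<tau> has_derivative (\<lambda>v. \<chi> k. frechet_derivative (\<lambda>y. \<tau> y $ k) (at w) v)) (at w)"
    (is "(_ has_derivative ?T) _")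
proof -
  have part: "((\<lambda>y. \<tau> y $ k) has_derivative (\<lambda>v. ?T v $ k)) (at w)" for k
    using has_derivative_frechet[OF assms[of k]] by simp
  have "((\<lambda>y. \<tau> y \<bullet> b) has_derivative (\<lambda>v. ?T v \<bullet> b)) (at w)" if "b \<in> Basis" for b
  proof -
    from that obtain k c where b: "b = axis k c" by (auto simp: Basis_vec_def)
    show ?thesis unfolding b inner_axis by (rule has_derivative_inner_left) (rule part)
  qed
  then show ?thesis by (subst has_derivative_componentwise_within) simp
qed

text \<open>
  As \<open>\<tau>\<close> is holomorphic, its derivative is complex linear, so only the derivatives \<open>d_z\<close> of \<open>f\<close>
  contribute to the chain rule, although \<open>f\<close> is merely smooth.
\<close>

lemma d_z_compose_holomorphic:
  fixes \<tau> :: "complex ^ 'n::finite \<Rightarrow> complex ^ 'm::finite"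
  assumes f: "f differentiable (at (\<tau> w))"
    and \<tau>: "\<And>k. (\<lambda>y. \<tau> y $ k) differentiable (at w)" and holo: "\<And>k. d_zbar i (\<lambda>y. \<tau> y $ k) w = 0"
  shows "d_z i (\<lambda>y. f (\<tau> y)) w = (\<Sum>a\<in>UNIV. d_z a f (\<tau> w) * d_z i (\<lambda>y. \<tau> y $ a) w)"
proof -
  let ?L = "frechet_derivative f (at (\<tau> w))"
  define T where "T v = (\<chi> k. frechet_derivative (\<lambda>y. \<tau> y $ k) (at w) v)" for v
  have "(\<tau> has_derivative T) (at w)"
    unfolding T_def[abs_def] by (rule has_derivative_vec[OF \<tau>])
  then have "((\<lambda>y. f (\<tau> y)) has_derivative (\<lambda>v. ?L (T v))) (at w)"
    by (rule has_derivative_compose[where f = \<tau> and s = UNIV, OF _ has_derivative_frechet[OF f]])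
  then have comp: "frechet_derivative (\<lambda>y. f (\<tau> y)) (at w) v = ?L (T v)" for v
    using frechet_derivative_at by metis
  define u where "u = T (axis i 1)"
  \<comment> \<open>the Cauchy-Riemann equations\<close>
  have cr: "T (axis i \<i>) = \<i> *s u"
  proof -
    have "frechet_derivative (\<lambda>y. \<tau> y $ k) (at w) (axis i 1)
      = - \<i> * frechet_derivative (\<lambda>y. \<tau> y $ k) (at w) (axis i \<i>)" for k
      using holo[of k] by (simp add: d_zbar_def add_eq_0_iff2)
    then show ?thesis by (simp add: T_def u_def vec_eq_iff)
  qed
  have u: "d_z i (\<lambda>y. \<tau> y $ a) w = u $ a" for a
  proof -
    have "frechet_derivative (\<lambda>y. \<tau> y $ a) (at w) (axis i 1) = u $ a"
      "frechet_derivative (\<lambda>y. \<tau> y $ a) (at w) (axis i \<i>) = \<i> * (u $ a)"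
      using cr by (simp_all add: T_def u_def vec_eq_iff)
    then show ?thesis by (simp add: d_z_def)
  qed
  show ?thesis
    unfolding u unfolding d_z_def comp cr u_def[symmetric]
    using real_linear_wirtinger[OF has_derivative_linear[OF has_derivative_frechet[OF f]], of u]
    by (simp add: mult.commute)
qed

section \<open>Exterior algebra\<close>

lemma scale_apply: "scale c a S = c * a S"
  by (simp add: scale_def)

lemma sum_apply: "(\<Sum>i\<in>I. f i) x = (\<Sum>i\<in>I. f i x)"
  by (induction I rule: infinite_finite_induct) auto

text \<open>
  Elements of the exterior algebra are treated as vectors. If the simplifier were to expand sums of
  functions pointwise, the linearity rules below would no longer match.
\<close>

declare plus_fun_apply [simp del] zero_fun_apply [simp del] minus_apply [simp del] uminus_apply [simp del]

lemmas pointwise = plus_fun_apply zero_fun_apply minus_apply uminus_apply scale_apply sum_apply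

lemma scale_zero_left [simp]: "scale 0 a = 0"
  and scale_zero_right [simp]: "scale c 0 = 0"
  and scale_one [simp]: "scale 1 a = a"
  and scale_scale [simp]: "scale c (scale d a) = scale (c * d) a"
  and scale_add_left: "scale (c + d) a = scale c a + scale d a"
  and scale_add_right: "scale c (a + b) = scale c a + scale c b"
  and scale_minus_left [simp]: "scale (- c) a = - scale c a"
  and scale_minus_right [simp]: "scale c (- a) = - scale c a"
  and scale_diff_right: "scale c (a - b) = scale c a - scale c b"
  by (simp_all add: fun_eq_iff pointwise algebra_simps)

lemma scale_eq_zero: "scale c a = 0 \<longleftrightarrow> c = 0 \<or> a = 0"
  by (auto simp: fun_eq_iff pointwise)

lemma scale_sum_right: "scale c (\<Sum>i\<in>I. f i) = (\<Sum>i\<in>I. scale c (f i))"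
  by (simp add: fun_eq_iff pointwise sum_distrib_left)

lemma scale_sum_left: "scale (\<Sum>i\<in>I. c i) a = (\<Sum>i\<in>I. scale (c i) a)"
  by (simp add: fun_eq_iff pointwise sum_distrib_right)

locale ext_linear =
  fixes L :: "'g ext \<Rightarrow> 'h ext"
  assumes add: "L (a + b) = L a + L b" and scale: "L (scale c a) = scale c (L a)"
begin

lemma zero: "L 0 = 0"
  using scale[of 0 0] by simp

lemma minus: "L (- a) = - L a"
  using scale[of "-1" a] by simp

lemma diff: "L (a - b) = L a - L b"
  using add[of a "- b"] by (simp add: minus)

lemma sum: "L (\<Sum>i\<in>I. f i) = (\<Sum>i\<in>I. L (f i))"
  by (induction I rule: infinite_finite_induct) (simp_all add: zero add)

end

interpretation wedge_right: ext_linear "wedge a" for a :: "'g::{finite,linorder} ext"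
  by unfold_locales (simp_all add: wedge_def fun_eq_iff pointwise algebra_simps sum.distrib sum_distrib_left)

interpretation wedge_left: ext_linear "\<lambda>b. wedge b a" for a :: "'g::{finite,linorder} ext"
  by unfold_locales (simp_all add: wedge_def fun_eq_iff pointwise algebra_simps sum.distrib sum_distrib_left)

interpretation contract: ext_linear "contract g" for g :: "'g::{finite,linorder}"
  by unfold_locales (auto simp: contract_def fun_eq_iff pointwise algebra_simps)

interpretation ext_hom: ext_linear "ext_hom f"
  for f :: "'g::{finite,linorder} \<Rightarrow> 'h::{finite,linorder} ext"
  by unfold_locales
     (simp_all add: ext_hom_def scale_add_left sum.distrib scale_sum_right pointwise flip: scale_scale)

text \<open>
  The sign picked up when the generator \<open>g\<close> is moved past the smaller members of \<open>S\<close>.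
\<close>

definition position_sign :: "'g::linorder \<Rightarrow> 'g set \<Rightarrow> complex" where
  "position_sign g S = (-1) ^ card {t \<in> S. t < g}"

lemma position_sign_square [simp]: "position_sign g S * position_sign g S = 1"
  by (simp add: position_sign_def flip: power_add mult_2)

lemma position_sign_square_left [simp]: "position_sign g S * (position_sign g S * x) = x"
  using position_sign_square[of g S] by (simp flip: mult.assoc)

lemma position_sign_insert:
  fixes g :: "'g::{finite,linorder}"
  assumes "h \<notin> S"
  shows "position_sign g (insert h S) = (if h < g then - position_sign g S else position_sign g S)"
proof -
  have "{t \<in> insert h S. t < g} = (if h < g then insert h {t \<in> S. t < g} else {t \<in> S. t < g})"
    by auto
  then show ?thesis using assms by (simp add: position_sign_def)
qed

lemma position_sign_remove:
  fixes g :: "'g::{finite,linorder}"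
  assumes "h \<in> S"
  shows "position_sign g (S - {h}) = (if h < g then - position_sign g S else position_sign g S)"
  using position_sign_insert[of h "S - {h}" g] assms by (simp add: insert_absorb)

lemma wedge_gen_apply:
  fixes g :: "'g::{finite,linorder}"
  shows "wedge (gen g) a S = (if g \<in> S then position_sign g S * a (S - {g}) else 0)"
proof -
  have "wedge (gen g) a S
      = (\<Sum>T\<in>Pow S. if T = {g} then shuffle_sign {g} (S - {g}) * a (S - {g}) else 0)"
    unfolding wedge_def gen_def by (rule sum.cong) auto
  also have "\<dots> = (if g \<in> S then shuffle_sign {g} (S - {g}) * a (S - {g}) else 0)"
    by (simp add: sum.delta)
  also have "shuffle_sign {g} (S - {g}) = position_sign g S"
  proof -
    have "{(s, t). s \<in> {g} \<and> t \<in> S - {g} \<and> t < s} = Pair g ` {t \<in> S. t < g}" by auto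
    then show ?thesis by (simp add: shuffle_sign_def position_sign_def card_image inj_on_def)
  qed
  finally show ?thesis .
qed

lemma contract_apply:
  "contract g a S = (if g \<in> S then 0 else position_sign g S * a (insert g S))"
  by (simp add: contract_def position_sign_def)

lemma wedge_gen_anticommute:
  "wedge (gen g) (wedge (gen h) a) = - wedge (gen h) (wedge (gen g) a)"
proof (rule ext)
  fix S
  have swap: "S - {h} - {g} = S - {g} - {h}" by auto
  show "wedge (gen g) (wedge (gen h) a) S = (- wedge (gen h) (wedge (gen g) a)) S"
  proof (cases "g = h")
    case True
    then show ?thesis by (simp add: wedge_gen_apply pointwise)
  next
    case False
    then show ?thesis
      by (cases g h rule: linorder_cases) (auto simp: wedge_gen_apply position_sign_remove swap pointwise)
  qed
qed

lemma contract_anticommute: "contract g (contract h a) = - contract h (contract g a)"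
proof (rule ext)
  fix S
  have swap: "insert h (insert g S) = insert g (insert h S)" by auto
  show "contract g (contract h a) S = (- contract h (contract g a)) S"
  proof (cases "g = h")
    case True
    then show ?thesis by (simp add: contract_apply pointwise)
  next
    case False
    then show ?thesis
      by (cases g h rule: linorder_cases) (auto simp: contract_apply position_sign_insert swap pointwise)
  qed
qed

text \<open>
  Together with the two preceding anticommutation rules these are the canonical anticommutation
  relations; all later computations with exterior products and contractions rest on them.
\<close>

lemma contract_wedge_gen:
  "contract g (wedge (gen h) a) = (if g = h then a else 0) - wedge (gen h) (contract g a)"
proof (rule ext)
  fix S
  show "contract g (wedge (gen h) a) S
      = ((if g = h then a else 0) - wedge (gen h) (contract g a)) S"
  proof (cases "g = h")
    case True
    then show ?thesis
      by (auto simp: contract_apply wedge_gen_apply position_sign_insert position_sign_remove insert_absorb pointwise)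
  next
    case False
    have "contract g (wedge (gen h) a) S = - wedge (gen h) (contract g a) S"
    proof (cases "g \<notin> S \<and> h \<in> S")
      case True
      then show ?thesis using False
        by (cases g h rule: linorder_cases)
          (simp_all add: contract_apply wedge_gen_apply position_sign_insert position_sign_remove
            insert_Diff_if pointwise)
    next
      case outside: False
      then show ?thesis using False by (auto simp: contract_apply wedge_gen_apply pointwise)
    qed
    then show ?thesis using False by (simp add: pointwise)
  qed
qed

lemma contract_ext_one [simp]: "contract g ext_one = 0"
  by (auto simp: fun_eq_iff contract_apply ext_one_def pointwise)

lemma wedge_ext_one [simp]: "wedge a ext_one = a"
proof
  fix S
  have "wedge a ext_one S = (\<Sum>T\<in>Pow S. if T = S then shuffle_sign S {} * a S else 0)"
    unfolding wedge_def ext_one_def by (rule sum.cong) auto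
  then show "wedge a ext_one S = a S" by (simp add: sum.delta shuffle_sign_def)
qed

text \<open>
  \<open>vec_wedge p\<close> is the exterior product with the vector \<open>\<Sum>\<^sub>d p\<^sub>d g\<^sub>d\<close>, and \<open>biv_wedge q\<close> the one
  with the bivector \<open>\<Sum>\<^sub>c\<^sub>d q\<^sub>c\<^sub>d g\<^sub>c \<and> g\<^sub>d\<close>. Only products with elements of degree one are iterated in what
  follows, so that anticommuting operators take the place of the associative law for \<open>wedge\<close>.
\<close>

definition lin :: "('g \<Rightarrow> complex) \<Rightarrow> 'g::finite ext" where
  "lin p = (\<Sum>d\<in>UNIV. scale (p d) (gen d))"

definition vec_wedge :: "('g \<Rightarrow> complex) \<Rightarrow> 'g::{finite,linorder} ext \<Rightarrow> 'g ext" where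
  "vec_wedge p a = wedge (lin p) a"

definition biv_wedge :: "('g \<Rightarrow> 'g \<Rightarrow> complex) \<Rightarrow> 'g::{finite,linorder} ext \<Rightarrow> 'g ext" where
  "biv_wedge q a = (\<Sum>d\<in>UNIV. wedge (gen d) (vec_wedge (q d) a))"

lemma vec_wedge_sum: "vec_wedge p a = (\<Sum>d\<in>UNIV. scale (p d) (wedge (gen d) a))"
  by (simp add: vec_wedge_def lin_def wedge_left.sum wedge_left.scale)

interpretation vec_wedge: ext_linear "vec_wedge p" for p :: "'g::{finite,linorder} \<Rightarrow> complex"
  by unfold_locales (simp_all add: vec_wedge_def wedge_right.add wedge_right.scale)

interpretation biv_wedge: ext_linear "biv_wedge q" for q :: "'g::{finite,linorder} \<Rightarrow> 'g \<Rightarrow> complex"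
  by unfold_locales
     (simp_all add: biv_wedge_def vec_wedge.add vec_wedge.scale wedge_right.add wedge_right.scale
       sum.distrib scale_sum_right)

lemma wedge_gen_vec_wedge: "wedge (gen g) (vec_wedge p a) = - vec_wedge p (wedge (gen g) a)"
  unfolding vec_wedge_sum wedge_right.sum wedge_right.scale sum_negf[symmetric]
  by (rule sum.cong) (simp_all add: wedge_gen_anticommute[of g])

lemma vec_wedge_anticommute: "vec_wedge p (vec_wedge q a) = - vec_wedge q (vec_wedge p a)"
  unfolding vec_wedge_sum[of p] wedge_gen_vec_wedge vec_wedge.sum vec_wedge.scale
  by (simp add: sum_negf)

lemma wedge_gen_biv_wedge: "wedge (gen g) (biv_wedge q a) = biv_wedge q (wedge (gen g) a)"
  unfolding biv_wedge_def wedge_right.sum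
  by (rule sum.cong)
     (simp_all add: wedge_gen_anticommute[of g] wedge_gen_vec_wedge[of g] wedge_right.minus)

lemma vec_wedge_biv_wedge: "vec_wedge p (biv_wedge q a) = biv_wedge q (vec_wedge p a)"
  unfolding vec_wedge_sum[of p] wedge_gen_biv_wedge by (simp add: biv_wedge.sum biv_wedge.scale)

lemma biv_wedge_commute: "biv_wedge p (biv_wedge q a) = biv_wedge q (biv_wedge p a)"
  unfolding biv_wedge_def[of p] vec_wedge_biv_wedge wedge_gen_biv_wedge by (simp add: biv_wedge.sum)

lemma contract_vec_wedge: "contract k (vec_wedge p a) = scale (p k) a - vec_wedge p (contract k a)"
proof -
  have "contract k (vec_wedge p a)
      = (\<Sum>d\<in>UNIV. (if d = k then scale (p k) a else 0) - scale (p d) (wedge (gen d) (contract k a)))"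
    unfolding vec_wedge_sum contract.sum contract.scale contract_wedge_gen
    by (rule sum.cong) (auto simp: scale_diff_right)
  then show ?thesis by (simp add: sum_subtractf vec_wedge_sum)
qed

text \<open>
  Contraction is an antiderivation, and an antisymmetric bivector contributes each of its two factors
  with the same sign; this is the origin of the factor \<open>2\<close>.
\<close>

lemma contract_biv_wedge:
  assumes "\<And>g h. q g h = - q h g"
  shows "contract k (biv_wedge q a) = biv_wedge q (contract k a) + scale 2 (vec_wedge (q k) a)"
proof -
  have "contract k (biv_wedge q a) = (\<Sum>d\<in>UNIV. (if k = d then vec_wedge (q d) a else 0)
      - wedge (gen d) (scale (q d k) a - vec_wedge (q d) (contract k a)))"
    unfolding biv_wedge_def contract.sum contract_wedge_gen contract_vec_wedge ..
  also have "\<dots> = (\<Sum>d\<in>UNIV. (if k = d then vec_wedge (q d) a else 0)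
      + scale (q k d) (wedge (gen d) a) + wedge (gen d) (vec_wedge (q d) (contract k a)))"
  proof (rule sum.cong[OF refl])
    fix d
    show "(if k = d then vec_wedge (q d) a else 0)
      - wedge (gen d) (scale (q d k) a - vec_wedge (q d) (contract k a)) =
      (if k = d then vec_wedge (q d) a else 0)
      + scale (q k d) (wedge (gen d) a) + wedge (gen d) (vec_wedge (q d) (contract k a))"
      unfolding assms[of k d] by (simp add: wedge_right.diff wedge_right.scale)
  qed
  finally show ?thesis
    by (simp add: sum.distrib biv_wedge_def vec_wedge_sum[of "q k"] scale_add_left[of 1 1, simplified])
qed

section \<open>Homomorphisms of exterior algebras\<close>

text \<open>
  The ordered product of the \<open>f g\<close> for \<open>g \<in> S\<close>, that is, the image of a basis element under
  \<open>ext_hom f\<close>.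
\<close>

definition word :: "('g::{finite,linorder} \<Rightarrow> 'h::{finite,linorder} ext) \<Rightarrow> 'g set \<Rightarrow> 'h ext" where
  "word f S = foldr wedge (map f (sorted_list_of_set S)) ext_one"

lemma ext_hom_word: "ext_hom f a = (\<Sum>S\<in>UNIV. scale (a S) (word f S))"
  by (simp add: ext_hom_def word_def)

lemma word_empty [simp]: "word f {} = ext_one"
  by (simp add: word_def)

text \<open>
  Multiplying an ordered product by \<open>f g\<close> means sorting one more factor in: each smaller factor that
  is passed contributes a sign.
\<close>

lemma wedge_word_list:
  fixes f :: "'g::{finite,linorder} \<Rightarrow> 'h::{finite,linorder} ext"
  assumes anti: "\<And>g h a. wedge (f g) (wedge (f h) a) = - wedge (f h) (wedge (f g) a)"
  shows "sorted xs \<Longrightarrow> distinct xs \<Longrightarrow> g \<notin> set xs \<Longrightarrow> wedge (f g) (foldr wedge (map f xs) ext_one)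
    = scale (position_sign g (set xs)) (foldr wedge (map f (insort g xs)) ext_one)"
proof (induction xs)
  case Nil
  then show ?case by (simp add: position_sign_def)
next
  case (Cons x xs)
  show ?case
  proof (cases "g < x")
    case True
    then have "{t \<in> set (x # xs). t < g} = {}" using Cons.prems by auto
    then have "position_sign g (set (x # xs)) = 1"
      unfolding position_sign_def by (simp only: card.empty power_0)
    then show ?thesis using True by (simp add: less_imp_le)
  next
    case False
    then have "x < g" using Cons.prems by auto
    moreover have "x \<notin> set xs" using Cons.prems by simp
    ultimately have "position_sign g (set (x # xs)) = - position_sign g (set xs)"
      by (simp add: position_sign_insert)
    moreover have "\<not> g \<le> x" using \<open>x < g\<close> by simp
    ultimately show ?thesis using Cons
      by (simp add: anti[of g x] wedge_right.scale)
  qed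
qed

context
  fixes f :: "'g::{finite,linorder} \<Rightarrow> 'h::{finite,linorder} ext"
  assumes anti: "\<And>g h a. wedge (f g) (wedge (f h) a) = - wedge (f h) (wedge (f g) a)"
begin

lemma wedge_word:
  assumes "g \<notin> S"
  shows "wedge (f g) (word f S) = scale (position_sign g S) (word f (insert g S))"
  using wedge_word_list[OF anti, of "sorted_list_of_set S" g] assms
  by (simp add: word_def sorted_list_of_set_insert_remove)

lemma word_insert:
  assumes "g \<notin> S"
  shows "word f (insert g S) = scale (position_sign g S) (wedge (f g) (word f S))"
  using wedge_word[OF assms] by simp

lemma wedge_word_member:
  assumes "g \<in> S"
  shows "wedge (f g) (word f S) = 0"
proof -
  have "wedge (f g) (wedge (f g) a) = 0" for a
    using anti[of g g a] by (simp add: fun_eq_iff pointwise)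
  then show ?thesis
    using word_insert[of g "S - {g}"] assms by (simp add: insert_absorb wedge_right.scale)
qed

text \<open>
  Multiplicativity of \<open>ext_hom f\<close>. It holds as soon as the products with the \<open>f g\<close> anticommute,
  because the signs that arise when \<open>g\<close> is sorted into a basis element are then the same before and
  after the application of \<open>f\<close>.
\<close>

lemma ext_hom_wedge_gen: "ext_hom f (wedge (gen g) a) = wedge (f g) (ext_hom f a)"
proof -
  have "ext_hom f (wedge (gen g) a)
      = (\<Sum>S\<in>{S. g \<in> S}. scale (position_sign g S * a (S - {g})) (word f S))"
    unfolding ext_hom_word by (rule sum.mono_neutral_cong_right) (auto simp: wedge_gen_apply)
  also have "\<dots> = (\<Sum>S\<in>{S. g \<notin> S}. scale (a S * position_sign g S) (word f (insert g S)))"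
    by (rule sum.reindex_bij_witness[of _ "insert g" "\<lambda>S. S - {g}"])
       (auto simp: insert_absorb position_sign_remove mult.commute)
  also have "\<dots> = (\<Sum>S\<in>{S. g \<notin> S}. scale (a S) (wedge (f g) (word f S)))"
    by (rule sum.cong) (auto simp: wedge_word)
  also have "\<dots> = (\<Sum>S\<in>UNIV. scale (a S) (wedge (f g) (word f S)))"
    by (rule sum.mono_neutral_cong_left) (auto simp: wedge_word_member)
  finally show ?thesis by (simp add: ext_hom_word wedge_right.sum wedge_right.scale)
qed

end

lemma ext_hom_one [simp]: "ext_hom f ext_one = ext_one"
proof -
  have "ext_hom f ext_one = (\<Sum>S\<in>UNIV. if S = {} then word f S else 0)"
    unfolding ext_hom_word ext_one_def by (rule sum.cong) auto
  then show ?thesis by simp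
qed

lemma word_gen: "word gen S = (\<lambda>T. if T = S then 1 else 0)"
proof -
  have "finite S" by simp
  then show ?thesis
  proof (induction S)
    case empty
    then show ?case by (simp add: ext_one_def)
  next
    case (insert g S)
    show ?case
      unfolding word_insert[OF wedge_gen_anticommute insert.hyps(2)] insert.IH
      using insert.hyps(2) by (auto simp: fun_eq_iff wedge_gen_apply position_sign_insert pointwise)
  qed
qed

lemma ext_hom_gen: "ext_hom gen a = a"
proof
  fix T
  have "ext_hom gen a T = (\<Sum>S\<in>UNIV. if T = S then a S else 0)"
    unfolding ext_hom_word pointwise word_gen by (rule sum.cong) auto
  then show "ext_hom gen a T = a T" by simp
qed

lemma ext_expand: "a = (\<Sum>S\<in>UNIV. scale (a S) (word gen S))"
  using ext_hom_gen[of a] by (simp add: ext_hom_word)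

text \<open>
  The exterior algebra is generated by its unit under products with generators; linear identities
  may be checked along this generation.
\<close>

lemma ext_induct [case_names zero add scale one gen]:
  fixes a :: "'g::{finite,linorder} ext"
  assumes zero: "P 0" and add: "\<And>a b. P a \<Longrightarrow> P b \<Longrightarrow> P (a + b)" and scale: "\<And>c a. P a \<Longrightarrow> P (scale c a)"
    and one: "P ext_one" and gen: "\<And>g a. P a \<Longrightarrow> P (wedge (gen g) a)"
  shows "P a"
proof -
  have w: "P (word gen S)" for S :: "'g set"
  proof -
    have "finite S" by simp
    then show ?thesis
    proof (induction S)
      case (insert g S)
      then show ?case
        by (auto simp: word_insert[OF wedge_gen_anticommute insert.hyps(2)] intro!: scale gen)
    qed (simp add: one)
  qed
  have "P (\<Sum>S\<in>I. scale (a S) (word gen S))" for I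
    by (induction I rule: infinite_finite_induct) (auto intro: zero add scale w)
  from this[of UNIV] show ?thesis by (simp only: ext_expand[symmetric])
qed

text \<open>
  All homomorphisms in use are induced by linear maps of the generators. Row \<open>g\<close> of the matrix
  holds the image of the generator \<open>g\<close>, hence the order of the factors in \<open>matrix_hom_compose\<close>.
\<close>

definition matrix_hom :: "('g \<Rightarrow> 'g \<Rightarrow> complex) \<Rightarrow> 'g::{finite,linorder} ext \<Rightarrow> 'g ext" where
  "matrix_hom P = ext_hom (\<lambda>g. lin (P g))"

interpretation matrix_hom: ext_linear "matrix_hom P" for P :: "'g::{finite,linorder} \<Rightarrow> 'g \<Rightarrow> complex"
  unfolding matrix_hom_def by unfold_locales (simp_all add: ext_hom.add ext_hom.scale)

lemma matrix_hom_one [simp]: "matrix_hom P ext_one = ext_one"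
  by (simp add: matrix_hom_def)

lemma matrix_hom_wedge_gen: "matrix_hom P (wedge (gen g) a) = vec_wedge (P g) (matrix_hom P a)"
  unfolding matrix_hom_def vec_wedge_def
  by (rule ext_hom_wedge_gen) (rule vec_wedge_anticommute[unfolded vec_wedge_def])

lemma vec_wedge_combination:
  "(\<Sum>d\<in>UNIV. scale (p d) (vec_wedge (P d) a)) = vec_wedge (\<lambda>k. \<Sum>d\<in>UNIV. p d * P d k) a"
  unfolding vec_wedge_sum scale_sum_right scale_sum_left scale_scale
  by (rule sum.swap)

lemma matrix_hom_vec_wedge:
  "matrix_hom P (vec_wedge p a) = vec_wedge (\<lambda>k. \<Sum>d\<in>UNIV. p d * P d k) (matrix_hom P a)"
  unfolding vec_wedge_sum[of p] matrix_hom.sum matrix_hom.scale matrix_hom_wedge_gen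
  by (rule vec_wedge_combination)

lemma matrix_hom_compose:
  "matrix_hom P (matrix_hom Q a) = matrix_hom (\<lambda>g k. \<Sum>d\<in>UNIV. Q g d * P d k) a"
  by (induction a rule: ext_induct)
     (simp_all only: matrix_hom_one matrix_hom.zero matrix_hom.add matrix_hom.scale matrix_hom_wedge_gen matrix_hom_vec_wedge)

lemma lin_delta: "lin (\<lambda>k. if g = k then c else 0) = scale c (gen g)"
proof -
  have "lin (\<lambda>k. if g = k then c else 0) = (\<Sum>k\<in>UNIV. if g = k then scale c (gen g) else 0)"
    unfolding lin_def by (rule sum.cong) auto
  then show ?thesis by simp
qed

lemma word_cong: "(\<And>g. g \<in> S \<Longrightarrow> f g = h g) \<Longrightarrow> word f S = word h S"
  unfolding word_def by (intro arg_cong[of _ _ "\<lambda>xs. foldr wedge xs ext_one"] map_cong) auto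

lemma ext_hom_cong:
  assumes "\<And>S g. a S \<noteq> 0 \<Longrightarrow> g \<in> S \<Longrightarrow> f g = h g"
  shows "ext_hom f a = ext_hom h a"
  unfolding ext_hom_word
proof (rule sum.cong[OF refl])
  fix S
  show "scale (a S) (word f S) = scale (a S) (word h S)"
    using word_cong[of S f h] assms[of S] by (cases "a S = 0") auto
qed

lemma matrix_word_insert:
  "g \<notin> S \<Longrightarrow> word (\<lambda>g. lin (P g)) (insert g S)
    = scale (position_sign g S) (vec_wedge (P g) (word (\<lambda>g. lin (P g)) S))"
  unfolding vec_wedge_def by (rule word_insert[OF vec_wedge_anticommute[unfolded vec_wedge_def]])

section \<open>Bidegrees\<close>

lemma has_bidegree_zero: "has_bidegree p q 0"
  by (simp add: has_bidegree_def pointwise)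

lemma has_bidegree_add: "has_bidegree p q a \<Longrightarrow> has_bidegree p q b \<Longrightarrow> has_bidegree p q (a + b)"
  unfolding has_bidegree_def pointwise by (metis add.right_neutral)

lemma has_bidegree_diff: "has_bidegree p q a \<Longrightarrow> has_bidegree p q b \<Longrightarrow> has_bidegree p q (a - b)"
  unfolding has_bidegree_def pointwise by (metis diff_zero)

lemma has_bidegree_scale: "has_bidegree p q a \<Longrightarrow> has_bidegree p q (scale c a)"
  by (simp add: has_bidegree_def pointwise)

lemma has_bidegree_sum: "(\<And>i. i \<in> I \<Longrightarrow> has_bidegree p q (f i)) \<Longrightarrow> has_bidegree p q (\<Sum>i\<in>I. f i)"
  by (induction I rule: infinite_finite_induct) (auto simp: has_bidegree_zero has_bidegree_add)

lemma has_bidegree_one: "has_bidegree 0 0 ext_one"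
  by (auto simp: has_bidegree_def ext_one_def)

lemma vimage_Hol_remove:
  "Hol -` (S - {Hol i}) = Hol -` S - {i}" "Anti -` (S - {Hol i}) = Anti -` S"
  "Hol -` (S - {Anti i}) = Hol -` S" "Anti -` (S - {Anti i}) = Anti -` S - {i}"
  by auto

lemma has_bidegree_wedge_Hol:
  fixes i :: "'n::{finite,linorder}"
  assumes "has_bidegree p q a"
  shows "has_bidegree (p + 1) q (wedge (gen (Hol i)) a)"
  unfolding has_bidegree_def
proof (intro allI impI)
  fix S assume "wedge (gen (Hol i)) a S \<noteq> 0"
  then have S: "Hol i \<in> S" "a (S - {Hol i}) \<noteq> 0" by (auto simp: wedge_gen_apply split: if_splits)
  have "card (Hol -` S) = Suc (card (Hol -` S - {i}))"
    using S(1) by (intro card.remove) auto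
  moreover note assms[unfolded has_bidegree_def, rule_format, OF S(2), unfolded vimage_Hol_remove]
  ultimately show "int (card (Hol -` S)) = p + 1 \<and> int (card (Anti -` S)) = q" by linarith
qed

lemma has_bidegree_wedge_Anti:
  fixes i :: "'n::{finite,linorder}"
  assumes "has_bidegree p q a"
  shows "has_bidegree p (q + 1) (wedge (gen (Anti i)) a)"
  unfolding has_bidegree_def
proof (intro allI impI)
  fix S assume "wedge (gen (Anti i)) a S \<noteq> 0"
  then have S: "Anti i \<in> S" "a (S - {Anti i}) \<noteq> 0" by (auto simp: wedge_gen_apply split: if_splits)
  have "card (Anti -` S) = Suc (card (Anti -` S - {i}))"
    using S(1) by (intro card.remove) auto
  moreover note assms[unfolded has_bidegree_def, rule_format, OF S(2), unfolded vimage_Hol_remove]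
  ultimately show "int (card (Hol -` S)) = p \<and> int (card (Anti -` S)) = q + 1" by linarith
qed

lemma sum_frame:
  "(\<Sum>g\<in>(UNIV :: 'n::finite frame set). f g) = (\<Sum>i\<in>UNIV. f (Hol i)) + (\<Sum>i\<in>UNIV. f (Anti i))"
proof -
  have "(UNIV :: 'n frame set) = range Hol \<union> range Anti"
    by (metis UNIV_eq_I UnI1 UnI2 frame.exhaust rangeI)
  then have "sum f UNIV = sum f (range Hol \<union> range Anti)" by simp
  also have "\<dots> = sum f (range Hol) + sum f (range Anti)"
    by (rule sum.union_disjoint) auto
  finally show ?thesis by (simp add: sum.reindex inj_on_def)
qed

definition block_diagonal :: "('n frame \<Rightarrow> 'n frame \<Rightarrow> complex) \<Rightarrow> bool" where
  "block_diagonal P \<longleftrightarrow> (\<forall>i j. P (Hol i) (Anti j) = 0 \<and> P (Anti i) (Hol j) = 0)"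

lemma has_bidegree_word:
  fixes P :: "'n::{finite,linorder} frame \<Rightarrow> 'n frame \<Rightarrow> complex"
  assumes P: "block_diagonal P"
  shows "has_bidegree (int (card (Hol -` S))) (int (card (Anti -` S))) (word (\<lambda>g. lin (P g)) S)"
proof -
  have anti: "wedge (lin (P g)) (wedge (lin (P h)) a) = - wedge (lin (P h)) (wedge (lin (P g)) a)"
    for g h a by (rule vec_wedge_anticommute[unfolded vec_wedge_def])
  have "finite S" by simp
  then show ?thesis
  proof (induction S)
    case empty
    then show ?case by (simp add: has_bidegree_one)
  next
    case (insert g S)
    have sum: "wedge (lin (P h)) a = (\<Sum>d\<in>UNIV. scale (P h d) (wedge (gen d) a))" for h a
      by (simp add: vec_wedge_sum flip: vec_wedge_def)
    show ?case
    proof (cases g)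
      case (Hol i)
      have v: "Hol -` insert (Hol i) S = insert i (Hol -` S)" "Anti -` insert (Hol i) S = Anti -` S"
        by auto
      have new: "Hol i \<notin> S" using insert.hyps Hol by simp
      then have "i \<notin> Hol -` S" by simp
      then show ?thesis using P insert.IH
        unfolding Hol v word_insert[OF anti new] sum sum_frame block_diagonal_def
        by (auto intro!: has_bidegree_scale has_bidegree_sum has_bidegree_wedge_Hol simp: add.commute[of 1])
    next
      case (Anti i)
      have v: "Hol -` insert (Anti i) S = Hol -` S" "Anti -` insert (Anti i) S = insert i (Anti -` S)"
        by auto
      have new: "Anti i \<notin> S" using insert.hyps Anti by simp
      then have "i \<notin> Anti -` S" by simp
      then show ?thesis using P insert.IH
        unfolding Anti v word_insert[OF anti new] sum sum_frame block_diagonal_def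
        by (auto intro!: has_bidegree_scale has_bidegree_sum has_bidegree_wedge_Anti simp: add.commute[of 1])
    qed
  qed
qed

lemma has_bidegree_matrix_hom:
  assumes "block_diagonal P" "has_bidegree p q a"
  shows "has_bidegree p q (matrix_hom P a)"
  unfolding matrix_hom_def ext_hom_word
proof (rule has_bidegree_sum)
  fix S
  show "has_bidegree p q (scale (a S) (word (\<lambda>g. lin (P g)) S))"
  proof (cases "a S = 0")
    case False
    then have "int (card (Hol -` S)) = p" "int (card (Anti -` S)) = q"
      using assms(2) by (auto simp: has_bidegree_def)
    then show ?thesis using has_bidegree_scale[OF has_bidegree_word[OF assms(1), of S]] by simp
  qed (simp add: has_bidegree_zero)
qed

section \<open>Fields and their derivatives\<close>

definition field_deriv ::
  "'n::{finite,linorder} frame \<Rightarrow> 'n field \<Rightarrow> 'n field" where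
  "field_deriv g v z = (\<lambda>S. wirtinger g (\<lambda>y. v y S) z)"

definition smooth_field :: "(complex ^ 'n::finite) set \<Rightarrow> 'n field \<Rightarrow> bool" where
  "smooth_field U v \<longleftrightarrow> (\<forall>S. smooth_on U (\<lambda>z. v z S))"

text \<open>
  A linear operator on a finite-dimensional space is a finite sum of coefficient functionals times
  constants, and therefore commutes with differentiation (\<open>field_deriv_linear\<close>).
\<close>

lemma ext_linear_expand:
  fixes L :: "'g::{finite,linorder} ext \<Rightarrow> 'h ext"
  assumes "ext_linear L"
  shows "L a = (\<Sum>S\<in>UNIV. scale (a S) (L (word gen S)))"
  by (subst ext_expand[of a]) (simp only: ext_linear.sum[OF assms] ext_linear.scale[OF assms])

lemma antisymmetric_sum_zero:
  fixes f :: "'i::finite \<Rightarrow> 'i \<Rightarrow> 'g ext"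
  assumes "\<And>i j. f i j = - f j i"
  shows "(\<Sum>i\<in>UNIV. \<Sum>j\<in>UNIV. f i j) = 0"
proof -
  have "(\<Sum>i\<in>UNIV. \<Sum>j\<in>UNIV. f i j) = (\<Sum>j\<in>UNIV. \<Sum>i\<in>UNIV. - f j i)"
    by (subst sum.swap) (intro sum.cong refl assms)
  then have "(\<Sum>i\<in>UNIV. \<Sum>j\<in>UNIV. f i j) = - (\<Sum>i\<in>UNIV. \<Sum>j\<in>UNIV. f i j)"
    by (simp add: sum_negf)
  then show ?thesis by (simp add: fun_eq_iff pointwise)
qed

lemma field_deriv_const [simp]: "field_deriv g (\<lambda>y. a) z = 0"
  by (simp add: field_deriv_def fun_eq_iff pointwise)

lemma smooth_field_const: "smooth_field U (\<lambda>y. a)"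
  by (simp add: smooth_field_def smooth_on_const)

context
  fixes U :: "(complex ^ 'n::{finite,linorder}) set"
  assumes U: "open U"
begin

lemma smooth_field_add: "smooth_field U v \<Longrightarrow> smooth_field U w \<Longrightarrow> smooth_field U (\<lambda>y. v y + w y)"
  by (simp add: smooth_field_def pointwise smooth_on_add[OF U])

lemma smooth_field_scale:
  "smooth_on U f \<Longrightarrow> smooth_field U v \<Longrightarrow> smooth_field U (\<lambda>y. scale (f y) (v y))"
  by (simp add: smooth_field_def pointwise smooth_on_mult[OF U])

lemma smooth_field_sum:
  "(\<And>i. i \<in> I \<Longrightarrow> smooth_field U (v i)) \<Longrightarrow> smooth_field U (\<lambda>y. \<Sum>i\<in>I. v i y)"
  by (simp add: smooth_field_def pointwise smooth_on_sum[OF U])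

lemma smooth_field_linear:
  assumes L: "ext_linear L" and v: "smooth_field U v"
  shows "smooth_field U (\<lambda>y. L (v y))"
  unfolding ext_linear_expand[OF L, of "v _"]
  by (intro smooth_field_sum smooth_field_scale smooth_field_const) (use v in \<open>simp add: smooth_field_def\<close>)

lemma smooth_field_deriv: "smooth_field U v \<Longrightarrow> smooth_field U (field_deriv g v)"
  by (simp add: smooth_field_def field_deriv_def smooth_on_wirtinger[OF U])

lemma smooth_field_vec_wedge:
  "(\<And>d. smooth_on U (p d)) \<Longrightarrow> smooth_field U v \<Longrightarrow> smooth_field U (\<lambda>y. vec_wedge (\<lambda>d. p d y) (v y))"
  unfolding vec_wedge_sum
  by (intro smooth_field_sum smooth_field_scale smooth_field_linear[OF wedge_right.ext_linear_axioms])

lemma smooth_field_biv_wedge: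
  "(\<And>a b. smooth_on U (q a b)) \<Longrightarrow> smooth_field U v
    \<Longrightarrow> smooth_field U (\<lambda>y. biv_wedge (\<lambda>a b. q a b y) (v y))"
  unfolding biv_wedge_def
  by (intro smooth_field_sum smooth_field_linear[OF wedge_right.ext_linear_axioms] smooth_field_vec_wedge)

lemma smooth_field_word:
  assumes P: "\<And>g k. smooth_on U (P g k)"
  shows "smooth_field U (\<lambda>y. word (\<lambda>g. lin (\<lambda>k. P g k y)) S)"
proof -
  have "finite S" by simp
  then show ?thesis
  proof (induction S)
    case empty
    then show ?case by (simp add: smooth_field_const)
  next
    case (insert g S)
    then show ?case unfolding matrix_word_insert[OF insert.hyps(2)]
      by (intro smooth_field_scale[OF smooth_on_const] smooth_field_vec_wedge P)
  qed
qed

context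
  fixes z assumes z: "z \<in> U"
begin

lemma field_deriv_add:
  "smooth_field U v \<Longrightarrow> smooth_field U w
    \<Longrightarrow> field_deriv g (\<lambda>y. v y + w y) z = field_deriv g v z + field_deriv g w z"
  by (simp add: fun_eq_iff smooth_field_def field_deriv_def pointwise wirtinger_add smooth_on_differentiable[OF _ z])

lemma field_deriv_scale:
  "smooth_on U f \<Longrightarrow> smooth_field U v \<Longrightarrow> field_deriv g (\<lambda>y. scale (f y) (v y)) z
    = scale (wirtinger g f z) (v z) + scale (f z) (field_deriv g v z)"
  by (simp add: fun_eq_iff smooth_field_def field_deriv_def pointwise wirtinger_mult smooth_on_differentiable[OF _ z])

lemma field_deriv_sum:
  "(\<And>i. i \<in> I \<Longrightarrow> smooth_field U (v i))
    \<Longrightarrow> field_deriv g (\<lambda>y. \<Sum>i\<in>I. v i y) z = (\<Sum>i\<in>I. field_deriv g (v i) z)"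
  by (simp add: fun_eq_iff smooth_field_def field_deriv_def pointwise wirtinger_sum smooth_on_differentiable[OF _ z])

lemma field_deriv_linear:
  assumes L: "ext_linear L" and v: "smooth_field U v"
  shows "field_deriv g (\<lambda>y. L (v y)) z = L (field_deriv g v z)"
proof -
  have "field_deriv g (\<lambda>y. L (v y)) z
      = (\<Sum>S\<in>UNIV. scale (wirtinger g (\<lambda>y. v y S) z) (L (word gen S)))"
  proof -
    have vS: "smooth_on U (\<lambda>y. v y S)" for S using v by (simp add: smooth_field_def)
    have "field_deriv g (\<lambda>y. L (v y)) z
        = field_deriv g (\<lambda>y. \<Sum>S\<in>UNIV. scale (v y S) (L (word gen S))) z"
      by (simp only: ext_linear_expand[OF L, of "v _"])
    also have "\<dots> = (\<Sum>S\<in>UNIV. field_deriv g (\<lambda>y. scale (v y S) (L (word gen S))) z)"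
      by (rule field_deriv_sum) (rule smooth_field_scale[OF vS smooth_field_const])
    finally show ?thesis by (simp add: field_deriv_scale[OF vS smooth_field_const])
  qed
  then show ?thesis
    unfolding ext_linear_expand[OF L, of "field_deriv g v z"] by (simp only: field_deriv_def[of g v])
qed

lemma field_deriv_vec_wedge:
  assumes p: "\<And>d. smooth_on U (p d)" and v: "smooth_field U v"
  shows "field_deriv g (\<lambda>y. vec_wedge (\<lambda>d. p d y) (v y)) z
    = vec_wedge (\<lambda>d. wirtinger g (p d) z) (v z) + vec_wedge (\<lambda>d. p d z) (field_deriv g v z)"
  unfolding vec_wedge_sum
  by (simp add: field_deriv_sum field_deriv_scale p smooth_field_scale
      smooth_field_linear[OF wedge_right.ext_linear_axioms v]
      field_deriv_linear[OF wedge_right.ext_linear_axioms v] sum.distrib)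

lemma field_deriv_biv_wedge:
  assumes q: "\<And>a b. smooth_on U (q a b)" and v: "smooth_field U v"
  shows "field_deriv g (\<lambda>y. biv_wedge (\<lambda>a b. q a b y) (v y)) z
    = biv_wedge (\<lambda>a b. wirtinger g (q a b) z) (v z) + biv_wedge (\<lambda>a b. q a b z) (field_deriv g v z)"
proof -
  note sm = smooth_field_vec_wedge[OF q v]
  show ?thesis unfolding biv_wedge_def
    by (simp add: field_deriv_sum smooth_field_linear[OF wedge_right.ext_linear_axioms sm]
        field_deriv_linear[OF wedge_right.ext_linear_axioms sm] field_deriv_vec_wedge q v
        wedge_right.add sum.distrib)
qed

lemma field_deriv_commute:
  "smooth_field U v \<Longrightarrow> field_deriv g (field_deriv h v) z = field_deriv h (field_deriv g v) z"
  by (simp add: smooth_field_def field_deriv_def fun_eq_iff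
      wirtinger_commute[OF U _ z, unfolded fun_eq_iff])

end

end

lemma field_deriv_cong:
  assumes "open U" "z \<in> U" "\<And>y. y \<in> U \<Longrightarrow> v y = w y"
  shows "field_deriv g v z = field_deriv g w z"
  unfolding field_deriv_def using wirtinger_cong[OF assms(1,2)] assms(3) by metis

section \<open>The differential of an anchor matrix\<close>

text \<open>
  The antiderivation that sends a function \<open>f\<close> to \<open>\<Sum>\<^sub>g (\<partial>\<^sub>g f) P\<^sub>g\<close>, where \<open>P\<^sub>g\<close> is the vector
  in row \<open>g\<close> of \<open>P\<close>, and the constant frame member \<open>k\<close> to one half of the bivector \<open>\<partial>\<^sub>k P\<close>. If its
  square is zero, it is the differential of a Lie algebroid whose anchor is given by \<open>P\<close>. The de Rham differential is
  the case of the unit matrix (\<open>de_rham_anchor_diff\<close>).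
\<close>

definition anchor_diff ::
  "('n::{finite,linorder} frame \<Rightarrow> 'n frame \<Rightarrow> (complex, 'n) vec \<Rightarrow> complex) \<Rightarrow> 'n field \<Rightarrow> 'n field" where
  "anchor_diff P v z = (\<Sum>g\<in>UNIV. vec_wedge (\<lambda>k. P g k z) (field_deriv g v z))
     + scale (1/2) (\<Sum>k\<in>UNIV. biv_wedge (\<lambda>a b. wirtinger k (P a b) z) (contract k (v z)))"

lemma anchor_diff_cong:
  assumes "open U" "z \<in> U" "\<And>y. y \<in> U \<Longrightarrow> v y = w y"
  shows "anchor_diff P v z = anchor_diff P w z"
proof -
  have "field_deriv g v z = field_deriv g w z" for g by (rule field_deriv_cong[OF assms])
  then show ?thesis using assms(3)[OF assms(2)] by (simp add: anchor_diff_def)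
qed

definition de_rham :: "'n::{finite,linorder} field \<Rightarrow> 'n field" where
  "de_rham v z = (\<Sum>g\<in>UNIV. wedge (gen g) (field_deriv g v z))"

text \<open>
  The conditions are those satisfied by the matrix of \<open>\<Lambda>\<^sup>#\<close>, and trivially by the unit matrix.
  Antisymmetry can only be demanded of the derivatives of \<open>P\<close>, since on the conjugate differentials
  \<open>P\<close> is the identity; the condition \<open>skew\<close> is the antisymmetry of \<open>P\<close> in those directions \<open>l\<close> in
  which \<open>P\<close> is not constant. The trivector in \<open>jacobi\<close> is the Schouten square of the bivector, up
  to a factor.
\<close>

locale poisson_anchor =
  fixes U :: "(complex ^ 'n::{finite,linorder}) set"
    and P :: "'n frame \<Rightarrow> 'n frame \<Rightarrow> (complex, 'n) vec \<Rightarrow> complex"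
  assumes U: "open U"
    and smooth: "smooth_on U (P g h)"
    and deriv_antisymmetric: "z \<in> U \<Longrightarrow> wirtinger k (P g h) z = - wirtinger k (P h g) z"
    and skew: "z \<in> U \<Longrightarrow> P l g z * wirtinger l (P c d) z = - (P g l z * wirtinger l (P c d) z)"
    and jacobi: "z \<in> U \<Longrightarrow>
      (\<Sum>h\<in>UNIV. vec_wedge (\<lambda>k. P h k z) (biv_wedge (\<lambda>a b. wirtinger h (P a b) z) ext_one)) = 0"
begin

text \<open>
  \<open>F z h\<close> is the product with the vector \<open>P\<^sub>h\<close> and \<open>Q z k\<close> the product with the bivector
  \<open>\<partial>\<^sub>k P\<close>, both at the point \<open>z\<close>; \<open>dF z g\<close> and \<open>dQ z g\<close> are their derivatives in the direction \<open>g\<close>.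
\<close>

abbreviation F where "F z h \<equiv> vec_wedge (\<lambda>k. P h k z)"
abbreviation dF where "dF z g h \<equiv> vec_wedge (\<lambda>k. wirtinger g (P h k) z)"
abbreviation Q where "Q z k \<equiv> biv_wedge (\<lambda>a b. wirtinger k (P a b) z)"
abbreviation dQ where "dQ z g k \<equiv> biv_wedge (\<lambda>a b. wirtinger g (wirtinger k (P a b)) z)"

lemma smooth_deriv: "smooth_on U (wirtinger k (P a b))"
  by (rule smooth_on_wirtinger[OF U smooth])

text \<open>
  A trivector that vanishes annihilates everything: the product with it commutes up to sign with the
  products with generators, which reduces the claim to the unit.
\<close>

lemma jacobi_operator:
  assumes z: "z \<in> U" shows "(\<Sum>h\<in>UNIV. F z h (Q z h a)) = 0"
proof (induction a rule: ext_induct)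
  case (gen g a)
  have "F z h (Q z h (wedge (gen g) a)) = - wedge (gen g) (F z h (Q z h a))" for h
    by (simp add: wedge_gen_vec_wedge flip: wedge_gen_biv_wedge)
  then show ?case using gen by (simp add: sum_negf wedge_right.zero flip: wedge_right.sum)
next
  case one
  then show ?case by (rule jacobi[OF z])
qed (simp_all add: biv_wedge.zero biv_wedge.add biv_wedge.scale vec_wedge.zero vec_wedge.add
    vec_wedge.scale sum.distrib flip: scale_sum_right)

lemma contract_Q:
  "z \<in> U \<Longrightarrow> contract k (Q z l a) = Q z l (contract k a) + scale 2 (dF z l k a)"
  by (rule contract_biv_wedge) (rule deriv_antisymmetric)

lemma scale_Q_skew:
  assumes "z \<in> U" shows "scale (P l g z) (Q z l a) = - scale (P g l z) (Q z l a)"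
proof -
  have "scale c (biv_wedge q a) = biv_wedge (\<lambda>i j. c * q i j) a" for c q
    by (simp add: biv_wedge_def vec_wedge_sum scale_sum_right flip: wedge_right.scale)
  moreover have "- biv_wedge q a = biv_wedge (\<lambda>i j. - q i j) a" for q
    by (simp add: biv_wedge_def vec_wedge_sum sum_negf wedge_right.minus)
  ultimately show ?thesis using skew[OF assms, of l g] by simp
qed

text \<open>
  The operator form of the equation \<open>D P\<^sub>g = 0\<close>, that is, of the fact that Hamiltonian fields of
  coordinates are killed by \<open>ad\<^sub>\<Lambda>\<close>. It is the contraction of the Jacobi identity with the generator
  \<open>g\<close>.
\<close>

lemma anchor_closed:
  assumes z: "z \<in> U"
  shows "(\<Sum>h\<in>UNIV. F z h (dF z h g a)) + scale (1/2) (\<Sum>k\<in>UNIV. Q z k (contract k (F z g a)))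
    + scale (1/2) (\<Sum>k\<in>UNIV. F z g (Q z k (contract k a))) = 0"
proof -
  have "0 = contract g (\<Sum>h\<in>UNIV. F z h (Q z h a))"
    by (simp add: jacobi_operator[OF z] contract.zero)
  also have "\<dots> = (\<Sum>h\<in>UNIV. scale (P h g z) (Q z h a)) - (\<Sum>h\<in>UNIV. F z h (Q z h (contract g a)))
      - scale 2 (\<Sum>h\<in>UNIV. F z h (dF z h g a))"
    by (simp add: contract.sum contract_vec_wedge contract_Q[OF z] vec_wedge.add vec_wedge.scale
        sum_subtractf sum.distrib scale_sum_right)
  finally have 1: "scale 2 (\<Sum>h\<in>UNIV. F z h (dF z h g a)) = (\<Sum>h\<in>UNIV. scale (P h g z) (Q z h a))"
    by (simp add: jacobi_operator[OF z])
  have 2: "(\<Sum>k\<in>UNIV. Q z k (contract k (F z g a)))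
      = (\<Sum>k\<in>UNIV. scale (P g k z) (Q z k a)) - (\<Sum>k\<in>UNIV. F z g (Q z k (contract k a)))"
    by (simp add: contract_vec_wedge biv_wedge.diff biv_wedge.scale sum_subtractf vec_wedge_biv_wedge)
  have 3: "(\<Sum>k\<in>UNIV. scale (P k g z) (Q z k a)) = - (\<Sum>k\<in>UNIV. scale (P g k z) (Q z k a))"
    by (simp add: scale_Q_skew[OF z] flip: sum_negf)
  have "scale 2 ((\<Sum>h\<in>UNIV. F z h (dF z h g a)) + scale (1/2) (\<Sum>k\<in>UNIV. Q z k (contract k (F z g a)))
    + scale (1/2) (\<Sum>k\<in>UNIV. F z g (Q z k (contract k a)))) = 0"
    unfolding scale_add_right 1 2 3 by (simp add: scale_diff_right)
  then show ?thesis by (simp only: scale_eq_zero) simp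
qed

text \<open>
  This is the part of \<open>D\<^sup>2\<close> that involves no derivative of the argument. It is half the
  sum over \<open>l\<close> of the derivatives of the Jacobi trivector in the direction \<open>l\<close>, each multiplied with
  the contraction of the argument by \<open>l\<close>. The terms correspond to each other because
  \<open>\<partial>\<^sub>h (\<partial>\<^sub>l P) = \<partial>\<^sub>l (\<partial>\<^sub>h P)\<close>.
\<close>

lemma curvature_vanishes:
  assumes z: "z \<in> U"
  shows "scale (1/2) (\<Sum>g\<in>UNIV. \<Sum>k\<in>UNIV. F z g (dQ z g k (contract k a)))
    + scale (1/4) (\<Sum>k\<in>UNIV. \<Sum>l\<in>UNIV. Q z k (contract k (Q z l (contract l a)))) = 0"
proof -
  have deriv: "(\<Sum>h\<in>UNIV. F z h (dQ z h l b)) = - (\<Sum>h\<in>UNIV. dF z l h (Q z h b))" for l b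
  proof -
    have sm: "smooth_field U (\<lambda>y. Q y h b)" for h
      by (rule smooth_field_biv_wedge[OF U smooth_deriv smooth_field_const])
    have "0 = field_deriv l (\<lambda>y. 0) z" by simp
    also have "\<dots> = field_deriv l (\<lambda>y. \<Sum>h\<in>UNIV. F y h (Q y h b)) z"
      by (rule field_deriv_cong[OF U z]) (simp add: jacobi_operator)
    also have "\<dots> = (\<Sum>h\<in>UNIV. dF z l h (Q z h b) + F z h (dQ z l h b))"
      by (simp add: field_deriv_sum[OF U z] smooth_field_vec_wedge[OF U smooth sm]
          field_deriv_vec_wedge[OF U z smooth sm]
          field_deriv_biv_wedge[OF U z smooth_deriv smooth_field_const] biv_wedge.zero)
    also have "\<dots> = (\<Sum>h\<in>UNIV. dF z l h (Q z h b)) + (\<Sum>h\<in>UNIV. F z h (dQ z h l b))"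
      by (simp add: sum.distrib wirtinger_commute[OF U smooth z, of l])
    finally show ?thesis by (simp add: eq_neg_iff_add_eq_0 add.commute)
  qed
  \<comment> \<open>products with bivectors commute, contractions anticommute\<close>
  have quad: "(\<Sum>k\<in>UNIV. \<Sum>l\<in>UNIV. Q z k (Q z l (contract k (contract l a)))) = 0"
    by (rule antisymmetric_sum_zero, subst biv_wedge_commute, subst contract_anticommute)
       (simp add: biv_wedge.minus)
  have "(\<Sum>k\<in>UNIV. \<Sum>l\<in>UNIV. Q z k (contract k (Q z l (contract l a))))
      = scale 2 (\<Sum>k\<in>UNIV. \<Sum>l\<in>UNIV. dF z l k (Q z k (contract l a)))"
    by (simp add: contract_Q[OF z] biv_wedge.add biv_wedge.scale sum.distrib quad scale_sum_right
        vec_wedge_biv_wedge)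
  also have "(\<Sum>k\<in>UNIV. \<Sum>l\<in>UNIV. dF z l k (Q z k (contract l a)))
      = (\<Sum>l\<in>UNIV. \<Sum>k\<in>UNIV. dF z l k (Q z k (contract l a)))"
    by (rule sum.swap)
  also have "\<dots> = - (\<Sum>l\<in>UNIV. \<Sum>h\<in>UNIV. F z h (dQ z h l (contract l a)))"
    by (simp add: deriv sum_negf)
  also have "(\<Sum>l\<in>UNIV. \<Sum>h\<in>UNIV. F z h (dQ z h l (contract l a)))
      = (\<Sum>h\<in>UNIV. \<Sum>l\<in>UNIV. F z h (dQ z h l (contract l a)))"
    by (rule sum.swap)
  finally show ?thesis by simp
qed

text \<open>
  \<open>D\<^sup>2 v\<close> is sorted by the order of the derivatives of \<open>v\<close>. The second order part vanishes because
  second derivatives commute and vectors anticommute, the first order part by \<open>anchor_closed\<close>, and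
  the rest by \<open>curvature_vanishes\<close>.
\<close>

lemma anchor_diff_square:
  assumes v: "smooth_field U v" and z: "z \<in> U"
  shows "anchor_diff P (anchor_diff P v) z = 0"
proof -
  note cv = smooth_field_linear[OF U contract.ext_linear_axioms v]
  note dv = smooth_field_deriv[OF U v]
  have deriv: "field_deriv g (anchor_diff P v) z
      = (\<Sum>h\<in>UNIV. dF z g h (field_deriv h v z) + F z h (field_deriv g (field_deriv h v) z))
      + scale (1/2) (\<Sum>k\<in>UNIV. dQ z g k (contract k (v z)) + Q z k (contract k (field_deriv g v z)))" for g
    unfolding anchor_diff_def[abs_def]
    by (simp add: field_deriv_add[OF U z] field_deriv_sum[OF U z] field_deriv_scale[OF U z smooth_on_const]
        field_deriv_vec_wedge[OF U z smooth dv] field_deriv_biv_wedge[OF U z smooth_deriv cv]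
        field_deriv_linear[OF U z contract.ext_linear_axioms v]
        smooth_field_sum[OF U] smooth_field_scale[OF U smooth_on_const]
        smooth_field_vec_wedge[OF U smooth dv] smooth_field_biv_wedge[OF U smooth_deriv cv])
  have second: "(\<Sum>g\<in>UNIV. \<Sum>h\<in>UNIV. F z g (F z h (field_deriv g (field_deriv h v) z))) = 0"
    by (rule antisymmetric_sum_zero, subst vec_wedge_anticommute, subst field_deriv_commute[OF U z v])
       (rule refl)
  have swap1: "(\<Sum>g\<in>UNIV. \<Sum>h\<in>UNIV. F z g (dF z g h (field_deriv h v z)))
      = (\<Sum>h\<in>UNIV. \<Sum>g\<in>UNIV. F z g (dF z g h (field_deriv h v z)))"
    by (rule sum.swap)
  have swap2: "(\<Sum>k\<in>UNIV. \<Sum>h\<in>UNIV. Q z k (contract k (F z h (field_deriv h v z))))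
      = (\<Sum>h\<in>UNIV. \<Sum>k\<in>UNIV. Q z k (contract k (F z h (field_deriv h v z))))"
    by (rule sum.swap)
  have "anchor_diff P (anchor_diff P v) z
      = (\<Sum>g\<in>UNIV. F z g (field_deriv g (anchor_diff P v) z))
      + scale (1/2) (\<Sum>k\<in>UNIV. Q z k (contract k (anchor_diff P v z)))"
    by (rule anchor_diff_def)
  also have "(\<Sum>g\<in>UNIV. F z g (field_deriv g (anchor_diff P v) z))
      = (\<Sum>g\<in>UNIV. \<Sum>h\<in>UNIV. F z g (dF z g h (field_deriv h v z)))
      + scale (1/2) (\<Sum>g\<in>UNIV. \<Sum>k\<in>UNIV. F z g (dQ z g k (contract k (v z))))
      + scale (1/2) (\<Sum>g\<in>UNIV. \<Sum>k\<in>UNIV. F z g (Q z k (contract k (field_deriv g v z))))"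
    unfolding deriv
    by (simp add: vec_wedge.add vec_wedge.sum vec_wedge.scale sum.distrib second scale_add_right
        flip: scale_sum_right)
  also have "scale (1/2) (\<Sum>k\<in>UNIV. Q z k (contract k (anchor_diff P v z)))
      = scale (1/2) (\<Sum>k\<in>UNIV. \<Sum>h\<in>UNIV. Q z k (contract k (F z h (field_deriv h v z))))
      + scale (1/4) (\<Sum>k\<in>UNIV. \<Sum>l\<in>UNIV. Q z k (contract k (Q z l (contract l (v z)))))"
    unfolding anchor_diff_def
    by (simp add: contract.add contract.sum contract.scale biv_wedge.add biv_wedge.sum biv_wedge.scale
        sum.distrib scale_add_right flip: scale_sum_right)
  finally have "anchor_diff P (anchor_diff P v) z
      = (\<Sum>h\<in>UNIV. (\<Sum>g\<in>UNIV. F z g (dF z g h (field_deriv h v z)))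
          + scale (1/2) (\<Sum>k\<in>UNIV. Q z k (contract k (F z h (field_deriv h v z))))
          + scale (1/2) (\<Sum>k\<in>UNIV. F z h (Q z k (contract k (field_deriv h v z)))))
      + (scale (1/2) (\<Sum>g\<in>UNIV. \<Sum>k\<in>UNIV. F z g (dQ z g k (contract k (v z))))
      + scale (1/4) (\<Sum>k\<in>UNIV. \<Sum>l\<in>UNIV. Q z k (contract k (Q z l (contract l (v z))))))"
    unfolding swap1 swap2 by (simp add: sum.distrib scale_sum_right)
  then show ?thesis by (simp add: anchor_closed[OF z] curvature_vanishes[OF z])
qed

lemma anchor_diff_add:
  assumes v: "smooth_field U v" and w: "smooth_field U w" and z: "z \<in> U"
  shows "anchor_diff P (\<lambda>y. v y + w y) z = anchor_diff P v z + anchor_diff P w z"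
  by (simp add: anchor_diff_def field_deriv_add[OF U z v w] vec_wedge.add contract.add biv_wedge.add
      sum.distrib scale_add_right)

lemma anchor_diff_scale:
  assumes f: "smooth_on U f" and v: "smooth_field U v" and z: "z \<in> U"
  shows "anchor_diff P (\<lambda>y. scale (f y) (v y)) z
    = (\<Sum>g\<in>UNIV. scale (wirtinger g f z) (F z g (v z))) + scale (f z) (anchor_diff P v z)"
  by (simp add: anchor_diff_def field_deriv_scale[OF U z f v] vec_wedge.add vec_wedge.scale contract.scale
      biv_wedge.scale sum.distrib scale_add_right scale_sum_right mult.commute)

lemma anchor_diff_diff:
  assumes v: "smooth_field U v" and w: "smooth_field U w" and z: "z \<in> U"
  shows "anchor_diff P (\<lambda>y. v y - w y) z = anchor_diff P v z - anchor_diff P w z"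
proof -
  have neg: "(\<lambda>y. - w y) = (\<lambda>y. scale (-1) (w y))" by simp
  have "anchor_diff P (\<lambda>y. - w y) z = - anchor_diff P w z"
    unfolding neg by (subst anchor_diff_scale[OF smooth_on_const w z]) simp
  then show ?thesis
    using anchor_diff_add[OF v _ z, of "\<lambda>y. - w y"] smooth_field_scale[OF U smooth_on_const w, of "-1"]
    by simp
qed

lemma anchor_diff_sum:
  assumes "finite I" "\<And>i. i \<in> I \<Longrightarrow> smooth_field U (v i)" and z: "z \<in> U"
  shows "anchor_diff P (\<lambda>y. \<Sum>i\<in>I. v i y) z = (\<Sum>i\<in>I. anchor_diff P (v i) z)"
  using assms(1,2)
proof (induction I rule: finite_induct)
  case empty
  then show ?case
    by (simp add: anchor_diff_def vec_wedge.zero contract.zero biv_wedge.zero)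
next
  case (insert i I)
  then show ?case by (simp add: anchor_diff_add[OF _ _ z] smooth_field_sum[OF U])
qed

lemma anchor_diff_vec_wedge:
  assumes v: "smooth_field U v" and z: "z \<in> U"
  shows "anchor_diff P (\<lambda>y. F y g (v y)) z = - F z g (anchor_diff P v z)"
proof -
  have 1: "(\<Sum>h\<in>UNIV. F z h (F z g (field_deriv h v z))) = - F z g (\<Sum>h\<in>UNIV. F z h (field_deriv h v z))"
    unfolding vec_wedge.sum sum_negf[symmetric] by (rule sum.cong[OF refl], rule vec_wedge_anticommute)
  have "anchor_diff P (\<lambda>y. F y g (v y)) z + F z g (anchor_diff P v z)
      = (\<Sum>h\<in>UNIV. F z h (dF z h g (v z))) + scale (1/2) (\<Sum>k\<in>UNIV. Q z k (contract k (F z g (v z))))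
    + scale (1/2) (\<Sum>k\<in>UNIV. F z g (Q z k (contract k (v z))))"
    by (simp add: anchor_diff_def field_deriv_vec_wedge[OF U z smooth v] vec_wedge.add vec_wedge.scale
        sum.distrib 1 vec_wedge.sum)
  then show ?thesis unfolding anchor_closed[OF z] by (simp add: eq_neg_iff_add_eq_0)
qed

abbreviation frame_word where "frame_word S y \<equiv> word (\<lambda>g. lin (\<lambda>k. P g k y)) S"

lemma smooth_field_frame_word: "smooth_field U (frame_word S)"
  by (rule smooth_field_word[OF U smooth])

lemma anchor_diff_frame_word:
  assumes z: "z \<in> U" shows "anchor_diff P (frame_word S) z = 0"
proof -
  have "finite S" by simp
  then show ?thesis
  proof (induction S)
    case empty
    then show ?case by (simp add: anchor_diff_def vec_wedge.zero biv_wedge.zero)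
  next
    case (insert g S)
    note sm = smooth_field_vec_wedge[OF U smooth smooth_field_frame_word]
    show ?case unfolding matrix_word_insert[OF insert.hyps(2)]
      by (simp add: anchor_diff_scale[OF smooth_on_const sm z] anchor_diff_vec_wedge[OF smooth_field_frame_word z]
          insert.IH vec_wedge.zero)
  qed
qed

lemma matrix_hom_frame_word: "matrix_hom (\<lambda>g k. P g k y) a = (\<Sum>S\<in>UNIV. scale (a S) (frame_word S y))"
  by (simp add: matrix_hom_def ext_hom_word)

lemma smooth_field_matrix_hom:
  assumes "smooth_field U v" shows "smooth_field U (\<lambda>y. matrix_hom (\<lambda>g k. P g k y) (v y))"
  unfolding matrix_hom_frame_word using assms
  by (intro smooth_field_sum[OF U] smooth_field_scale[OF U] smooth_field_frame_word) (simp add: smooth_field_def)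

text \<open>
  The homomorphism \<open>\<Phi>\<close> with matrix \<open>P\<close> satisfies \<open>D \<circ> \<Phi> = \<Phi> \<circ> d\<close>. Since \<open>D\<close> kills the images of the
  constant basis elements (\<open>anchor_diff_frame_word\<close>), only the derivatives of the coefficients
  remain on the left, as they do on the right.
\<close>

lemma anchor_diff_matrix_hom:
  assumes v: "smooth_field U v" and z: "z \<in> U"
  shows "anchor_diff P (\<lambda>y. matrix_hom (\<lambda>g k. P g k y) (v y)) z = matrix_hom (\<lambda>g k. P g k z) (de_rham v z)"
proof -
  have v': "smooth_on U (\<lambda>y. v y S)" for S using v by (simp add: smooth_field_def)
  have "anchor_diff P (\<lambda>y. matrix_hom (\<lambda>g k. P g k y) (v y)) z
      = (\<Sum>S\<in>UNIV. \<Sum>g\<in>UNIV. scale (wirtinger g (\<lambda>y. v y S) z) (F z g (frame_word S z)))"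
    unfolding matrix_hom_frame_word
    by (simp add: anchor_diff_sum[OF _ _ z] anchor_diff_scale[OF v' smooth_field_frame_word z]
        smooth_field_scale[OF U v' smooth_field_frame_word] anchor_diff_frame_word[OF z])
  also have "\<dots> = (\<Sum>g\<in>UNIV. \<Sum>S\<in>UNIV. scale (wirtinger g (\<lambda>y. v y S) z) (F z g (frame_word S z)))"
    by (rule sum.swap)
  also have "\<dots> = (\<Sum>g\<in>UNIV. F z g (matrix_hom (\<lambda>g k. P g k z) (field_deriv g v z)))"
    by (simp add: matrix_hom_frame_word vec_wedge.sum vec_wedge.scale field_deriv_def)
  also have "\<dots> = matrix_hom (\<lambda>g k. P g k z) (de_rham v z)"
    by (simp add: de_rham_def matrix_hom.sum matrix_hom_wedge_gen)
  finally show ?thesis .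
qed

end

lemma poisson_anchor_trivial:
  "open U \<Longrightarrow> poisson_anchor U (\<lambda>g k _. if g = k then 1 else 0)"
  by unfold_locales
     (auto simp: smooth_on_const biv_wedge_def vec_wedge_sum wedge_right.zero)

lemma de_rham_anchor_diff: "de_rham = anchor_diff (\<lambda>g k _. if g = k then 1 else 0)"
proof (intro ext)
  fix v :: "'n::{finite,linorder} field" and z S
  have "vec_wedge (\<lambda>k. if g = k then 1 else 0) a = wedge (gen g) a" for g :: "'n frame" and a
    by (simp add: vec_wedge_def lin_delta)
  then show "de_rham v z S = anchor_diff (\<lambda>g k _. if g = k then 1 else 0) v z S"
    by (simp add: de_rham_def anchor_diff_def biv_wedge_def vec_wedge_sum wedge_right.zero)
qed

section \<open>The anchor of a Poisson bivector field\<close>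

text \<open>
  Reading off coefficients by two contractions makes antisymmetry in the indices evident and leaves
  no distinction according to their order.
\<close>

definition bivector_coeff :: "'g::{finite,linorder} ext \<Rightarrow> 'g \<Rightarrow> 'g \<Rightarrow> complex" where
  "bivector_coeff a g h = contract h (contract g a) {}"

text \<open>
  The matrix of \<open>\<Lambda>\<^sup>#\<close> for a bivector \<open>a\<close> of bidegree \<open>(2,0)\<close>: with \<open>a = \<Sum>\<^sub>i\<^sub><\<^sub>j \<pi>\<^sub>i\<^sub>j \<partial>\<^sub>i \<and> \<partial>\<^sub>j\<close> it
  sends \<open>dz\<^sub>j\<close> to \<open>\<Sum>\<^sub>i \<pi>\<^sub>i\<^sub>j \<partial>\<^sub>i\<close>. The transposition of indices is chosen such that
  \<open>\<Lambda>\<^sup># df = ad\<^sub>\<Lambda> f\<close>, without a sign.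
\<close>

definition anchor :: "'n::{finite,linorder} frame ext \<Rightarrow> 'n frame \<Rightarrow> 'n frame \<Rightarrow> complex" where
  "anchor a g k = bivector_coeff a k g + (if g = k \<and> g \<in> range Anti then 1 else 0)"

lemma bivector_coeff_antisymmetric: "bivector_coeff a g h = - bivector_coeff a h g"
  unfolding bivector_coeff_def by (subst contract_anticommute) (simp add: pointwise)

lemma bivector_coeff_diag [simp]: "bivector_coeff a g g = 0"
  using bivector_coeff_antisymmetric[of a g g] by simp

lemma bivector_coeff_apply:
  "bivector_coeff a g h = (if g = h then 0 else position_sign g {h} * a {g, h})"
  by (auto simp: bivector_coeff_def contract_apply position_sign_def)

lemma bivector_coeff_Hol_less:
  assumes "i < j" shows "bivector_coeff a (Hol i) (Hol j) = a {Hol i, Hol j}"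
proof -
  have "{t \<in> {Hol j}. t < Hol i} = {}" using assms by (auto simp: less_frame_def)
  then have "position_sign (Hol i) {Hol j} = 1" unfolding position_sign_def by (simp only: card.empty power_0)
  then show ?thesis using assms by (simp add: bivector_coeff_apply)
qed

lemma bivector_coeff_Anti:
  assumes "has_bidegree 2 0 a"
  shows "bivector_coeff a g (Anti j) = 0" "bivector_coeff a (Anti j) g = 0"
proof -
  have "a {g, Anti j} = 0"
  proof (rule ccontr)
    assume "a {g, Anti j} \<noteq> 0"
    then have "card (Anti -` {g, Anti j}) = 0" using assms by (auto simp: has_bidegree_def)
    then show False by (simp add: card_eq_0_iff) blast
  qed
  then show "bivector_coeff a g (Anti j) = 0" by (simp add: bivector_coeff_apply)
  then show "bivector_coeff a (Anti j) g = 0" using bivector_coeff_antisymmetric[of a g "Anti j"] by simp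
qed

text \<open>
  The operators \<open>g \<and> \<iota>\<^sub>g\<close> are the projections to the basis elements that contain \<open>g\<close>; their sum counts
  the degree.
\<close>

lemma euler_identity:
  assumes "\<And>S. a S \<noteq> 0 \<Longrightarrow> card S = k"
  shows "(\<Sum>g\<in>UNIV. wedge (gen g) (contract g a)) = scale (of_nat k) a"
proof
  fix S
  have "(\<Sum>g\<in>UNIV. wedge (gen g) (contract g a)) S = (\<Sum>g\<in>UNIV. if g \<in> S then a S else 0)"
    unfolding sum_apply
    by (rule sum.cong) (auto simp: wedge_gen_apply contract_apply position_sign_remove insert_absorb)
  also have "\<dots> = of_nat (card S) * a S" by (simp add: sum.If_cases)
  also have "\<dots> = scale (of_nat k) a S" using assms[of S] by (cases "a S = 0") (auto simp: pointwise)
  finally show "(\<Sum>g\<in>UNIV. wedge (gen g) (contract g a)) S = scale (of_nat k) a S" .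
qed

lemma contract_degree:
  assumes "\<And>S. a S \<noteq> 0 \<Longrightarrow> card S = Suc k" and "contract g a S \<noteq> 0"
  shows "card S = k"
proof -
  have "g \<notin> S" "a (insert g S) \<noteq> 0" using assms(2) by (auto simp: contract_apply split: if_splits)
  then show ?thesis using assms(1)[of "insert g S"] by simp
qed

lemma degree_zero:
  fixes a :: "'g::finite ext"
  assumes "\<And>S. a S \<noteq> 0 \<Longrightarrow> card S = 0"
  shows "a = scale (a {}) ext_one"
proof
  fix S
  show "a S = scale (a {}) ext_one S"
    using assms[of S] by (cases "S = {}") (auto simp: pointwise ext_one_def)
qed

text \<open>
  The expansion follows from Euler's identity, applied to \<open>a\<close> and to its contractions.
\<close>

lemma bivector_expand:
  assumes a: "\<And>S. a S \<noteq> 0 \<Longrightarrow> card S = 2"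
  shows "a = scale (1/2) (biv_wedge (bivector_coeff a) ext_one)"
proof -
  have 1: "contract g a S \<noteq> 0 \<Longrightarrow> card S = 1" for g S
    by (rule contract_degree[of a]) (use a in auto)
  have 2: "contract h (contract g a) S \<noteq> 0 \<Longrightarrow> card S = 0" for g h S
    by (rule contract_degree[of "contract g a"]) (use 1 in auto)
  have 3: "contract h (contract g a) = scale (bivector_coeff a g h) ext_one" for g h
    unfolding bivector_coeff_def by (rule degree_zero) (rule 2)
  have 4: "contract g a = vec_wedge (bivector_coeff a g) ext_one" for g
    using euler_identity[of "contract g a" 1] 1 by (simp add: 3 wedge_right.scale vec_wedge_sum)
  have "scale 2 a = biv_wedge (bivector_coeff a) ext_one"
    using euler_identity[of a 2] a by (simp add: biv_wedge_def flip: 4)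
  then have "scale (1/2) (scale 2 a) = scale (1/2) (biv_wedge (bivector_coeff a) ext_one)" by simp
  then show ?thesis by simp
qed

lemma card_frame_set:
  fixes S :: "'n::finite frame set"
  shows "card S = card (Hol -` S) + card (Anti -` S)"
proof -
  have "S = Hol ` (Hol -` S) \<union> Anti ` (Anti -` S)"
    by (auto simp: image_iff) (metis frame.exhaust)
  then have "card S = card (Hol ` (Hol -` S) \<union> Anti ` (Anti -` S))" by simp
  also have "\<dots> = card (Hol ` (Hol -` S)) + card (Anti ` (Anti -` S))"
    by (rule card_Un_disjoint) auto
  also have "card (Hol ` (Hol -` S)) = card (Hol -` S)"
    by (rule card_image) (simp add: inj_on_def)
  also have "card (Anti ` (Anti -` S)) = card (Anti -` S)"
    by (rule card_image) (simp add: inj_on_def)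
  finally show ?thesis .
qed

lemma has_bidegree_card:
  fixes S :: "'n::finite frame set"
  assumes "has_bidegree 2 0 a" "a S \<noteq> 0" shows "card S = 2"
  using assms unfolding has_bidegree_def card_frame_set[of S] by auto

lemma anchor_Hol: "anchor a (Hol j) k = bivector_coeff a k (Hol j)"
  by (auto simp: anchor_def)

lemma anchor_Anti: "has_bidegree 2 0 a \<Longrightarrow> anchor a (Anti j) k = (if Anti j = k then 1 else 0)"
  by (simp add: anchor_def bivector_coeff_Anti)

lemma block_diagonal_anchor: "has_bidegree 2 0 a \<Longrightarrow> block_diagonal (anchor a)"
  by (simp add: block_diagonal_def anchor_Hol anchor_Anti bivector_coeff_Anti)

lemma sum_pairs:
  fixes G :: "'n::{finite,linorder} \<Rightarrow> 'n \<Rightarrow> 'b::comm_monoid_add"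
  assumes "\<And>i. G i i = 0"
  shows "(\<Sum>i\<in>UNIV. \<Sum>j\<in>UNIV. G i j) = (\<Sum>(i, j)\<in>{(i, j). i < j}. G i j + G j i)"
proof -
  have "(\<Sum>i\<in>UNIV. \<Sum>j\<in>UNIV. G i j) = (\<Sum>(i, j)\<in>UNIV. G i j)"
    by (simp add: sum.cartesian_product)
  also have "\<dots> = (\<Sum>(i, j)\<in>{(i, j). i < j} \<union> {(i, j). j < i}. G i j)"
    by (rule sum.mono_neutral_right) (auto simp: assms, metis assms linorder_neqE)
  also have "\<dots> = (\<Sum>(i, j)\<in>{(i, j). i < j}. G i j) + (\<Sum>(i, j)\<in>{(i, j). j < i}. G i j)"
    by (rule sum.union_disjoint) (auto intro: finite_subset[OF subset_UNIV])
  also have "(\<Sum>(i, j)\<in>{(i, j). j < i}. G i j) = (\<Sum>(i, j)\<in>{(i, j). i < j}. G j i)"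
    by (rule sum.reindex_bij_witness[of _ prod.swap prod.swap]) auto
  finally show ?thesis by (simp add: sum.distrib case_prod_unfold)
qed

lemma lie_loc_coordinate:
  fixes j :: "'n::{finite,linorder}"
  shows "lie_loc (\<lambda>_. gen (Hol j)) v z = field_deriv (Hol j) v z"
proof -
  have app: "vf_apply (\<lambda>_. gen (Hol j)) f z = d_z j f z" for j :: 'n and f
    unfolding vf_apply_def gen_def by (simp add: if_distrib if_distribR cong: if_cong)
  have "d_z i (\<lambda>y. c) z = 0" for i :: 'n and c
    using wirtinger_const[of "Hol i" c z] by (simp add: wirtinger.simps)
  then have "vf_bracket (\<lambda>_. gen (Hol j)) (\<lambda>_. gen (Hol k)) z = 0" for k
    by (simp add: vf_bracket_def vf_apply_def)
  then show ?thesis by (simp add: lie_loc_def app wedge_left.zero field_deriv_def wirtinger.simps)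
qed

lemma lie_loc_multiple:
  fixes i :: "'n::{finite,linorder}"
  assumes l: "l differentiable (at z)"
  shows "lie_loc (\<lambda>y. scale (l y) (gen (Hol i))) v z = scale (l z) (field_deriv (Hol i) v z)
    - (\<Sum>k\<in>UNIV. scale (d_z k l z) (wedge (gen (Hol i)) (contract (Hol k) (v z))))"
proof -
  let ?V = "\<lambda>y. scale (l y) (gen (Hol i))"
  have comp: "?V y {Hol m} = (if m = i then 1 else 0) * l y" for m y
    by (simp add: pointwise gen_def)
  have app: "vf_apply ?V f z = l z * d_z i f z" for f
    unfolding vf_apply_def comp by (simp add: if_distrib if_distribR cong: if_cong)
  have app': "vf_apply (\<lambda>_. gen (Hol j)) f z = d_z j f z" for j :: 'n and f
    unfolding vf_apply_def gen_def by (simp add: if_distrib if_distribR cong: if_cong)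
  have const: "d_z i (\<lambda>y. c) z = 0" for i :: 'n and c
    using wirtinger_const[of "Hol i" c z] by (simp add: wirtinger.simps)
  have cm: "d_z k (\<lambda>y. c * l y) z = c * d_z k l z" for k c
    using wirtinger_cmult[OF l, of "Hol k" c] by (simp add: wirtinger.simps)
  have "vf_bracket ?V (\<lambda>_. gen (Hol k)) z
      = (\<Sum>m\<in>UNIV. if m = i then scale (- d_z k l z) (gen (Hol m)) else 0)" for k
    unfolding vf_bracket_def app app' comp const cm by (rule sum.cong) auto
  then have br: "vf_bracket ?V (\<lambda>_. gen (Hol k)) z = scale (- d_z k l z) (gen (Hol i))" for k
    by simp
  show ?thesis unfolding lie_loc_def br app wedge_left.scale
    by (simp add: field_deriv_def wirtinger.simps sum_negf fun_eq_iff pointwise)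
qed

text \<open>
  In coordinates the bracket with a coordinate field is differentiation of the coefficients, and the
  bracket of a multiple \<open>l \<partial>\<^sub>i\<close> with a coordinate field \<open>\<partial>\<^sub>k\<close> is \<open>- (\<partial>\<^sub>k l) \<partial>\<^sub>i\<close>.
\<close>

lemma ad_loc_formula:
  assumes L: "\<And>S. (\<lambda>y. L y S) differentiable (at z)"
  shows "ad_loc L v z = (\<Sum>(i, j)\<in>{(i, j). i < j}.
      scale (L z {Hol i, Hol j}) (wedge (gen (Hol i)) (field_deriv (Hol j) v z))
    - scale (L z {Hol i, Hol j}) (wedge (gen (Hol j)) (field_deriv (Hol i) v z))
    + (\<Sum>k\<in>UNIV. scale (d_z k (\<lambda>y. L y {Hol i, Hol j}) z)
        (wedge (gen (Hol j)) (wedge (gen (Hol i)) (contract (Hol k) (v z))))))"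
  unfolding ad_loc_def sum_apply[where x = z]
  by (rule sum.cong)
     (auto simp: ad_decomposable_loc_def lie_loc_coordinate lie_loc_multiple[OF L] wedge_left.scale
       wedge_right.scale wedge_right.diff wedge_right.sum)

lemma del_dbar_loc: "del_loc v z + dbar_loc v z = de_rham v z"
  by (simp add: del_loc_def dbar_loc_def de_rham_def sum_frame field_deriv_def wirtinger.simps)

locale poisson_field =
  fixes U :: "(complex ^ 'n::{finite,linorder}) set" and L :: "'n field"
  assumes U: "open U"
    and holo: "holo_on U (\<lambda>z. L z S)"
    and bideg: "has_bidegree 2 0 (L z)"
    and ad_self: "z \<in> U \<Longrightarrow> ad_loc L L z = 0"
begin

abbreviation P where "P g k z \<equiv> anchor (L z) g k"

lemma smooth_L: "smooth_on U (\<lambda>z. L z S)"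
  using holo by (simp add: holo_on_def)

lemma smooth_coeff: "smooth_on U (\<lambda>z. bivector_coeff (L z) g h)"
  unfolding bivector_coeff_apply
  by (cases "g = h") (auto intro!: smooth_on_const smooth_on_mult[OF U] smooth_L)

lemma smooth_anchor: "smooth_on U (P g k)"
  unfolding anchor_def by (intro smooth_on_add[OF U] smooth_on_const smooth_coeff)

lemma deriv_anchor:
  assumes "z \<in> U" shows "wirtinger l (P g k) z = wirtinger l (\<lambda>y. bivector_coeff (L y) k g) z"
  unfolding anchor_def
  by (subst wirtinger_add[OF smooth_on_differentiable[OF smooth_coeff assms]]) auto

lemma deriv_coeff_antisymmetric:
  assumes "z \<in> U"
  shows "wirtinger l (\<lambda>y. bivector_coeff (L y) g h) z = - wirtinger l (\<lambda>y. bivector_coeff (L y) h g) z"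
proof -
  have "wirtinger l (\<lambda>y. bivector_coeff (L y) g h) z = wirtinger l (\<lambda>y. (-1) * bivector_coeff (L y) h g) z"
    by (subst bivector_coeff_antisymmetric) simp
  then show ?thesis
    by (simp only: wirtinger_cmult[OF smooth_on_differentiable[OF smooth_coeff assms]]) simp
qed

lemma deriv_anchor_Anti:
  assumes z: "z \<in> U" shows "wirtinger (Anti l) (P g k) z = 0"
proof -
  have "wirtinger (Anti l) (\<lambda>y. L y S) z = 0" for S
    using holo z by (simp add: holo_on_def wirtinger.simps)
  then show ?thesis unfolding deriv_anchor[OF z] bivector_coeff_apply
    by (cases "k = g") (simp_all add: wirtinger_cmult[OF smooth_on_differentiable[OF smooth_L z]])
qed

lemma deriv_anchor_antisymmetric:
  "z \<in> U \<Longrightarrow> wirtinger l (P g k) z = - wirtinger l (P k g) z"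
  by (simp only: deriv_anchor) (rule deriv_coeff_antisymmetric)

lemma biv_wedge_zero: "biv_wedge (\<lambda>a b. 0) w = 0"
  by (simp add: biv_wedge_def vec_wedge_sum wedge_right.zero)

text \<open>
  Comparison with the coordinate formula for \<open>ad\<^sub>\<Lambda>\<close>. The sums over all pairs of indices on the left
  become the sums over increasing pairs in the definition of \<open>ad_loc\<close> by antisymmetry, which also
  absorbs the factor one half.
\<close>

lemma anchor_diff_eq:
  assumes z: "z \<in> U"
  shows "anchor_diff P v z = dbar_loc v z + ad_loc L v z"
proof -
  let ?\<pi> = "\<lambda>i j. bivector_coeff (L z) (Hol i) (Hol j)"
  let ?d = "\<lambda>k i j. wirtinger (Hol k) (\<lambda>y. bivector_coeff (L y) (Hol i) (Hol j)) z"
  have F_Hol: "vec_wedge (\<lambda>k. P (Hol j) k z) w = (\<Sum>i\<in>UNIV. scale (?\<pi> i j) (wedge (gen (Hol i)) w))" for j w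
    by (simp add: vec_wedge_sum sum_frame anchor_Hol bivector_coeff_Anti[OF bideg])
  have F_Anti: "vec_wedge (\<lambda>k. P (Anti j) k z) w = wedge (gen (Anti j)) w" for j w
    by (simp add: anchor_Anti[OF bideg] vec_wedge_def lin_delta)
  have d_Anti: "wirtinger l (P g (Anti m)) z = 0" "wirtinger l (P (Anti m) g) z = 0" for l g m
    by (simp_all add: deriv_anchor[OF z] bivector_coeff_Anti[OF bideg])
  have Q_Hol: "biv_wedge (\<lambda>a b. wirtinger l (P a b) z) w
      = (\<Sum>i\<in>UNIV. \<Sum>j\<in>UNIV. scale (wirtinger l (P (Hol i) (Hol j)) z) (wedge (gen (Hol i)) (wedge (gen (Hol j)) w)))"
    for l w
    by (simp add: biv_wedge_def vec_wedge_sum sum_frame d_Anti wedge_right.zero wedge_right.add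
        wedge_right.sum wedge_right.scale)
  have d_Hol: "wirtinger l (P (Hol i) (Hol j)) z = - d_l"
    "wirtinger l (P (Hol j) (Hol i)) z = d_l"
    if "i < j" "d_l = wirtinger l (\<lambda>y. L y {Hol i, Hol j}) z" for i j l d_l
    using that deriv_coeff_antisymmetric[OF z, of l "Hol j" "Hol i"]
    by (simp_all add: deriv_anchor[OF z] bivector_coeff_Hol_less)
  have Q_pairs: "biv_wedge (\<lambda>a b. wirtinger (Hol k) (P a b) z) w
      = scale 2 (\<Sum>(i, j)\<in>{(i, j). i < j}. scale (d_z k (\<lambda>y. L y {Hol i, Hol j}) z)
        (wedge (gen (Hol j)) (wedge (gen (Hol i)) w)))" for k w
  proof -
    have "scale (wirtinger (Hol k) (P (Hol i) (Hol i)) z) (wedge (gen (Hol i)) (wedge (gen (Hol i)) w)) = 0" for i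
      using deriv_anchor_antisymmetric[OF z, of "Hol k" "Hol i" "Hol i"] by simp
    moreover have "scale (wirtinger (Hol k) (P (Hol i) (Hol j)) z) (wedge (gen (Hol i)) (wedge (gen (Hol j)) w))
        + scale (wirtinger (Hol k) (P (Hol j) (Hol i)) z) (wedge (gen (Hol j)) (wedge (gen (Hol i)) w))
      = scale 2 (scale (d_z k (\<lambda>y. L y {Hol i, Hol j}) z) (wedge (gen (Hol j)) (wedge (gen (Hol i)) w)))"
      if "i < j" for i j
      using d_Hol[OF that refl, of "Hol k"] wedge_gen_anticommute[of "Hol i" "Hol j" w]
      by (simp add: wirtinger.simps scale_add_left[of 1 1, simplified] flip: scale_scale)
    ultimately show ?thesis
      unfolding Q_Hol scale_sum_right
      by (subst sum_pairs) (assumption, rule sum.cong[OF refl], clarify, simp only: prod.case)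
  qed
  have Q_Anti: "biv_wedge (\<lambda>a b. wirtinger (Anti k) (P a b) z) w = 0" for k w
    by (simp add: deriv_anchor_Anti[OF z] biv_wedge_zero)
  have first: "(\<Sum>i\<in>UNIV. \<Sum>j\<in>UNIV. scale (?\<pi> i j) (wedge (gen (Hol i)) (field_deriv (Hol j) v z)))
      = (\<Sum>(i, j)\<in>{(i, j). i < j}.
      scale (L z {Hol i, Hol j}) (wedge (gen (Hol i)) (field_deriv (Hol j) v z))
    - scale (L z {Hol i, Hol j}) (wedge (gen (Hol j)) (field_deriv (Hol i) v z)))"
  proof (subst sum_pairs)
    have "?\<pi> j i = - L z {Hol i, Hol j}" if "i < j" for i j
      using that bivector_coeff_antisymmetric[of "L z" "Hol j" "Hol i"] by (simp add: bivector_coeff_Hol_less)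
    then show "(\<Sum>(i, j)\<in>{(i, j). i < j}. scale (?\<pi> i j) (wedge (gen (Hol i)) (field_deriv (Hol j) v z))
        + scale (?\<pi> j i) (wedge (gen (Hol j)) (field_deriv (Hol i) v z)))
      = (\<Sum>(i, j)\<in>{(i, j). i < j}.
      scale (L z {Hol i, Hol j}) (wedge (gen (Hol i)) (field_deriv (Hol j) v z))
    - scale (L z {Hol i, Hol j}) (wedge (gen (Hol j)) (field_deriv (Hol i) v z)))"
      by (intro sum.cong) (auto simp: bivector_coeff_Hol_less)
  qed simp
  have "anchor_diff P v z = (\<Sum>j\<in>UNIV. \<Sum>i\<in>UNIV. scale (?\<pi> i j) (wedge (gen (Hol i)) (field_deriv (Hol j) v z)))
      + (\<Sum>j\<in>UNIV. wedge (gen (Anti j)) (field_deriv (Anti j) v z))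
      + scale (1/2) (\<Sum>k\<in>UNIV. biv_wedge (\<lambda>a b. wirtinger (Hol k) (P a b) z) (contract (Hol k) (v z)))"
    unfolding anchor_diff_def sum_frame F_Hol F_Anti Q_Anti by simp
  also have "(\<Sum>j\<in>UNIV. \<Sum>i\<in>UNIV. scale (?\<pi> i j) (wedge (gen (Hol i)) (field_deriv (Hol j) v z)))
    = (\<Sum>i\<in>UNIV. \<Sum>j\<in>UNIV. scale (?\<pi> i j) (wedge (gen (Hol i)) (field_deriv (Hol j) v z)))"
    by (rule sum.swap)
  also have "scale (1/2) (\<Sum>k\<in>UNIV. biv_wedge (\<lambda>a b. wirtinger (Hol k) (P a b) z) (contract (Hol k) (v z)))
    = (\<Sum>k\<in>UNIV. \<Sum>(i, j)\<in>{(i, j). i < j}. scale (d_z k (\<lambda>y. L y {Hol i, Hol j}) z)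
        (wedge (gen (Hol j)) (wedge (gen (Hol i)) (contract (Hol k) (v z)))))"
    unfolding Q_pairs by (simp flip: scale_sum_right)
  also have "\<dots> = (\<Sum>(i, j)\<in>{(i, j). i < j}. \<Sum>k\<in>UNIV. scale (d_z k (\<lambda>y. L y {Hol i, Hol j}) z)
        (wedge (gen (Hol j)) (wedge (gen (Hol i)) (contract (Hol k) (v z)))))"
    by (subst sum.swap) (simp add: case_prod_unfold)
  finally show ?thesis
    unfolding first ad_loc_formula[OF smooth_on_differentiable[OF smooth_L z]]
    by (simp add: dbar_loc_def field_deriv_def[of "Anti _" v] wirtinger.simps sum.distrib sum_subtractf
        case_prod_unfold algebra_simps)
qed

lemma dbar_self:
  assumes "z \<in> U" shows "dbar_loc L z = 0"
proof -
  have "(\<lambda>S. d_zbar j (\<lambda>y. L y S) z) = 0" for j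
    using holo assms by (simp add: holo_on_def fun_eq_iff pointwise)
  then show ?thesis by (simp add: dbar_loc_def wedge_right.zero)
qed

text \<open>
  The Jacobi identity is the equation \<open>[\<Lambda>, \<Lambda>] = 0\<close> written out: with
  \<open>\<Lambda> = 1/2 \<Sum>\<^sub>a\<^sub>b \<pi>\<^sub>a\<^sub>b \<partial>\<^sub>a \<and> \<partial>\<^sub>b\<close>, the part of \<open>D \<Lambda>\<close> that differentiates the coefficients of
  \<open>\<Lambda>\<close> and the part that differentiates those of \<open>P\<close> are equal, and each is minus one half of the
  trivector in question.
\<close>

lemma poisson_anchor_anchor: "poisson_anchor U (\<lambda>g k z. anchor (L z) g k)"
proof
  show "open U" by (rule U)
  show "smooth_on U (P g h)" for g h by (rule smooth_anchor)
  show "wirtinger k (P g h) z = - wirtinger k (P h g) z" if "z \<in> U" for k g h z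
    by (rule deriv_anchor_antisymmetric[OF that])
  show "P l g z * wirtinger l (P c d) z = - (P g l z * wirtinger l (P c d) z)" if "z \<in> U" for l g c d z
  proof (cases l)
    case (Hol i)
    then have "P l g z = - P g l z"
      using bivector_coeff_antisymmetric[of "L z" g l] by (auto simp: anchor_def)
    then show ?thesis by simp
  qed (simp add: deriv_anchor_Anti[OF that])
  fix z assume z: "z \<in> U"
  let ?\<pi> = "bivector_coeff (L z)"
  let ?F = "\<lambda>h. vec_wedge (\<lambda>k. P h k z)"
  let ?Q = "\<lambda>h. biv_wedge (\<lambda>a b. wirtinger h (P a b) z)"
  have L: "L y = scale (1/2) (biv_wedge (bivector_coeff (L y)) ext_one)" for y
    by (rule bivector_expand) (rule has_bidegree_card[OF bideg])
  have minus: "biv_wedge (\<lambda>i j. - q i j) w = - biv_wedge q w" "vec_wedge (\<lambda>i. - p i) w = - vec_wedge p w" for q p w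
    by (simp_all add: biv_wedge_def vec_wedge_sum sum_negf wedge_right.minus)
  have deriv: "field_deriv g L z = - scale (1/2) (?Q g ext_one)" for g
  proof -
    have "field_deriv g L z = field_deriv g (\<lambda>y. scale (1/2) (biv_wedge (\<lambda>a b. bivector_coeff (L y) a b) ext_one)) z"
      by (simp flip: L)
    also have "\<dots> = scale (1/2) (biv_wedge (\<lambda>a b. wirtinger g (\<lambda>y. bivector_coeff (L y) a b) z) ext_one)"
      by (simp add: field_deriv_scale[OF U z smooth_on_const] smooth_field_biv_wedge[OF U smooth_coeff smooth_field_const]
          field_deriv_biv_wedge[OF U z smooth_coeff smooth_field_const] biv_wedge.zero)
    also have "biv_wedge (\<lambda>a b. wirtinger g (\<lambda>y. bivector_coeff (L y) a b) z) ext_one = - ?Q g ext_one"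
    proof -
      have "(\<lambda>a b. wirtinger g (\<lambda>y. bivector_coeff (L y) a b) z) = (\<lambda>a b. - wirtinger g (P a b) z)"
        by (intro ext) (simp only: deriv_anchor[OF z], rule deriv_coeff_antisymmetric[OF z])
      then show ?thesis by (simp add: minus)
    qed
    finally show ?thesis by simp
  qed
  have contr: "contract k (L z) = vec_wedge (?\<pi> k) ext_one" for k
  proof -
    have "contract k (biv_wedge ?\<pi> ext_one) = scale 2 (vec_wedge (?\<pi> k) ext_one)"
      by (subst contract_biv_wedge[OF bivector_coeff_antisymmetric]) (simp add: biv_wedge.zero)
    then show ?thesis by (subst L) (simp add: contract.scale)
  qed
  have FQ: "?Q k (contract k (L z)) = - ?F k (?Q k ext_one)" for k
  proof (cases k)
    case (Hol i)
    have "(\<lambda>d. P k d z) = (\<lambda>d. - ?\<pi> k d)"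
      unfolding Hol anchor_Hol by (rule ext) (rule bivector_coeff_antisymmetric)
    then show ?thesis by (simp add: contr minus flip: vec_wedge_biv_wedge)
  next
    case (Anti i)
    then show ?thesis by (simp add: deriv_anchor_Anti[OF z] biv_wedge_zero vec_wedge.zero)
  qed
  have "0 = anchor_diff P L z" using ad_self[OF z] dbar_self[OF z] by (simp add: anchor_diff_eq[OF z])
  also have "\<dots> = - (\<Sum>h\<in>UNIV. ?F h (?Q h ext_one))"
  proof -
    have "anchor_diff P L z = - scale (1/2) (\<Sum>h\<in>UNIV. ?F h (?Q h ext_one))
        + - scale (1/2) (\<Sum>h\<in>UNIV. ?F h (?Q h ext_one))"
      unfolding anchor_diff_def deriv FQ
      by (simp only: vec_wedge.minus vec_wedge.scale sum_negf scale_minus_right flip: scale_sum_right)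
    then show ?thesis by (simp add: fun_eq_iff pointwise)
  qed
  finally show "(\<Sum>h\<in>UNIV. ?F h (?Q h ext_one)) = 0" by simp
qed

end

section \<open>Sections over a manifold\<close>

context
  fixes X :: "'a topology" and \<A> :: "('a, 'n::finite) chart set"
  assumes manifold: "complex_manifold X \<A>"
begin

lemma open_chart_image: "c \<in> \<A> \<Longrightarrow> open (chart_image c)"
  using manifold by (simp add: complex_manifold_def)

lemma chart_homeomorphic:
  "c \<in> \<A> \<Longrightarrow> homeomorphic_map (subtopology X (fst c)) (top_of_set (chart_image c)) (snd c)"
  and chart_open: "c \<in> \<A> \<Longrightarrow> openin X (fst c)"
  using manifold by (auto simp: complex_manifold_def)

lemma chart_inj:
  assumes "c \<in> \<A>" shows "inj_on (snd c) (fst c)"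
proof -
  have "inj_on (snd c) (topspace (subtopology X (fst c)))"
    using chart_homeomorphic[OF assms] by (simp add: homeomorphic_map_def)
  then show ?thesis using openin_subset[OF chart_open[OF assms]] by (simp add: inf.absorb2)
qed

lemma open_overlap:
  assumes "c \<in> \<A>" "c' \<in> \<A>" shows "open (snd c ` (fst c \<inter> fst c'))"
proof -
  have "openin (subtopology X (fst c)) (fst c \<inter> fst c')"
    using chart_open[OF assms(2)] by (auto simp: openin_subtopology)
  then have "openin (top_of_set (chart_image c)) (snd c ` (fst c \<inter> fst c'))"
    using homeomorphic_imp_open_map[OF chart_homeomorphic[OF assms(1)]] by (simp add: open_map_def)
  then show ?thesis using openin_open_eq[OF open_chart_image[OF assms(1)]] by blast
qed

lemma transition_chart: "c \<in> \<A> \<Longrightarrow> x \<in> fst c \<Longrightarrow> transition c c' (snd c x) = snd c' x"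
  by (simp add: transition_def inv_into_f_f[OF chart_inj])

lemma transition_holo:
  "c \<in> \<A> \<Longrightarrow> c' \<in> \<A> \<Longrightarrow> holo_on (snd c ` (fst c \<inter> fst c')) (\<lambda>z. transition c c' z $ k)"
  using manifold by (simp add: complex_manifold_def)

lemma transition_smooth:
  "c \<in> \<A> \<Longrightarrow> c' \<in> \<A> \<Longrightarrow> smooth_on (snd c ` (fst c \<inter> fst c')) (\<lambda>z. transition c c' z $ k)"
  using transition_holo by (simp add: holo_on_def)

lemma transition_d_zbar:
  "c \<in> \<A> \<Longrightarrow> c' \<in> \<A> \<Longrightarrow> z \<in> snd c ` (fst c \<inter> fst c') \<Longrightarrow> d_zbar i (\<lambda>z. transition c c' z $ k) z = 0"
  using transition_holo[of c c' k] unfolding holo_on_def by blast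

lemma d_z_transition:
  assumes c: "c \<in> \<A>" "c' \<in> \<A>" "x \<in> fst c" "x \<in> fst c'" and f: "f differentiable (at (snd c x))"
  shows "d_z i (\<lambda>w. f (transition c' c w)) (snd c' x)
    = (\<Sum>a\<in>UNIV. d_z a f (snd c x) * jacobian c' c x a i)"
proof -
  have x: "snd c' x \<in> snd c' ` (fst c' \<inter> fst c)" using c by blast
  show ?thesis unfolding jacobian_def
    using d_z_compose_holomorphic[where \<tau> = "transition c' c" and w = "snd c' x" and f = f and i = i]
      transition_d_zbar[OF c(2,1) x] smooth_on_differentiable[OF transition_smooth[OF c(2,1)] x] f
    by (simp add: transition_chart[OF c(2,4)])
qed

text \<open>
  The chain rule for the two mutually inverse changes of coordinates.
\<close>

lemma jacobian_inverse:
  assumes c: "c \<in> \<A>" "c' \<in> \<A>" "x \<in> fst c" "x \<in> fst c'"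
  shows "(\<Sum>a\<in>UNIV. jacobian c' c x i a * jacobian c c' x a l) = (if i = l then 1 else 0)"
proof -
  let ?W = "snd c ` (fst c \<inter> fst c')"
  have x: "snd c' x \<in> snd c' ` (fst c' \<inter> fst c)" "snd c x \<in> ?W" using c by auto
  have coord: "((\<lambda>z :: complex ^ 'n. z $ i) has_derivative (\<lambda>z. z $ i)) (at w)" for w
    by (rule bounded_linear_imp_has_derivative[OF bounded_linear_vec_nth])
  have "frechet_derivative (\<lambda>z :: complex ^ 'n. z $ i) (at w) = (\<lambda>z. z $ i)" for w
    using frechet_derivative_at[OF coord] by simp
  then have dcoord: "d_z l (\<lambda>z :: complex ^ 'n. z $ i) w = (if i = l then 1 else 0)" for w
    by (simp add: d_z_def axis_def)
  have "(\<Sum>a\<in>UNIV. jacobian c' c x i a * jacobian c c' x a l)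
      = d_z l (\<lambda>z. transition c' c (transition c c' z) $ i) (snd c x)"
    unfolding jacobian_def[of c' c]
    by (rule d_z_transition[OF c(2,1,4,3) smooth_on_differentiable[OF transition_smooth[OF c(2,1)] x(1)],
          symmetric])
  also have "\<dots> = d_z l (\<lambda>z. z $ i) (snd c x)"
  proof -
    have "wirtinger (Hol l) (\<lambda>z. transition c' c (transition c c' z) $ i) (snd c x)
        = wirtinger (Hol l) (\<lambda>z. z $ i) (snd c x)"
      by (rule wirtinger_cong[OF open_overlap[OF c(1,2)] x(2)]) (use c in \<open>auto simp: transition_chart\<close>)
    then show ?thesis by (simp add: wirtinger.simps)
  qed
  finally show ?thesis by (simp add: dcoord)
qed

end

text \<open>
  The matrices of the two changes of frame, in the row convention of \<open>matrix_hom\<close>.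
\<close>

fun vector_matrix where
  "vector_matrix c c' x (Hol i) (Hol a) = jacobian c c' x a i"
| "vector_matrix c c' x (Anti j) (Anti b) = cnj (jacobian c' c x j b)"
| "vector_matrix c c' x _ _ = 0"

fun form_matrix where
  "form_matrix c c' x (Hol i) (Hol a) = jacobian c' c x i a"
| "form_matrix c c' x (Anti j) (Anti b) = cnj (jacobian c' c x j b)"
| "form_matrix c c' x _ _ = 0"

lemma ext_hom_vector_change: "ext_hom (vector_change c c' x) = matrix_hom (vector_matrix c c' x)"
proof -
  have "vector_change c c' x g = lin (vector_matrix c c' x g)" for g
    by (cases g) (simp_all add: lin_def sum_frame)
  then have "vector_change c c' x = (\<lambda>g. lin (vector_matrix c c' x g))" by (rule ext)
  then show ?thesis by (simp add: matrix_hom_def[abs_def])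
qed

lemma ext_hom_form_change: "ext_hom (form_change c c' x) = matrix_hom (form_matrix c c' x)"
proof -
  have "form_change c c' x g = lin (form_matrix c c' x g)" for g
    by (cases g) (simp_all add: lin_def sum_frame)
  then have "form_change c c' x = (\<lambda>g. lin (form_matrix c c' x g))" by (rule ext)
  then show ?thesis by (simp add: matrix_hom_def[abs_def])
qed

text \<open>
  Families of smooth local fields without any compatibility between charts. The total differentials
  act on them, and the identities of differential operators hold for them chart by chart.
\<close>

definition ambient_sections :: "('a, 'n::{finite,linorder}) chart set \<Rightarrow> ('a, 'n) sect set" where
  "ambient_sections \<A> = {s. (\<forall>c\<in>\<A>. smooth_field (chart_image c) (s c)) \<and>
     (\<forall>c z. c \<notin> \<A> \<or> z \<notin> chart_image c \<longrightarrow> s c z = 0)}"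

lemma smooth_sectionsD:
  assumes "s \<in> smooth_sections G \<A> p q"
  shows "c \<in> \<A> \<Longrightarrow> smooth_field (chart_image c) (s c)"
    and "c \<notin> \<A> \<or> z \<notin> chart_image c \<Longrightarrow> s c z = 0"
    and "c \<in> \<A> \<Longrightarrow> c' \<in> \<A> \<Longrightarrow> x \<in> fst c \<Longrightarrow> x \<in> fst c' \<Longrightarrow>
      s c' (snd c' x) = ext_hom (G c c' x) (s c (snd c x))"
    and "has_bidegree p q (s c z)"
  using assms unfolding smooth_sections_def smooth_field_def by blast+

lemma smooth_sectionsI:
  assumes "\<And>c. c \<in> \<A> \<Longrightarrow> smooth_field (chart_image c) (s c)"
    and "\<And>c z. c \<notin> \<A> \<or> z \<notin> chart_image c \<Longrightarrow> s c z = 0"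
    and "\<And>c c' x. c \<in> \<A> \<Longrightarrow> c' \<in> \<A> \<Longrightarrow> x \<in> fst c \<Longrightarrow> x \<in> fst c' \<Longrightarrow>
      s c' (snd c' x) = ext_hom (G c c' x) (s c (snd c x))"
    and "\<And>c z. has_bidegree p q (s c z)"
  shows "s \<in> smooth_sections G \<A> p q"
  using assms unfolding smooth_sections_def smooth_field_def by blast

lemma ambient_sectionsD:
  assumes "s \<in> ambient_sections \<A>"
  shows "c \<in> \<A> \<Longrightarrow> smooth_field (chart_image c) (s c)"
    and "c \<notin> \<A> \<or> z \<notin> chart_image c \<Longrightarrow> s c z = 0"
  using assms unfolding ambient_sections_def by blast+

lemma ambient_sectionsI:
  assumes "\<And>c. c \<in> \<A> \<Longrightarrow> smooth_field (chart_image c) (s c)"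
    and "\<And>c z. c \<notin> \<A> \<or> z \<notin> chart_image c \<Longrightarrow> s c z = 0"
  shows "s \<in> ambient_sections \<A>"
  using assms unfolding ambient_sections_def by blast

lemma zero_smooth_section: "0 \<in> smooth_sections G \<A> p q"
  by (simp add: smooth_sections_def zero_fun_apply smooth_on_const ext_hom.zero has_bidegree_zero)

lemma double_complex_of_anchors:
  fixes \<A> :: "('a, 'n::{finite,linorder}) chart set"
  assumes P: "\<And>c. c \<in> \<A> \<Longrightarrow> poisson_anchor (chart_image c) (P c)"
  shows "double_complex (smooth_sections G \<A>) (chartwise \<A> (\<lambda>c. anchor_diff (P c)))
    (ambient_sections \<A>) (int CARD('n))"
proof
  fix p q and x y :: "('a, 'n) sect"
  have U: "open (chart_image c)" if "c \<in> \<A>" for c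
    using P[OF that] by (rule poisson_anchor.U)
  have minus: "smooth_field (chart_image c) (\<lambda>z. v z - w z)"
    if "c \<in> \<A>" "smooth_field (chart_image c) v" "smooth_field (chart_image c) w" for c v w
    using smooth_field_add[OF U[OF that(1)] that(2) smooth_field_scale[OF U[OF that(1)] smooth_on_const that(3), of "-1"]]
    by simp
  show "0 \<in> smooth_sections G \<A> p q"
    by (simp add: zero_smooth_section)
  show "x - y \<in> smooth_sections G \<A> p q"
    if "x \<in> smooth_sections G \<A> p q" "y \<in> smooth_sections G \<A> p q"
  proof (rule smooth_sectionsI)
    note x = smooth_sectionsD[OF that(1)] and y = smooth_sectionsD[OF that(2)]
    show "smooth_field (chart_image c) ((x - y) c)" if "c \<in> \<A>" for c
      using minus[OF that x(1)[OF that] y(1)[OF that]] by (simp add: fun_diff_def)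
    show "(x - y) c z = 0" if "c \<notin> \<A> \<or> z \<notin> chart_image c" for c z
      using x(2)[OF that] y(2)[OF that] by (simp add: minus_apply)
    show "(x - y) c' (snd c' u) = ext_hom (G c c' u) ((x - y) c (snd c u))"
      if "c \<in> \<A>" "c' \<in> \<A>" "u \<in> fst c" "u \<in> fst c'" for c c' u
      by (simp add: minus_apply ext_hom.diff x(3)[OF that] y(3)[OF that])
    show "has_bidegree p q ((x - y) c z)" for c z
      using has_bidegree_diff[OF x(4) y(4)] by (simp add: minus_apply)
  qed
  show "smooth_sections G \<A> p q = {0}" if "p < 0 \<or> int CARD('n) < p \<or> q < 0"
  proof -
    have "s = 0" if s: "s \<in> smooth_sections G \<A> p q" for s
    proof (intro ext)
      fix c z and S :: "'n frame set"
      have "int (card (Hol -` S)) \<le> int CARD('n)"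
        using card_mono[of UNIV "Hol -` S"] by simp
      moreover have "has_bidegree p q (s c z)" by (rule smooth_sectionsD(4)[OF s])
      ultimately have "s c z S = 0"
        using \<open>p < 0 \<or> int CARD('n) < p \<or> q < 0\<close> unfolding has_bidegree_def by fastforce
      then show "s c z S = 0 c z S" by (simp add: zero_fun_apply)
    qed
    then show ?thesis using zero_smooth_section by blast
  qed
  show "smooth_sections G \<A> p q \<subseteq> ambient_sections \<A>"
    by (intro subsetI ambient_sectionsI) (auto dest: smooth_sectionsD)
  show "x - y \<in> ambient_sections \<A>" if "x \<in> ambient_sections \<A>" "y \<in> ambient_sections \<A>"
  proof (rule ambient_sectionsI)
    note x = ambient_sectionsD[OF that(1)] and y = ambient_sectionsD[OF that(2)]
    show "smooth_field (chart_image c) ((x - y) c)" if "c \<in> \<A>" for c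
      using minus[OF that x(1)[OF that] y(1)[OF that]] by (simp add: fun_diff_def)
    show "(x - y) c z = 0" if "c \<notin> \<A> \<or> z \<notin> chart_image c" for c z
      using x(2)[OF that] y(2)[OF that] by (simp add: minus_apply)
  qed
  show "chartwise \<A> (\<lambda>c. anchor_diff (P c)) (x - y)
      = chartwise \<A> (\<lambda>c. anchor_diff (P c)) x - chartwise \<A> (\<lambda>c. anchor_diff (P c)) y"
    if "x \<in> ambient_sections \<A>" "y \<in> ambient_sections \<A>"
  proof (intro ext)
    fix c z S
    have "anchor_diff (P c) ((x - y) c) z = anchor_diff (P c) (x c) z - anchor_diff (P c) (y c) z"
      if "c \<in> \<A>" "z \<in> chart_image c"
      using poisson_anchor.anchor_diff_diff[OF P[OF that(1)] _ _ that(2)]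
        ambient_sectionsD(1)[OF \<open>x \<in> ambient_sections \<A>\<close> that(1)]
        ambient_sectionsD(1)[OF \<open>y \<in> ambient_sections \<A>\<close> that(1)]
      by (simp add: fun_diff_def)
    then show "chartwise \<A> (\<lambda>c. anchor_diff (P c)) (x - y) c z S
      = (chartwise \<A> (\<lambda>c. anchor_diff (P c)) x - chartwise \<A> (\<lambda>c. anchor_diff (P c)) y) c z S"
      by (simp add: chartwise_def minus_apply zero_fun_apply)
  qed
  show "chartwise \<A> (\<lambda>c. anchor_diff (P c)) (chartwise \<A> (\<lambda>c. anchor_diff (P c)) x) = 0"
    if x: "x \<in> ambient_sections \<A>"
  proof (intro ext)
    fix c z S
    let ?D = "chartwise \<A> (\<lambda>c. anchor_diff (P c))"
    have "anchor_diff (P c) (?D x c) z = 0" if c: "c \<in> \<A>" "z \<in> chart_image c"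
    proof -
      have "anchor_diff (P c) (?D x c) z = anchor_diff (P c) (anchor_diff (P c) (x c)) z"
        by (rule anchor_diff_cong[OF U[OF c(1)] c(2)]) (simp add: chartwise_def c)
      also have "\<dots> = 0"
        by (rule poisson_anchor.anchor_diff_square[OF P[OF c(1)] ambient_sectionsD(1)[OF x c(1)] c(2)])
      finally show ?thesis .
    qed
    then show "?D (?D x) c z S = 0 c z S" by (simp add: chartwise_def[of _ _ "?D x"] zero_fun_apply)
  qed
qed

text \<open>
  The transformation law of a tensor with two upper indices.
\<close>

lemma bivector_coeff_matrix_hom:
  assumes a: "\<And>S. a S \<noteq> 0 \<Longrightarrow> card S = 2"
  shows "bivector_coeff (matrix_hom M a) b d = (\<Sum>g\<in>UNIV. \<Sum>h\<in>UNIV. M g b * M h d * bivector_coeff a g h)"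
proof -
  let ?\<pi> = "bivector_coeff a"
  have "contract d (contract b (vec_wedge p (vec_wedge q ext_one)))
      = scale (p b * q d) ext_one - scale (q b * p d) ext_one" for p q
    by (simp add: contract_vec_wedge contract.diff contract.scale vec_wedge.zero vec_wedge.scale)
  then have elem: "contract d (contract b (vec_wedge p (vec_wedge q ext_one))) {} = p b * q d - q b * p d" for p q
    by (simp add: pointwise ext_one_def)
  have gen: "matrix_hom M (gen g) = vec_wedge (M g) ext_one" for g
    using matrix_hom_wedge_gen[of M g ext_one] by simp
  have "matrix_hom M a = matrix_hom M (scale (1/2) (biv_wedge ?\<pi> ext_one))"
    using bivector_expand[OF a] by simp
  also have "\<dots> = scale (1/2) (\<Sum>g\<in>UNIV. \<Sum>h\<in>UNIV. scale (?\<pi> g h) (vec_wedge (M g) (vec_wedge (M h) ext_one)))"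
    by (simp add: matrix_hom.scale biv_wedge_def matrix_hom.sum matrix_hom_wedge_gen vec_wedge_sum[of "?\<pi> _"]
        vec_wedge.sum vec_wedge.scale gen)
  finally have hom: "matrix_hom M a
      = scale (1/2) (\<Sum>g\<in>UNIV. \<Sum>h\<in>UNIV. scale (?\<pi> g h) (vec_wedge (M g) (vec_wedge (M h) ext_one)))" .
  have "bivector_coeff (matrix_hom M a) b d = contract d (contract b (matrix_hom M a)) {}"
    by (rule bivector_coeff_def)
  also have "\<dots> = 1/2 * (\<Sum>g\<in>UNIV. \<Sum>h\<in>UNIV. ?\<pi> g h * (M g b * M h d - M h b * M g d))"
    by (simp only: hom contract.scale contract.sum scale_apply sum_apply[where x = "{}"] elem)
  also have "(\<Sum>g\<in>UNIV. \<Sum>h\<in>UNIV. ?\<pi> g h * (M g b * M h d - M h b * M g d))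
      = (\<Sum>g\<in>UNIV. \<Sum>h\<in>UNIV. ?\<pi> g h * (M g b * M h d)) - (\<Sum>g\<in>UNIV. \<Sum>h\<in>UNIV. ?\<pi> g h * (M h b * M g d))"
    by (simp add: right_diff_distrib sum_subtractf)
  also have "(\<Sum>g\<in>UNIV. \<Sum>h\<in>UNIV. ?\<pi> g h * (M h b * M g d))
      = (\<Sum>h\<in>UNIV. \<Sum>g\<in>UNIV. - (?\<pi> h g * (M h b * M g d)))"
    by (subst sum.swap) (intro sum.cong refl, subst bivector_coeff_antisymmetric, simp)
  finally show ?thesis by (simp add: sum_negf mult_ac)
qed


lemma matrix_hom_fix:
  assumes "has_bidegree 2 0 a" "has_bidegree 0 q b"
  shows "matrix_hom (anchor a) b = b"
proof -
  have "matrix_hom (anchor a) b = ext_hom gen b"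
    unfolding matrix_hom_def
  proof (rule ext_hom_cong)
    fix S g assume "b S \<noteq> 0" "g \<in> S"
    then have "Hol -` S = {}" using assms(2) by (auto simp: has_bidegree_def)
    then obtain j where "g = Anti j" using \<open>g \<in> S\<close> by (cases g) auto
    then have "anchor a g = (\<lambda>k. if g = k then 1 else 0)"
      using anchor_Anti[OF assms(1)] by (intro ext) simp
    then show "lin (anchor a g) = gen g" by (simp add: lin_delta)
  qed
  then show ?thesis by (simp add: ext_hom_gen)
qed

text \<open>
  In column \<open>0\<close> only conjugate differentials occur, and these change in the same way in both
  complexes.
\<close>

lemma column_zero_form:
  assumes "s \<in> polyvector_sections \<A> 0 q"
  shows "s \<in> form_sections \<A> 0 q"
  unfolding form_sections_def
proof (rule smooth_sectionsI)
  note s = smooth_sectionsD[OF assms[unfolded polyvector_sections_def]]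
  fix c c' x assume "c \<in> \<A>" "c' \<in> \<A>" "x \<in> fst c" "x \<in> fst c'"
  then have "s c' (snd c' x) = ext_hom (vector_change c c' x) (s c (snd c x))" by (rule s(3))
  also have "\<dots> = ext_hom (form_change c c' x) (s c (snd c x))"
  proof (rule ext_hom_cong)
    fix S g assume "s c (snd c x) S \<noteq> 0" "g \<in> S"
    then have "Hol -` S = {}" using s(4)[of c "snd c x"] by (auto simp: has_bidegree_def)
    then obtain j where "g = Anti j" using \<open>g \<in> S\<close> by (cases g) auto
    then show "vector_change c c' x g = form_change c c' x g" by simp
  qed
  finally show "s c' (snd c' x) = ext_hom (form_change c c' x) (s c (snd c x))" .
qed (use smooth_sectionsD[OF assms[unfolded polyvector_sections_def]] in auto)

lemma has_bidegree_field_deriv: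
  assumes "\<And>y. has_bidegree p q (v y)" shows "has_bidegree p q (field_deriv g v z)"
  unfolding has_bidegree_def
proof (intro allI impI)
  fix S assume ne: "field_deriv g v z S \<noteq> 0"
  have "\<exists>y. v y S \<noteq> 0"
  proof (rule ccontr)
    assume "\<nexists>y. v y S \<noteq> 0"
    then have "(\<lambda>y. v y S) = (\<lambda>y. 0)" by auto
    then show False using ne by (simp add: field_deriv_def)
  qed
  then show "int (card (Hol -` S)) = p \<and> int (card (Anti -` S)) = q"
    using assms unfolding has_bidegree_def by blast
qed

lemma del_loc_field_deriv: "del_loc v z = (\<Sum>i\<in>UNIV. wedge (gen (Hol i)) (field_deriv (Hol i) v z))"
  by (simp add: del_loc_def field_deriv_def wirtinger.simps)

lemma dbar_loc_field_deriv: "dbar_loc v z = (\<Sum>i\<in>UNIV. wedge (gen (Anti i)) (field_deriv (Anti i) v z))"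
  by (simp add: dbar_loc_def field_deriv_def wirtinger.simps)

lemma differentiable_compose_vec:
  fixes \<tau> :: "'v::real_normed_vector \<Rightarrow> complex ^ 'm::finite"
  assumes "f differentiable (at (\<tau> w))" "\<And>k. (\<lambda>y. \<tau> y $ k) differentiable (at w)"
  shows "(\<lambda>y. f (\<tau> y)) differentiable (at w)"
  using has_derivative_compose[where f = \<tau> and s = UNIV, OF has_derivative_vec[OF assms(2)]
      has_derivative_frechet[OF assms(1)]]
  unfolding differentiable_def by blast

context
  fixes X :: "'a topology" and \<A> :: "('a, 'n::{finite,linorder}) chart set"
  assumes manifold: "complex_manifold X \<A>"
begin

text \<open>
  In other coordinates the coefficients of a \<open>(0,q)\<close>-form are multiplied by minors of the conjugate
  Jacobian matrix. These are antiholomorphic, so \<open>d_z\<close> acts on the coefficients alone, and the chain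
  rule supplies the holomorphic Jacobian matrix by which the \<open>dz\<^sub>i\<close> change.
\<close>

lemma del_loc_transform:
  assumes s: "s \<in> form_sections \<A> 0 q" and c: "c \<in> \<A>" "c' \<in> \<A>" "x \<in> fst c" "x \<in> fst c'"
  shows "del_loc (s c') (snd c' x) = matrix_hom (form_matrix c c' x) (del_loc (s c) (snd c x))"
proof -
  note sD = smooth_sectionsD[OF s[unfolded form_sections_def]]
  define W where "W = snd c' ` (fst c' \<inter> fst c)"
  define \<tau> where "\<tau> = transition c' c"
  define M where "M g k w = (case g of
      Hol i \<Rightarrow> (case k of Hol a \<Rightarrow> d_z a (\<lambda>w. \<tau> w $ i) w | Anti b \<Rightarrow> 0)
    | Anti j \<Rightarrow> (case k of Hol a \<Rightarrow> 0 | Anti b \<Rightarrow> cnj (d_z b (\<lambda>w. \<tau> w $ j) w)))" for g k w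
  have W: "open W" unfolding W_def by (rule open_overlap[OF manifold c(2,1)])
  have w: "snd c' x \<in> W" unfolding W_def using c by blast
  have \<tau>w: "\<tau> (snd c' x) = snd c x" unfolding \<tau>_def by (rule transition_chart[OF manifold c(2,4)])
  have z: "snd c x \<in> chart_image c" using c by (simp add: chart_image_def)
  have sm\<tau>: "smooth_on W (\<lambda>w. \<tau> w $ k)" for k
    unfolding W_def \<tau>_def by (rule transition_smooth[OF manifold c(2,1)])
  have smd: "smooth_on W (\<lambda>w. d_z a (\<lambda>w. \<tau> w $ k) w)" for a k
    using smooth_on_wirtinger[OF W sm\<tau>, of "Hol a"] by (simp add: wirtinger.simps)
  have smM: "smooth_on W (M g k)" for g k
    unfolding M_def[abs_def]
    by (cases g; cases k)
      (auto intro: smooth_on_const smd smooth_on_bounded_linear[OF W bounded_linear_cnj])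
  have FM: "form_matrix c c' x = (\<lambda>g k. M g k (snd c' x))"
  proof (intro ext)
    show "form_matrix c c' x g k = M g k (snd c' x)" for g k
      by (cases g; cases k) (simp_all add: M_def jacobian_def \<tau>_def)
  qed
  let ?word = "\<lambda>S w. word (\<lambda>g. lin (\<lambda>k. M g k w)) S"
  have sm_word: "smooth_field W (?word S)" for S
    by (rule smooth_field_word[OF W smM])
  \<comment> \<open>the entries of the conjugate Jacobian matrix are antiholomorphic\<close>
  have anti: "wirtinger (Hol i) (M (Anti j) k) (snd c' x) = 0" for i j k
  proof (cases k)
    case (Anti b)
    have "wirtinger (Anti i) (wirtinger (Hol b) (\<lambda>w. \<tau> w $ j)) (snd c' x)
        = wirtinger (Hol b) (wirtinger (Anti i) (\<lambda>w. \<tau> w $ j)) (snd c' x)"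
      by (rule wirtinger_commute[OF W sm\<tau> w])
    also have "\<dots> = wirtinger (Hol b) (\<lambda>w. 0) (snd c' x)"
      by (rule wirtinger_cong[OF W w])
         (simp add: wirtinger.simps \<tau>_def W_def transition_d_zbar[OF manifold c(2,1)])
    also have "\<dots> = 0" by (rule wirtinger_const)
    finally have "d_zbar i (\<lambda>w. d_z b (\<lambda>w. \<tau> w $ j) w) (snd c' x) = 0" by (simp add: wirtinger.simps)
    then show ?thesis
      using d_z_cnj[OF smooth_on_differentiable[OF smd w]]
      by (simp add: M_def[abs_def] Anti wirtinger.simps)
  qed (simp add: M_def[abs_def])
  \<comment> \<open>and so are its minors\<close>
  have const_word: "field_deriv (Hol i) (?word S) (snd c' x) = 0" if "Hol -` S = {}" for i S
  proof -
    have "finite S" by simp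
    then show ?thesis using that
    proof (induction S)
      case (insert g S)
      then obtain j where g: "g = Anti j" by (cases g) auto
      have IH: "field_deriv (Hol i) (?word S) (snd c' x) = 0" using insert by auto
      show ?case
        unfolding g matrix_word_insert[OF insert.hyps(2)[unfolded g]]
        by (simp add: field_deriv_scale[OF W w smooth_on_const] smooth_field_vec_wedge[OF W smM sm_word]
            field_deriv_vec_wedge[OF W w smM sm_word] anti IH vec_wedge.zero)
           (simp add: vec_wedge_sum)
    qed simp
  qed
  have deriv: "field_deriv (Hol i) (s c') (snd c' x)
      = (\<Sum>a\<in>UNIV. scale (d_z i (\<lambda>w. \<tau> w $ a) (snd c' x))
          (matrix_hom (form_matrix c c' x) (field_deriv (Hol a) (s c) (snd c x))))" for i
  proof
    fix S'
    have diff: "(\<lambda>w. s c (\<tau> w) S) differentiable (at (snd c' x))" for S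
      by (rule differentiable_compose_vec)
         (use sD(1)[OF c(1)] z smooth_on_differentiable[OF sm\<tau> w] in
           \<open>auto simp: \<tau>w smooth_field_def intro: smooth_on_differentiable\<close>)
    have diff_word: "(\<lambda>w. ?word S w S') differentiable (at (snd c' x))" for S
      using sm_word[of S] w by (auto simp: smooth_field_def intro: smooth_on_differentiable)
    have chain: "wirtinger (Hol i) (\<lambda>w. s c (\<tau> w) S) (snd c' x)
      = (\<Sum>a\<in>UNIV. field_deriv (Hol a) (s c) (snd c x) S * d_z i (\<lambda>w. \<tau> w $ a) (snd c' x))" for S
    proof -
      have "(\<lambda>z. s c z S) differentiable (at (snd c x))"
        using sD(1)[OF c(1)] z by (auto simp: smooth_field_def intro: smooth_on_differentiable)
      from d_z_transition[OF manifold c this, of i]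
      show ?thesis by (simp add: wirtinger.simps field_deriv_def jacobian_def \<tau>_def)
    qed
    have local: "s c' w S' = (\<Sum>S\<in>UNIV. s c (\<tau> w) S * ?word S w S')" if wW: "w \<in> W" for w
    proof -
      obtain u where u: "u \<in> fst c" "u \<in> fst c'" "w = snd c' u" using wW by (auto simp: W_def)
      have "form_matrix c c' u = (\<lambda>g k. M g k w)"
      proof (intro ext)
        show "form_matrix c c' u g k = M g k w" for g k
          by (cases g; cases k) (simp_all add: M_def jacobian_def \<tau>_def u(3))
      qed
      then have "s c' w = matrix_hom (\<lambda>g k. M g k w) (s c (\<tau> w))"
        using sD(3)[OF c(1,2) u(1,2)] transition_chart[OF manifold c(2) u(2), of c]
        by (simp add: u(3) \<tau>_def ext_hom_form_change)
      then show ?thesis by (simp add: matrix_hom_def ext_hom_word pointwise)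
    qed
    \<comment> \<open>basis elements with a holomorphic factor do not occur in a \<open>(0,q)\<close>-form\<close>
    have drop: "s c (snd c x) S * wirtinger (Hol i) (\<lambda>w. ?word S w S') (snd c' x) = 0" for S
    proof (cases "s c (snd c x) S = 0")
      case False
      then have "Hol -` S = {}" using sD(4)[of c "snd c x"] by (auto simp: has_bidegree_def)
      then show ?thesis using fun_cong[OF const_word[of S i], of S'] by (simp add: field_deriv_def zero_fun_apply)
    qed simp
    have "field_deriv (Hol i) (s c') (snd c' x) S'
        = wirtinger (Hol i) (\<lambda>w. \<Sum>S\<in>UNIV. s c (\<tau> w) S * ?word S w S') (snd c' x)"
      unfolding field_deriv_def by (rule wirtinger_cong[OF W w local])
    also have "\<dots> = (\<Sum>S\<in>UNIV. wirtinger (Hol i) (\<lambda>w. s c (\<tau> w) S) (snd c' x) * ?word S (snd c' x) S')"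
      by (simp add: wirtinger_sum wirtinger_mult diff diff_word \<tau>w drop)
    also have "\<dots> = (\<Sum>S\<in>UNIV. \<Sum>a\<in>UNIV. d_z i (\<lambda>w. \<tau> w $ a) (snd c' x)
        * (field_deriv (Hol a) (s c) (snd c x) S * ?word S (snd c' x) S'))"
      by (simp add: chain sum_distrib_right sum_distrib_left mult_ac)
    also have "\<dots> = (\<Sum>a\<in>UNIV. d_z i (\<lambda>w. \<tau> w $ a) (snd c' x)
        * (\<Sum>S\<in>UNIV. field_deriv (Hol a) (s c) (snd c x) S * ?word S (snd c' x) S'))"
      by (subst sum.swap) (simp add: sum_distrib_left)
    finally show "field_deriv (Hol i) (s c') (snd c' x) S'
      = (\<Sum>a\<in>UNIV. scale (d_z i (\<lambda>w. \<tau> w $ a) (snd c' x))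
          (matrix_hom (form_matrix c c' x) (field_deriv (Hol a) (s c) (snd c x)))) S'"
      by (simp add: matrix_hom_def ext_hom_word pointwise FM)
  qed
  have row: "vec_wedge (form_matrix c c' x (Hol a)) b
      = (\<Sum>i\<in>UNIV. scale (d_z i (\<lambda>w. \<tau> w $ a) (snd c' x)) (wedge (gen (Hol i)) b))" for a b
    by (simp add: vec_wedge_sum sum_frame jacobian_def \<tau>_def)
  have "del_loc (s c') (snd c' x) = (\<Sum>i\<in>UNIV. \<Sum>a\<in>UNIV. scale (d_z i (\<lambda>w. \<tau> w $ a) (snd c' x))
      (wedge (gen (Hol i)) (matrix_hom (form_matrix c c' x) (field_deriv (Hol a) (s c) (snd c x)))))"
    by (simp add: del_loc_field_deriv deriv wedge_right.sum wedge_right.scale)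
  also have "\<dots> = matrix_hom (form_matrix c c' x) (del_loc (s c) (snd c x))"
    by (subst sum.swap) (simp add: del_loc_field_deriv matrix_hom.sum matrix_hom_wedge_gen row)
  finally show ?thesis .
qed

lemma del_op_form_section:
  assumes s: "s \<in> form_sections \<A> 0 q"
  shows "del_op \<A> s \<in> form_sections \<A> 1 q"
  unfolding form_sections_def
proof (rule smooth_sectionsI)
  note sD = smooth_sectionsD[OF s[unfolded form_sections_def]]
  have val: "del_op \<A> s c z = (if c \<in> \<A> \<and> z \<in> chart_image c then del_loc (s c) z else 0)" for c z
    by (simp add: del_op_def chartwise_def)
  show "smooth_field (chart_image c) (del_op \<A> s c)" if c: "c \<in> \<A>" for c
  proof -
    have U: "open (chart_image c)" by (rule open_chart_image[OF manifold c])
    have "smooth_field (chart_image c) (\<lambda>z. del_loc (s c) z)"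
      unfolding del_loc_field_deriv
      by (intro smooth_field_sum[OF U] smooth_field_linear[OF U wedge_right.ext_linear_axioms]
          smooth_field_deriv[OF U] sD(1) c)
    then have "smooth_on (chart_image c) (\<lambda>z. del_loc (s c) z S)" for S
      by (simp add: smooth_field_def)
    from smooth_on_cong[OF U _ this] show ?thesis by (simp add: smooth_field_def val c)
  qed
  show "del_op \<A> s c z = 0" if "c \<notin> \<A> \<or> z \<notin> chart_image c" for c z
    using that by (auto simp: val)
  show "has_bidegree 1 q (del_op \<A> s c z)" for c z
  proof -
    have "has_bidegree 1 q (del_loc (s c) z)"
      unfolding del_loc_field_deriv
      using has_bidegree_wedge_Hol[OF has_bidegree_field_deriv[of 0 q "s c"]] sD(4)
      by (intro has_bidegree_sum) simp
    then show ?thesis by (simp add: val has_bidegree_zero)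
  qed
  show "del_op \<A> s c' (snd c' x) = ext_hom (form_change c c' x) (del_op \<A> s c (snd c x))"
    if "c \<in> \<A>" "c' \<in> \<A>" "x \<in> fst c" "x \<in> fst c'" for c c' x
  proof -
    have "snd c x \<in> chart_image c" "snd c' x \<in> chart_image c'"
      using that by (auto simp: chart_image_def)
    then show ?thesis using del_loc_transform[OF s that] that(1,2) by (simp only: val ext_hom_form_change if_True simp_thms)
  qed
qed

end


section \<open>The anchor as a map of double complexes\<close>

locale poisson_manifold =
  fixes X :: "'a topology" and \<A> :: "('a, 'n::{finite,linorder}) chart set" and \<Lambda> :: "('a, 'n) sect"
  assumes poisson: "holomorphic_poisson_manifold X \<A> \<Lambda>"
begin

lemma manifold: "complex_manifold X \<A>"
  using poisson by (simp add: holomorphic_poisson_manifold_def)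

lemma \<Lambda>_section: "\<Lambda> \<in> smooth_sections vector_change \<A> 2 0"
  using poisson by (simp add: holomorphic_poisson_manifold_def polyvector_sections_def)

lemmas \<Lambda>_bidegree = smooth_sectionsD(4)[OF \<Lambda>_section]

lemma poisson_field_chart:
  assumes c: "c \<in> \<A>" shows "poisson_field (chart_image c) (\<Lambda> c)"
proof
  show "open (chart_image c)" by (rule open_chart_image[OF manifold c])
  show "holo_on (chart_image c) (\<lambda>z. \<Lambda> c z S)" for S
    using poisson c by (simp add: holomorphic_poisson_manifold_def)
  show "has_bidegree 2 0 (\<Lambda> c z)" for z by (rule \<Lambda>_bidegree)
  show "ad_loc (\<Lambda> c) (\<Lambda> c) z = 0" if "z \<in> chart_image c" for z
  proof -
    have "ad_op \<A> \<Lambda> \<Lambda> c z = 0 c z" using poisson by (simp add: holomorphic_poisson_manifold_def)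
    then show ?thesis using c that by (simp add: ad_op_def chartwise_def zero_fun_apply)
  qed
qed

abbreviation \<Lambda>_anchor where "\<Lambda>_anchor c \<equiv> \<lambda>g k z. anchor (\<Lambda> c z) g k"

abbreviation D_poisson where "D_poisson \<equiv> \<lambda>s. dbar_op \<A> s + ad_op \<A> \<Lambda> s"

abbreviation D_form where "D_form \<equiv> \<lambda>s. del_op \<A> s + dbar_op \<A> s"

lemma poisson_anchor_chart: "c \<in> \<A> \<Longrightarrow> poisson_anchor (chart_image c) (\<Lambda>_anchor c)"
  by (rule poisson_field.poisson_anchor_anchor[OF poisson_field_chart])

lemma D_poisson_eq: "D_poisson = chartwise \<A> (\<lambda>c. anchor_diff (\<Lambda>_anchor c))"
proof (intro ext)
  fix s c z S
  show "(dbar_op \<A> s + ad_op \<A> \<Lambda> s) c z S = chartwise \<A> (\<lambda>c. anchor_diff (\<Lambda>_anchor c)) s c z S"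
    by (simp add: dbar_op_def ad_op_def chartwise_def plus_fun_apply zero_fun_apply
        poisson_field.anchor_diff_eq[OF poisson_field_chart])
qed

lemma D_form_eq: "D_form = chartwise \<A> (\<lambda>_. anchor_diff (\<lambda>g k _. if g = k then 1 else 0))"
proof (intro ext)
  fix s c z S
  show "(del_op \<A> s + dbar_op \<A> s) c z S
      = chartwise \<A> (\<lambda>_. anchor_diff (\<lambda>g k _. if g = k then 1 else 0)) s c z S"
    by (simp add: dbar_op_def del_op_def chartwise_def plus_fun_apply zero_fun_apply
        del_dbar_loc[unfolded fun_eq_iff plus_fun_apply, rule_format] flip: de_rham_anchor_diff)
qed

sublocale polyvectors: double_complex "polyvector_sections \<A>" D_poisson "ambient_sections \<A>" "int CARD('n)"
  unfolding polyvector_sections_def D_poisson_eq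
  by (rule double_complex_of_anchors) (rule poisson_anchor_chart)

sublocale forms: double_complex "form_sections \<A>" D_form "ambient_sections \<A>" "int CARD('n)"
  unfolding form_sections_def D_form_eq
proof (rule double_complex_of_anchors)
  fix c assume "c \<in> \<A>"
  show "poisson_anchor (chart_image c) (\<lambda>g k _. if g = k then 1 else 0)"
    using open_chart_image[OF manifold \<open>c \<in> \<A>\<close>] by (rule poisson_anchor_trivial)
qed

text \<open>
  The anchor \<open>\<Lambda>\<^sup>#\<close> on families of local fields.
\<close>

definition sharp :: "('a, 'n) sect \<Rightarrow> ('a, 'n) sect" where
  "sharp s = (\<lambda>c z. matrix_hom (anchor (\<Lambda> c z)) (s c z))"

lemma sharp_apply: "sharp s c z = matrix_hom (anchor (\<Lambda> c z)) (s c z)"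
  by (simp add: sharp_def)

lemma sharp_diff: "sharp (x - y) = sharp x - sharp y"
  by (simp add: sharp_def fun_eq_iff minus_apply matrix_hom.diff)

lemma sharp_zero: "sharp 0 = 0"
  using sharp_diff[of 0 0] by simp

lemma sharp_add: "sharp (x + y) = sharp x + sharp y"
  using sharp_diff[of "x + y" y] by (simp add: algebra_simps)

lemma sharp_sum: "sharp (\<Sum>i\<in>I. f i) = (\<Sum>i\<in>I. sharp (f i))"
  by (induction I rule: infinite_finite_induct) (simp_all add: sharp_zero sharp_add)

text \<open>
  The matrix of \<open>\<Lambda>\<^sup>#\<close> intertwines the changes of frame of forms and of vectors: the bivector
  transforms with the Jacobian matrix \<open>J\<close> in both indices, and the inverse of \<open>J\<close>, by which forms change,
  cancels one of the two.
\<close>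

lemma anchor_transform:
  assumes c: "c \<in> \<A>" "c' \<in> \<A>" "x \<in> fst c" "x \<in> fst c'"
  shows "(\<Sum>d\<in>UNIV. form_matrix c c' x g d * anchor (\<Lambda> c' (snd c' x)) d k)
    = (\<Sum>d\<in>UNIV. anchor (\<Lambda> c (snd c x)) g d * vector_matrix c c' x d k)"
proof -
  let ?\<pi> = "bivector_coeff (\<Lambda> c (snd c x))"
  have \<pi>': "bivector_coeff (\<Lambda> c' (snd c' x)) (Hol b) (Hol a)
      = (\<Sum>m\<in>UNIV. \<Sum>l\<in>UNIV. jacobian c c' x b m * jacobian c c' x a l * ?\<pi> (Hol m) (Hol l))" for a b
    using bivector_coeff_matrix_hom[OF has_bidegree_card[OF \<Lambda>_bidegree[of c "snd c x"]],
        where M = "vector_matrix c c' x" and b = "Hol b" and d = "Hol a"]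
    by (simp add: smooth_sectionsD(3)[OF \<Lambda>_section c] ext_hom_vector_change sum_frame)
  show ?thesis
  proof (cases g; cases k)
    fix i b assume g: "g = Hol i" and k: "k = Hol b"
    have "(\<Sum>d\<in>UNIV. form_matrix c c' x g d * anchor (\<Lambda> c' (snd c' x)) d k)
        = (\<Sum>a\<in>UNIV. \<Sum>m\<in>UNIV. \<Sum>l\<in>UNIV. jacobian c' c x i a * (jacobian c c' x b m * jacobian c c' x a l * ?\<pi> (Hol m) (Hol l)))"
      by (simp add: g k sum_frame anchor_Hol \<pi>' sum_distrib_left)
    also have "\<dots> = (\<Sum>m\<in>UNIV. \<Sum>a\<in>UNIV. \<Sum>l\<in>UNIV. jacobian c' c x i a * (jacobian c c' x b m * jacobian c c' x a l * ?\<pi> (Hol m) (Hol l)))"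
      by (rule sum.swap)
    also have "\<dots> = (\<Sum>m\<in>UNIV. \<Sum>l\<in>UNIV. \<Sum>a\<in>UNIV. jacobian c' c x i a * (jacobian c c' x b m * jacobian c c' x a l * ?\<pi> (Hol m) (Hol l)))"
      by (intro sum.cong refl sum.swap)
    also have "\<dots> = (\<Sum>m\<in>UNIV. \<Sum>l\<in>UNIV. jacobian c c' x b m * ?\<pi> (Hol m) (Hol l)
        * (\<Sum>a\<in>UNIV. jacobian c' c x i a * jacobian c c' x a l))"
      by (simp add: sum_distrib_left mult_ac)
    also have "\<dots> = (\<Sum>m\<in>UNIV. jacobian c c' x b m * ?\<pi> (Hol m) (Hol i))"
      by (simp add: jacobian_inverse[OF manifold c] if_distrib cong: if_cong)
    also have "\<dots> = (\<Sum>d\<in>UNIV. anchor (\<Lambda> c (snd c x)) g d * vector_matrix c c' x d k)"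
      by (simp add: g k sum_frame anchor_Hol mult.commute)
    finally show ?thesis .
  qed (simp_all add: sum_frame anchor_Hol anchor_Anti[OF \<Lambda>_bidegree] bivector_coeff_Anti[OF \<Lambda>_bidegree]
      if_distrib if_distribR cong: if_cong)
qed

lemma sharp_piece:
  assumes s: "s \<in> form_sections \<A> p q" shows "sharp s \<in> polyvector_sections \<A> p q"
  unfolding polyvector_sections_def
proof (rule smooth_sectionsI)
  note sD = smooth_sectionsD[OF s[unfolded form_sections_def]]
  show "smooth_field (chart_image c) (sharp s c)" if c: "c \<in> \<A>" for c
    unfolding sharp_def by (rule poisson_anchor.smooth_field_matrix_hom[OF poisson_anchor_chart[OF c] sD(1)[OF c]])
  show "sharp s c z = 0" if "c \<notin> \<A> \<or> z \<notin> chart_image c" for c z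
    using sD(2)[OF that] by (simp add: sharp_def matrix_hom.zero)
  show "has_bidegree p q (sharp s c z)" for c z
    unfolding sharp_def by (rule has_bidegree_matrix_hom[OF block_diagonal_anchor[OF \<Lambda>_bidegree] sD(4)])
  show "sharp s c' (snd c' x) = ext_hom (vector_change c c' x) (sharp s c (snd c x))"
    if c: "c \<in> \<A>" "c' \<in> \<A>" "x \<in> fst c" "x \<in> fst c'" for c c' x
    by (simp add: sharp_def sD(3)[OF c] ext_hom_form_change ext_hom_vector_change matrix_hom_compose
        anchor_transform[OF c])
qed

lemma sharp_filtration:
  assumes "x \<in> filtration (form_sections \<A>) p m"
  shows "sharp x \<in> filtration (polyvector_sections \<A>) p m"
proof -
  from assms obtain a where a: "x = (\<Sum>i\<in>{p..m}. a i)" "\<forall>i\<in>{p..m}. a i \<in> form_sections \<A> i (m - i)"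
    unfolding filtration_def by auto
  show ?thesis unfolding filtration_def
    by (rule CollectI, rule exI[of _ "\<lambda>i. sharp (a i)"]) (use a sharp_piece in \<open>auto simp: sharp_sum\<close>)
qed

lemma D_sharp:
  assumes s: "s \<in> ambient_sections \<A>"
  shows "D_poisson (sharp s) = sharp (D_form s)"
proof (intro ext)
  fix c z S
  have "anchor_diff (\<Lambda>_anchor c) (sharp s c) z = matrix_hom (anchor (\<Lambda> c z)) (de_rham (s c) z)"
    if c: "c \<in> \<A>" "z \<in> chart_image c"
    unfolding sharp_def
    by (rule poisson_anchor.anchor_diff_matrix_hom[OF poisson_anchor_chart[OF c(1)] ambient_sectionsD(1)[OF s c(1)] c(2)])
  then show "D_poisson (sharp s) c z S = sharp (D_form s) c z S"
    unfolding fun_cong[OF D_poisson_eq] fun_cong[OF D_form_eq] de_rham_anchor_diff[symmetric]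
    by (simp add: chartwise_def sharp_apply matrix_hom.zero)
qed

text \<open>
  The component of \<open>D x\<close> in column \<open>0\<close> is \<open>\<partial>\<close>-bar of the leading part, since \<open>ad\<^sub>\<Lambda>\<close> raises the
  column. This component is read off from the coefficients at the basis elements without
  holomorphic factors.
\<close>

lemma dbar_closed_leading_part:
  assumes x: "x \<in> cycles (polyvector_sections \<A>) D_poisson 1 0 q"
    and x0: "x0 \<in> polyvector_sections \<A> 0 q" and rest: "x - x0 \<in> filtration (polyvector_sections \<A>) 1 q"
  shows "dbar_op \<A> x0 = 0"
proof -
  have van: "u c z S = 0" if "u \<in> filtration (polyvector_sections \<A>) 1 m" "Hol -` S = {}" for u m c z S
  proof -
    from that(1) obtain a where a: "u = (\<Sum>i\<in>{1..m}. a i)" "\<forall>i\<in>{1..m}. a i \<in> polyvector_sections \<A> i (m - i)"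
      unfolding filtration_def by auto
    have "a i c z S = 0" if "i \<in> {1..m}" for i
    proof (rule ccontr)
      assume "a i c z S \<noteq> 0"
      moreover have "has_bidegree i (m - i) (a i c z)"
        using a(2) that smooth_sectionsD(4) unfolding polyvector_sections_def by blast
      ultimately have "int (card (Hol -` S)) = i" unfolding has_bidegree_def by blast
      then show False using \<open>Hol -` S = {}\<close> that by simp
    qed
    then show ?thesis unfolding a(1) by (simp add: sum_apply[where x = c] sum_apply[where x = z] sum_apply[where x = S])
  qed
  have ad: "ad_loc L v z S = 0" if "Hol -` S = {}" "\<And>S. (\<lambda>y. L y S) differentiable (at z)" for L v z and S :: "'n frame set"
  proof -
    have "wedge (gen (Hol i)) a S = 0" for i a using that(1) by (auto simp: wedge_gen_apply)
    then show ?thesis unfolding ad_loc_formula[OF that(2)]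
      by (simp add: sum_apply[where x = S] case_prod_unfold pointwise)
  qed
  have D: "D_poisson u c z S = dbar_loc (u c) z S" if "c \<in> \<A>" "z \<in> chart_image c" "Hol -` S = {}" for u c z S
    using that ad[OF that(3) smooth_on_differentiable[OF poisson_field.smooth_L[OF poisson_field_chart[OF that(1)]] that(2)]]
    by (simp add: dbar_op_def ad_op_def chartwise_def plus_fun_apply)
  have amb: "x \<in> ambient_sections \<A>" "x0 \<in> ambient_sections \<A>"
    using polyvectors.cycles_ambient[OF x] polyvectors.piece_ambient x0 by auto
  have Dx: "D_poisson x \<in> filtration (polyvector_sections \<A>) 1 (q + 1)"
    using x by (simp add: cycles_def)
  have zero: "dbar_loc (x0 c) z S = 0" if c: "c \<in> \<A>" "z \<in> chart_image c" for c z S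
  proof (cases "Hol -` S = {}")
    case True
    have "(\<lambda>y. (x - x0) c y T) = (\<lambda>y. 0)" if "Hol -` T = {}" for T
      using van[OF rest that] by (rule ext)
    then have "dbar_loc ((x - x0) c) z S = 0"
      unfolding dbar_loc_field_deriv sum_apply[where x = S]
    proof (intro sum.neutral ballI)
      fix i
      have "Hol -` (S - {Anti i}) = {}" using True by (simp add: vimage_Hol_remove)
      with \<open>\<And>T. Hol -` T = {} \<Longrightarrow> (\<lambda>y. (x - x0) c y T) = (\<lambda>y. 0)\<close>
      have "field_deriv (Anti i) ((x - x0) c) z (S - {Anti i}) = 0"
        unfolding field_deriv_def by (simp only: wirtinger_const)
      then show "wedge (gen (Anti i)) (field_deriv (Anti i) ((x - x0) c) z) S = 0"
        by (simp add: wedge_gen_apply)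
    qed
    then have "D_poisson (x - x0) c z S = 0" using D[OF c True] by simp
    moreover have "D_poisson x c z S = 0" by (rule van[OF Dx True])
    moreover have "D_poisson (x - x0) = D_poisson x - D_poisson x0"
      by (rule polyvectors.D_diff[OF amb])
    ultimately have "D_poisson x0 c z S = 0" by (simp add: minus_apply)
    then show ?thesis using D[OF c True] by simp
  next
    case False
    have "has_bidegree 0 q (x0 c y)" for y
      using smooth_sectionsD(4)[OF x0[unfolded polyvector_sections_def]] .
    then have "has_bidegree 0 (q + 1) (dbar_loc (x0 c) z)"
      unfolding dbar_loc_field_deriv
      by (intro has_bidegree_sum has_bidegree_wedge_Anti has_bidegree_field_deriv)
    then show ?thesis using False by (auto simp: has_bidegree_def)
  qed
  show ?thesis
  proof (intro ext)
    show "dbar_op \<A> x0 c z S = 0 c z S" for c z S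
      using zero by (simp add: dbar_op_def chartwise_def zero_fun_apply)
  qed
qed

text \<open>
  The leading part \<open>x0\<close> is a \<open>\<partial>\<close>-bar-closed form and a cycle of the Froelicher spectral sequence.
  Its closed extension \<open>y\<close> is carried by \<open>\<Lambda>\<^sup>#\<close> to a closed polyvector, and \<open>\<Lambda>\<^sup>#\<close> fixes \<open>x0\<close>.
\<close>

lemma first_column_extends:
  assumes deg: "frolicher_degenerates_at \<A> 1"
    and x: "x \<in> cycles (polyvector_sections \<A>) D_poisson 1 0 q"
  shows "\<exists>y. y \<in> filtration (polyvector_sections \<A>) 0 q \<and> D_poisson y = 0
    \<and> x - y \<in> filtration (polyvector_sections \<A>) 1 q"
proof -
  have "x \<in> filtration (polyvector_sections \<A>) 0 q"
    using polyvectors.cycles_filtration[OF x] by simp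
  then obtain x0 where x0: "x0 \<in> polyvector_sections \<A> 0 q"
      "x - x0 \<in> filtration (polyvector_sections \<A>) 1 q"
    by (rule polyvectors.filtration_split) simp
  have form: "x0 \<in> form_sections \<A> 0 q" by (rule column_zero_form[OF x0(1)])
  have "D_form x0 = del_op \<A> x0"
    by (simp add: dbar_closed_leading_part[OF x x0])
  then have "D_form x0 \<in> filtration (form_sections \<A>) 1 (1 + q)"
    using forms.piece_filtration[OF del_op_form_section[OF manifold form]] by simp
  then have "x0 \<in> cycles (form_sections \<A>) D_form 1 0 q"
    using forms.piece_filtration[OF form] by (simp add: cycles_def add.commute)
  from forms.closed_extension_if_degenerate[OF deg[unfolded frolicher_degenerates_at_def] this]
  obtain y where y: "y \<in> filtration (form_sections \<A>) 0 q" "D_form y = 0"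
      "x0 - y \<in> filtration (form_sections \<A>) 1 q"
    by (auto simp only: add_0)
  have "sharp x0 c z = x0 c z" for c z
    unfolding sharp_apply
    by (rule matrix_hom_fix[OF \<Lambda>_bidegree smooth_sectionsD(4)[OF x0(1)[unfolded polyvector_sections_def]]])
  then have "sharp x0 = x0" by (intro ext) (simp only:)
  then have "x - sharp y = (x - x0) + sharp (x0 - y)" by (simp add: sharp_diff)
  then have "x - sharp y \<in> filtration (polyvector_sections \<A>) 1 q"
    using polyvectors.add_filtration[OF x0(2) sharp_filtration[OF y(3)]] by (simp only:)
  moreover have "D_poisson (sharp y) = 0"
    using D_sharp[of y] forms.filtration_ambient y(1,2) sharp_zero by auto
  ultimately show ?thesis using sharp_filtration[OF y(1)] by blast
qed

end

theorem theorem3: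
  fixes X :: "'a topology"
    and \<A> :: "('a, 'n::{finite,linorder}) chart set"
    and \<Lambda> :: "('a, 'n) sect"
  assumes "holomorphic_poisson_manifold X \<A> \<Lambda>"
    and "frolicher_degenerates_at \<A> 1"
  shows "poisson_degenerates_at \<A> \<Lambda> (int CARD('n))"
proof -
  interpret poisson_manifold X \<A> \<Lambda> by unfold_locales (rule assms(1))
  have "1 \<le> int CARD('n)" by (simp add: Suc_leI)
  then show ?thesis
    unfolding poisson_degenerates_at_def
    by (rule polyvectors.degenerates_if_first_column_extends) (rule first_column_extends[OF assms(2)])
qed

end
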